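(* Let $k\ge 2$, $\epsilon>0$ and $u\ge 1$. For every $\epsilon$-locally differentially private mechanism $\mathbf Q$ with input alphabet $\{1,\dots,k\}$, $$\lim_{n\to\infty} r_{k,n}^{\ell_u^u}(\mathbf Q)\, n^{u/2}\ \ge\ k\, C_u\, M(k,\epsilon)^{u/2}.$$
   Context: Let $\mathcal{X}=\{1,\dots,k\}$ and $\Delta_k=\{\mathbf p\in\mathbb R^k: p_i\ge 0,\ \sum_i p_i=1\}$. A privatization mechanism $\mathbf Q:\mathcal X\to\mathcal Y$ is a conditional distribution from $\mathcal X$ to a measurable output space $\mathcal Y$; it is $\epsilon$-locally differentially private if $\mathbf Q(Y\in S\mid X=x)\le e^{\epsilon}\mathbf Q(Y\in S\mid X=x')$ for all $x,x'\in\mathcal X$ and all measurable $S$. Given $\mathbf p\in\Delta_k$, the privatized samples $Y^{(1)},\dots,Y^{(n)}$ are i.i.d. with distribution $\mathbf m(S)=\sum_{i=1}^k\mathbf Q(S\mid i)p_i$. An estimator is a measurable map $\hat{\mathbf p}:\mathcal Y^n\to\mathbb R^k$. For $x\in\mathbb R^k$, $\ell_u^u(x)=\sum_i|x_i|^u$. Define $r_{k,n}^{\ell_u^u}(\mathbf Q)=\inf_{\hat{\mathbf p}}\sup_{\mathbf p\in\Delta_k}\mathbb E_{Y^n\sim\mathbf m^n}\ell_u^u(\hat{\mathbf p}(Y^n)-\mathbf p)$. Let $C_u=\mathbb E|Z|^u=2^{u/2}\Gamma((u+1)/2)/\sqrt\pi$ for $Z\sim\mathcal N(0,1)$. Let $d^\ast\in\arg\min_{1\le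 d\le k-1}\frac{(de^{\epsilon}+k-d)^2}{d(k-d)}$ (ties broken arbitrarily) and $M(k,\epsilon)=\frac{(k-1)^2}{k^2(e^{\epsilon}-1)^2}\cdot\frac{(d^\ast e^{\epsilon}+k-d^\ast)^2}{d^\ast(k-d^\ast)}$. *)

theory Defs
  imports "HOL-Probability.Probability"
begin

definition prob_simplex :: "nat \<Rightarrow> (nat \<Rightarrow> real) set" where
  "prob_simplex k = {p. (\<forall>i\<in>{1..k}. 0 \<le> p i) \<and> (\<Sum>i=1..k. p i) = 1}"

definition is_mechanism :: "nat \<Rightarrow> 'b measure \<Rightarrow> (nat \<Rightarrow> 'b measure) \<Rightarrow> bool" where
  "is_mechanism k Y Q \<longleftrightarrow> (\<forall>x\<in>{1..k}. prob_space (Q x) \<and> sets (Q x) = sets Y)"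

definition ldp :: "real \<Rightarrow> nat \<Rightarrow> 'b measure \<Rightarrow> (nat \<Rightarrow> 'b measure) \<Rightarrow> bool" where
  "ldp \<epsilon> k Y Q \<longleftrightarrow> is_mechanism k Y Q \<and>
     (\<forall>x\<in>{1..k}. \<forall>x'\<in>{1..k}. \<forall>S\<in>sets Y.
        measure (Q x) S \<le> exp \<epsilon> * measure (Q x') S)"

definition mix :: "nat \<Rightarrow> 'b measure \<Rightarrow> (nat \<Rightarrow> 'b measure) \<Rightarrow> (nat \<Rightarrow> real) \<Rightarrow> 'b measure" where
  "mix k Y Q p = measure_of (space Y) (sets Y)
     (\<lambda>S. \<Sum>i=1..k. ennreal (p i) * emeasure (Q i) S)"

definition estimators :: "nat \<Rightarrow> nat \<Rightarrow> 'b measure \<Rightarrow> ((nat \<Rightarrow> 'b) \<Rightarrow> nat \<Rightarrow> real) set" where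
  "estimators k n Y = {ph. \<forall>i\<in>{1..k}. (\<lambda>y. ph y i) \<in> borel_measurable (PiM {..<n} (\<lambda>_. Y))}"

definition lu_loss :: "real \<Rightarrow> nat \<Rightarrow> (nat \<Rightarrow> real) \<Rightarrow> real" where
  "lu_loss u k x = (\<Sum>i=1..k. \<bar>x i\<bar> powr u)"

definition minimax_risk :: "real \<Rightarrow> nat \<Rightarrow> nat \<Rightarrow> 'b measure \<Rightarrow> (nat \<Rightarrow> 'b measure) \<Rightarrow> ennreal" where
  "minimax_risk u k n Y Q =
     (INF ph\<in>estimators k n Y. SUP p\<in>prob_simplex k.
        \<integral>\<^sup>+ y. ennreal (lu_loss u k (\<lambda>i. ph y i - p i)) \<partial>(PiM {..<n} (\<lambda>_. mix k Y Q p)))"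

definition C_u :: "real \<Rightarrow> real" where
  "C_u u = 2 powr (u / 2) * Gamma ((u + 1) / 2) / sqrt pi"

definition M_ke :: "nat \<Rightarrow> real \<Rightarrow> real" where
  "M_ke k \<epsilon> = (real (k - 1))\<^sup>2 / ((real k)\<^sup>2 * (exp \<epsilon> - 1)\<^sup>2) *
     Min ((\<lambda>d. (real d * exp \<epsilon> + real k - real d)\<^sup>2 / (real d * (real k - real d))) ` {1..k-1})"

end

(*
  Let mu be the output law at the uniform input and q_i the density of Q_i with respect to mu, so that
  sum_i q_i = k. Around the uniform distribution take p = 1/k + (theta - mean theta)/sqrt n, whose output
  law has density 1 + sum_j theta_j (q_j - 1)/sqrt n, and give the theta_j independent truncated Gaussian
  priors of precision tau on {-L..L}. Conditionally on the other coordinates, theta_i parametrises a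
  one-dimensional locally asymptotically normal family with information V_i = integral (q_i - 1)^2 dmu,
  so the rescaled Bayes risk for p_i is asymptotically at least
  (1 - 1/k)^u C_u (V_i + tau)^(-u/2) as L tends to infinity. Here u >= 1 enters through
  2|s|^u <= |a - s|^u + |a + s|^u, which makes the centre of a symmetric weight its best point estimate.
  Convexity of x^(-u/2) turns sum_i V_i <= k v into the sum bound, and the privacy constraint gives the
  pointwise bound sum_i (q_i - 1)^2 <= k v because a convex function on a box is maximal at a vertex.
*)

theory Submission
  imports Defs "HOL-Real_Asymp.Real_Asymp"
begin

section \<open>Elementary inequalities\<close>

text \<open>The i-th scalar problem reveals the other \<open>\<theta> j\<close> to the statistician.
  This costs nothing where it matters: for a mechanism symmetric in the symbols the information
  matrix is a multiple of the projection orthogonal to (1,...,1), and the i-th unit vector minus its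
  mean is the least favourable direction for p_i. Keeping k redundant parameters preserves the
  symmetry between symbols. One product prior serves all k coordinates, so the scalar bounds add up
  under a single average. Only a lower bound for the likelihood is required, so a one-sided
  elementary estimate of ln (1 + x) replaces a full expansion. Truncation keeps the perturbed points
  in the simplex and makes the limit functional bounded and continuous, as weak convergence
  requires.\<close>

lemma sum_of_squares_le_square_sum:
  fixes q :: "'i \<Rightarrow> real"
  assumes "finite I" "\<And>i. i \<in> I \<Longrightarrow> 0 \<le> q i"
  shows "(\<Sum>i\<in>I. (q i)\<^sup>2) \<le> (\<Sum>i\<in>I. q i)\<^sup>2"
  using assms
proof (induction I rule: finite_induct)
  case (insert a I)
  have "0 \<le> 2 * q a * (\<Sum>i\<in>I. q i)" using insert by (intro mult_nonneg_nonneg sum_nonneg) auto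
  then show ?case using insert by (simp add: power2_sum)
qed auto

text \<open>With the other coordinates frozen, left side minus right side is a quadratic with
  leading coefficient \<open>card I - c\<close>, hence convex for \<open>c \<le> card I\<close>, so
  one coordinate at a time can be pushed to an endpoint. The inequality is homogeneous and free of a
  constraint on the sum, since such a constraint would not survive moving a single
  coordinate.\<close>

lemma sum_squares_le_of_box_vertices:
  fixes q :: "'i \<Rightarrow> real"
  assumes "finite I" and m: "0 \<le> m" "m \<le> M"
    and vertex: "\<And>v. (\<And>i. i \<in> I \<Longrightarrow> v i = m \<or> v i = M) \<Longrightarrow>
      real (card I) * (\<Sum>i\<in>I. (v i)\<^sup>2) \<le> c * (\<Sum>i\<in>I. v i)\<^sup>2"
    and q: "\<And>i. i \<in> I \<Longrightarrow> m \<le> q i \<and> q i \<le> M"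
  shows "real (card I) * (\<Sum>i\<in>I. (q i)\<^sup>2) \<le> c * (\<Sum>i\<in>I. q i)\<^sup>2"
proof (cases "c \<le> real (card I)")
  case True
  \<comment> \<open>\<open>A\<close> holds the coordinates not yet known to sit at an endpoint; the
    induction pins them one by one, and for empty \<open>A\<close> the vertex hypothesis
    applies.\<close>
  have "real (card I) * (\<Sum>i\<in>I. (q i)\<^sup>2) \<le> c * (\<Sum>i\<in>I. q i)\<^sup>2"
    if "A \<subseteq> I" "\<And>i. i \<in> A \<Longrightarrow> m \<le> q i \<and> q i \<le> M" "\<And>i. i \<in> I - A \<Longrightarrow> q i = m \<or> q i = M" for A q
    using finite_subset[OF that(1) assms(1)] that
  proof (induction A arbitrary: q rule: finite_induct)
    case empty
    then show ?case by (intro vertex) auto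
  next
    case (insert a A)
    define s where "s = (\<Sum>i\<in>I-{a}. (q i)\<^sup>2)"
    define r where "r = (\<Sum>i\<in>I-{a}. q i)"
    have a: "a \<in> I" using insert.prems by auto
    have eq: "(\<Sum>i\<in>I. ((q(a:=x)) i)\<^sup>2) = x\<^sup>2 + s" "(\<Sum>i\<in>I. (q(a:=x)) i) = x + r" for x
      using assms(1) a unfolding s_def r_def
      by (subst sum.remove[of _ a]; auto intro!: sum.cong)+
    have IH: "real (card I) * (x\<^sup>2 + s) \<le> c * (x + r)\<^sup>2" if "x = m \<or> x = M" for x
    proof -
      have "real (card I) * (\<Sum>i\<in>I. ((q(a:=x)) i)\<^sup>2) \<le> c * (\<Sum>i\<in>I. (q(a:=x)) i)\<^sup>2"
      proof (rule insert.IH)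
        show "A \<subseteq> I" using insert.prems by auto
        show "m \<le> (q(a:=x)) i \<and> (q(a:=x)) i \<le> M" if "i \<in> A" for i
          using insert.prems(2)[of i] insert.hyps that by auto
        show "(q(a:=x)) i = m \<or> (q(a:=x)) i = M" if "i \<in> I - A" for i
          using insert.prems(3)[of i] \<open>x = m \<or> x = M\<close> that by auto
      qed
      then show ?thesis unfolding eq .
    qed
    \<comment> \<open>Barycentric weight of \<open>q a\<close> between the endpoints; the value 0
      serves the degenerate box \<open>m = M\<close>.\<close>
    define t where "t = (if m = M then 0 else (q a - m) / (M - m))"
    have qa: "m \<le> q a" "q a \<le> M" using insert.prems by auto
    have t: "0 \<le> t" "t \<le> 1" "q a = (1-t) * m + t * M"
      using qa m by (auto simp: t_def field_simps)
    let ?K = "real (card I)"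
    have "?K * ((q a)\<^sup>2 + s) - c * (q a + r)\<^sup>2 =
       (1-t) * (?K * (m\<^sup>2 + s) - c * (m + r)\<^sup>2) + t * (?K * (M\<^sup>2 + s) - c * (M + r)\<^sup>2)
        - (?K - c) * (t * (1-t) * (M - m)\<^sup>2)"
      unfolding t(3) by (simp add: algebra_simps power2_eq_square)
    also have "\<dots> \<le> 0"
    proof -
      have "(1-t) * (?K * (m\<^sup>2 + s) - c * (m + r)\<^sup>2) \<le> 0" "t * (?K * (M\<^sup>2 + s) - c * (M + r)\<^sup>2) \<le> 0"
        using IH[of m] IH[of M] t by (auto intro!: mult_nonneg_nonpos)
      moreover have "0 \<le> (?K - c) * (t * (1-t) * (M - m)\<^sup>2)" using t True by simp
      ultimately show ?thesis by linarith
    qed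
    finally show ?case using eq[of "q a"] by simp
  qed
  from this[of I q] q show ?thesis by auto
next
  case False
  have q0: "0 \<le> q i" if "i \<in> I" for i using q[OF that] m by linarith
  \<comment> \<open>Convexity fails for \<open>c > card I\<close>, but then the crude comparison of
    the sum of squares with the squared sum is enough.\<close>
  have "real (card I) * (\<Sum>i\<in>I. (q i)\<^sup>2) \<le> c * (\<Sum>i\<in>I. (q i)\<^sup>2)"
    using False by (intro mult_right_mono sum_nonneg) auto
  also have "\<dots> \<le> c * (\<Sum>i\<in>I. q i)\<^sup>2"
    using False assms(1) q0 by (intro mult_left_mono sum_of_squares_le_square_sum) auto
  finally show ?thesis .
qed

text \<open>Lower half of the second-order expansion of \<open>ln (1 + x)\<close>. For
  \<open>x \<ge> 0\<close> the quadratic polynomial alone lies below the logarithm; for negative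
  \<open>x\<close> the cubic term pays for the remainder, the derivative
  \<open>y\<^sup>2 * (2 - 3 * y)/(1 - y)\<close> being nonnegative up to
  \<open>y = 2/3\<close>.\<close>

lemma one_plus_ge_exp_cubic:
  fixes x :: real
  assumes "\<bar>x\<bar> \<le> 1/2"
  shows "exp (x - x\<^sup>2/2 - \<bar>x\<bar>^3) \<le> 1 + x"
proof -
  have "x - x\<^sup>2/2 - \<bar>x\<bar>^3 \<le> ln (1 + x)"
  proof (cases "x \<ge> 0")
    case True
    have "ln (1 + 0) - 0 + 0\<^sup>2/2 \<le> ln (1 + x) - x + x\<^sup>2/2"
    proof (rule DERIV_nonneg_imp_nondecreasing[OF True])
      fix y :: real assume y: "0 \<le> y" "y \<le> x"
      have "((\<lambda>y. ln (1 + y) - y + y\<^sup>2/2) has_real_derivative (1/(1+y) - 1 + y)) (at y)"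
        using y by (auto intro!: derivative_eq_intros simp: field_simps)
      moreover have "1/(1+y) - 1 + y = y\<^sup>2/(1+y)" using y by (simp add: field_simps power2_eq_square)
      ultimately show "\<exists>d. ((\<lambda>y. ln (1 + y) - y + y\<^sup>2/2) has_real_derivative d) (at y) \<and> 0 \<le> d"
        using y by auto
    qed
    then have "0 \<le> ln (1 + x) - x + x\<^sup>2/2" by simp
    moreover have "0 \<le> \<bar>x\<bar>^3" by simp
    ultimately show ?thesis by linarith
  next
    case False
    define z where "z = - x"
    have z: "0 \<le> z" "z \<le> 1/2" using False assms by (auto simp: z_def)
    have "ln (1 - 0) + 0 + 0\<^sup>2/2 + 0^3 \<le> ln (1 - z) + z + z\<^sup>2/2 + z^3"
    proof (rule DERIV_nonneg_imp_nondecreasing[OF z(1)])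
      fix y :: real assume y: "0 \<le> y" "y \<le> z"
      have "((\<lambda>y. ln (1 - y) + y + y\<^sup>2/2 + y^3) has_real_derivative (-1/(1-y) + 1 + y + 3*y\<^sup>2)) (at y)"
        using y z by (auto intro!: derivative_eq_intros simp: field_simps)
      moreover have "-1/(1-y) + 1 + y + 3*y\<^sup>2 = y\<^sup>2 * (2 - 3 * y)/(1-y)"
        using y z by (simp add: field_simps power2_eq_square)
      ultimately show "\<exists>d. ((\<lambda>y. ln (1 - y) + y + y\<^sup>2/2 + y^3) has_real_derivative d) (at y) \<and> 0 \<le> d"
        using y z by auto
    qed
    then show ?thesis using False by (simp add: z_def)
  qed
  then show ?thesis using assms by (subst (asm) ln_ge_iff) auto
qed

text \<open>Since 2s is the difference of a + s and a - s, |s| is at most the mean of |a - s| and |a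
  + s|; monotonicity and midpoint convexity of the power do the rest.\<close>

lemma powr_abs_symmetrization:
  fixes a s u :: real
  assumes "u \<ge> 1"
  shows "2 * \<bar>s\<bar> powr u \<le> \<bar>a - s\<bar> powr u + \<bar>a + s\<bar> powr u"
proof -
  have conv: "((x + y) / 2) powr u \<le> (x powr u + y powr u) / 2" if "0 \<le> x" "0 \<le> y" for x y :: real
  proof (cases "x = 0 \<or> y = 0")
    case True
    \<comment> \<open>With an endpoint 0, outside the domain \<open>{0<..}\<close> of the convexity
      used below, the claim reduces to \<open>2 \<le> 2 powr u\<close>.\<close>
    have "(w / 2) powr u \<le> w powr u / 2" if "0 \<le> w" for w :: real
    proof -
      have "2 powr 1 \<le> 2 powr u" using assms by (intro powr_mono) auto
      then have "w powr u * 2 \<le> w powr u * 2 powr u" by (intro mult_left_mono) auto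
      then show ?thesis using that by (simp add: powr_divide field_simps)
    qed
    then show ?thesis using True that by auto
  next
    case False
    then have "x \<in> {0<..}" "y \<in> {0<..}" using that by auto
    from convex_onD[OF powr_convex[OF assms], of "1/2" x y] this show ?thesis
      by (simp add: field_simps)
  qed
  have "\<bar>s\<bar> powr u \<le> ((\<bar>a - s\<bar> + \<bar>a + s\<bar>) / 2) powr u"
    using assms by (intro powr_mono2) auto
  also have "\<dots> \<le> (\<bar>a - s\<bar> powr u + \<bar>a + s\<bar> powr u) / 2" by (intro conv) auto
  finally show ?thesis by simp
qed

text \<open>Completing the square recentres the tilted Gaussian weight at \<open>x / W\<close>.\<close>

lemma gaussian_tilt_risk_lower:
  fixes a L W u x :: real
  assumes "u \<ge> 1" "L > 0" "W > 0"
  shows "ennreal (exp (x\<^sup>2/(2*W)) * max 0 (1 - 2*\<bar>x\<bar>/(W*L))) *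
      (\<integral>\<^sup>+s. ennreal (\<bar>s\<bar> powr u * exp (- W * s\<^sup>2/2)) * indicator {-L/2..L/2} s \<partial>lborel)
    \<le> (\<integral>\<^sup>+\<theta>. ennreal (\<bar>a - \<theta>\<bar> powr u * exp (\<theta> * x - W * \<theta>\<^sup>2/2)) * indicator {-L..L} \<theta> \<partial>lborel)"
\<comment> \<open>The factor with \<open>max 0\<close> is a continuous substitute for the indicator
  of this condition: it vanishes outside, is at most 1 inside, and its continuity lets weak
  convergence act on it later.\<close>
proof (cases "\<bar>x\<bar>/W \<le> L/2")
  case False
  then have "1 - 2*\<bar>x\<bar>/(W*L) \<le> 0" using assms by (simp add: field_simps)
  then show ?thesis by simp
next
  case True
  then have xW: "\<bar>x/W\<bar> \<le> L/2" using assms by simp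
  define b where "b = a - x/W"
  let ?g = "\<lambda>s. exp (- W * s\<^sup>2/2)"
  define J where "J = (\<integral>\<^sup>+s. ennreal (\<bar>b - s\<bar> powr u * ?g s) * indicator {-L/2..L/2} s \<partial>lborel)"
  define K where "K = (\<integral>\<^sup>+s. ennreal (\<bar>s\<bar> powr u * ?g s) * indicator {-L/2..L/2} s \<partial>lborel)"
  have sq: "(x/W + s) * x - W*(x/W + s)\<^sup>2/2 = x\<^sup>2/(2*W) - W * s\<^sup>2/2" for s
    using assms by (simp add: field_simps power2_eq_square)
  have "(\<integral>\<^sup>+\<theta>. ennreal (\<bar>a - \<theta>\<bar> powr u * exp (\<theta> * x - W * \<theta>\<^sup>2/2)) * indicator {-L..L} \<theta> \<partial>lborel)
    = (\<integral>\<^sup>+s. ennreal (\<bar>b - s\<bar> powr u * exp (x\<^sup>2/(2*W) - W * s\<^sup>2/2)) * indicator {-L..L} (x/W + s) \<partial>lborel)"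
    by (subst nn_integral_real_affine[where c=1 and t="x/W"])
       (auto simp: sq[simplified] b_def diff_diff_eq)
  also have "\<dots> \<ge> (\<integral>\<^sup>+s. ennreal (exp (x\<^sup>2/(2*W))) * (ennreal (\<bar>b - s\<bar> powr u * ?g s) * indicator {-L/2..L/2} s) \<partial>lborel)"
  proof (intro nn_integral_mono)
    fix s :: real
    have "exp (x\<^sup>2/(2*W)) * (\<bar>b - s\<bar> powr u * ?g s) = \<bar>b - s\<bar> powr u * exp (x\<^sup>2/(2*W) - W * s\<^sup>2/2)"
      using mult_exp_exp[of "x\<^sup>2/(2*W)" "- W * s\<^sup>2/2"] by (simp add: mult.left_commute)
    \<comment> \<open>A window of half-width \<open>L/2\<close> around the centre
      \<open>x/W\<close>, itself within \<open>L/2\<close> of 0, stays inside the support of the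
      prior.\<close>
    moreover have "x/W + s \<in> {-L..L}" if "s \<in> {-L/2..L/2}"
      using that xW unfolding atLeastAtMost_iff abs_le_iff by linarith
    ultimately show "ennreal (exp (x\<^sup>2/(2*W))) * (ennreal (\<bar>b - s\<bar> powr u * ?g s) * indicator {-L/2..L/2} s)
        \<le> ennreal (\<bar>b - s\<bar> powr u * exp (x\<^sup>2/(2*W) - W * s\<^sup>2/2)) * indicator {-L..L} (x/W + s)"
      by (auto simp: indicator_def ennreal_mult'[symmetric] mult.left_commute)
  qed
  also have "(\<integral>\<^sup>+s. ennreal (exp (x\<^sup>2/(2*W))) * (ennreal (\<bar>b - s\<bar> powr u * ?g s) * indicator {-L/2..L/2} s) \<partial>lborel)
      = ennreal (exp (x\<^sup>2/(2*W))) * J"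
    unfolding J_def by (intro nn_integral_cmult) auto
  finally have 1: "ennreal (exp (x\<^sup>2/(2*W))) * J \<le> (\<integral>\<^sup>+\<theta>. ennreal (\<bar>a - \<theta>\<bar> powr u * exp (\<theta> * x - W * \<theta>\<^sup>2/2)) * indicator {-L..L} \<theta> \<partial>lborel)" .
  \<comment> \<open>Reflection of \<open>s\<close> preserves weight and window, so \<open>J\<close>
    is also the integral of the mean of \<open>\<bar>b - s\<bar> powr u\<close> and
    \<open>\<bar>b + s\<bar> powr u\<close>, to which the symmetrization applies.\<close>
  have J': "J = (\<integral>\<^sup>+s. ennreal (\<bar>b + s\<bar> powr u * ?g s) * indicator {-L/2..L/2} s \<partial>lborel)"
    unfolding J_def by (subst nn_integral_real_affine[where c="-1" and t=0])
      (auto intro!: nn_integral_cong simp: indicator_def)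
  have "2 * K = (\<integral>\<^sup>+s. ennreal (2 * \<bar>s\<bar> powr u * ?g s) * indicator {-L/2..L/2} s \<partial>lborel)"
    unfolding K_def by (subst nn_integral_cmult[symmetric])
      (auto intro!: nn_integral_cong simp: ennreal_mult' mult.assoc)
  also have "\<dots> \<le> (\<integral>\<^sup>+s. ennreal (\<bar>b - s\<bar> powr u * ?g s) * indicator {-L/2..L/2} s +
       ennreal (\<bar>b + s\<bar> powr u * ?g s) * indicator {-L/2..L/2} s \<partial>lborel)"
  proof (intro nn_integral_mono)
    fix s :: real
    have "2 * \<bar>s\<bar> powr u * ?g s \<le> (\<bar>b - s\<bar> powr u + \<bar>b + s\<bar> powr u) * ?g s"
      using powr_abs_symmetrization[OF assms(1)] by (intro mult_right_mono) auto
    then show "ennreal (2 * \<bar>s\<bar> powr u * ?g s) * indicator {-L/2..L/2} s \<le>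
       ennreal (\<bar>b - s\<bar> powr u * ?g s) * indicator {-L/2..L/2} s +
       ennreal (\<bar>b + s\<bar> powr u * ?g s) * indicator {-L/2..L/2} s"
      by (auto simp: indicator_def ennreal_plus[symmetric] distrib_right simp del: ennreal_plus intro!: ennreal_leI)
  qed
  also have "\<dots> = J + J"
    by (subst nn_integral_add) (simp_all only: J'[symmetric] J_def[symmetric], auto)
  finally have "2 * K \<le> 2 * J" by (simp add: mult_2)
  then have KJ: "K \<le> J" by (subst (asm) ennreal_mult_le_mult_iff) auto
  have "exp (x\<^sup>2/(2*W)) * max 0 (1 - 2*\<bar>x\<bar>/(W*L)) \<le> exp (x\<^sup>2/(2*W)) * 1"
    using assms by (intro mult_left_mono) auto
  then have "ennreal (exp (x\<^sup>2/(2*W)) * max 0 (1 - 2*\<bar>x\<bar>/(W*L))) * K \<le> ennreal (exp (x\<^sup>2/(2*W))) * J"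
    using KJ by (intro mult_mono ennreal_leI) auto
  with 1 show ?thesis unfolding K_def by order
qed

section \<open>Gaussian integrals\<close>

lemma nn_integral_even:
  fixes f :: "real \<Rightarrow> ennreal"
  assumes [measurable]: "f \<in> borel_measurable borel" and even: "\<And>x. f (- x) = f x"
  shows "(\<integral>\<^sup>+x. f x \<partial>lborel) = 2 * (\<integral>\<^sup>+x. f x * indicator {0..} x \<partial>lborel)"
proof -
  have neg: "(\<integral>\<^sup>+x. f x * indicator {..0} x \<partial>lborel) = (\<integral>\<^sup>+x. f x * indicator {0..} x \<partial>lborel)"
    by (subst nn_integral_real_affine[where c="-1" and t=0])
      (auto intro!: nn_integral_cong simp: indicator_def even)
  have "(\<integral>\<^sup>+x. f x \<partial>lborel) = (\<integral>\<^sup>+x. f x * indicator {0..} x + f x * indicator {..0} x \<partial>lborel)"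
    by (rule nn_integral_cong_AE) (use AE_lborel_singleton[of "0::real"] in eventually_elim, auto simp: indicator_def)
  also have "\<dots> = 2 * (\<integral>\<^sup>+x. f x * indicator {0..} x \<partial>lborel)"
    by (subst nn_integral_add) (auto simp: neg mult_2)
  finally show ?thesis .
qed

text \<open>The substitution \<open>t = s\<^sup>2/2\<close> turns the Gamma integral at
  \<open>a = (u+1)/2\<close> into the half-line moment, and evenness doubles it. It is carried out
  on bounded intervals \<open>{0..r}\<close>, followed by monotone convergence. The value is
  \<open>sqrt (2 * pi) * C_u u\<close>.\<close>

lemma nn_integral_abs_powr_gaussian_std:
  fixes u :: real
  assumes "u > -1"
  shows "(\<integral>\<^sup>+s. ennreal (\<bar>s\<bar> powr u * exp (- s\<^sup>2/2)) \<partial>lborel) = ennreal (2 powr ((u+1)/2) * Gamma ((u+1)/2))"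
proof -
  define a where "a = (u+1)/2"
  have a: "a > 0" using assms by (simp add: a_def)
  let ?f = "\<lambda>t::real. t powr (a - 1) / exp t"
  let ?h = "\<lambda>s::real. s powr u * exp (- s\<^sup>2/2)"
  have eq: "(\<integral>\<^sup>+t. ennreal (?f t * indicator {0..(real r)\<^sup>2/2} t) \<partial>lborel)
      = ennreal (2 powr (1 - a)) * (\<integral>\<^sup>+s. ennreal (?h s) * indicator {0..real r} s \<partial>lborel)" for r
  proof -
    have "(\<integral>\<^sup>+t. ennreal (?f t * indicator {(0::real)\<^sup>2/2..(real r)\<^sup>2/2} t) \<partial>lborel)
      = (\<integral>\<^sup>+s. ennreal (?f (s\<^sup>2/2) * s * indicator {0..real r} s) \<partial>lborel)"
      by (rule nn_integral_substitution)
        (auto intro!: derivative_eq_intros continuous_intros simp: set_borel_measurable_def)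
    also have "\<dots> = (\<integral>\<^sup>+s. ennreal (2 powr (1 - a)) * (ennreal (?h s) * indicator {0..real r} s) \<partial>lborel)"
    proof (intro nn_integral_cong)
      fix s :: real
      have "?f (s\<^sup>2/2) * s = 2 powr (1 - a) * ?h s" if "s > 0"
      proof -
        have "(s\<^sup>2/2) powr (a - 1) = s powr (2 * (a - 1)) * 2 powr (1 - a)"
        proof -
          have "(s\<^sup>2/2) powr (a - 1) = (s powr 2) powr (a - 1) / 2 powr (a - 1)"
            using that by (simp add: powr_divide)
          then show ?thesis using powr_minus_divide[of 2 "a - 1"] by (simp only: powr_powr) simp
        qed
        moreover have "s powr (2 * (a - 1)) * s = s powr u"
        proof -
          have "1 + 2 * (a - 1) = u" by (simp add: a_def field_simps)
          then show ?thesis using that powr_mult_base[of s "2 * (a - 1)"] by (simp only: mult.commute)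
        qed
        ultimately show ?thesis by (simp add: exp_minus field_simps)
      qed
      then show "ennreal (?f (s\<^sup>2/2) * s * indicator {0..real r} s) = ennreal (2 powr (1 - a)) * (ennreal (?h s) * indicator {0..real r} s)"
        by (cases "s > 0") (auto simp: indicator_def ennreal_mult'[symmetric])
    qed
    also have "\<dots> = ennreal (2 powr (1 - a)) * (\<integral>\<^sup>+s. ennreal (?h s) * indicator {0..real r} s \<partial>lborel)"
      by (intro nn_integral_cmult) auto
    finally show ?thesis by simp
  qed
  have L1: "(\<lambda>r. \<integral>\<^sup>+t. ennreal (?f t * indicator {0..(real r)\<^sup>2/2} t) \<partial>lborel) \<longlonglongrightarrow> (\<integral>\<^sup>+t. ennreal (indicator {0..} t * t powr (a - 1) / exp t) \<partial>lborel)"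
  proof (rule nn_integral_LIMSEQ)
    show "incseq (\<lambda>r t. ennreal (?f t * indicator {0..(real r)\<^sup>2/2} t))"
      unfolding incseq_def le_fun_def
    proof (intro allI impI ennreal_leI mult_left_mono)
      fix m n :: nat and t :: real assume "m \<le> n"
      then have "(real m)\<^sup>2/2 \<le> (real n)\<^sup>2/2" by (simp add: power_mono)
      then show "indicat_real {0..(real m)\<^sup>2/2} t \<le> indicat_real {0..(real n)\<^sup>2/2} t"
        by (intro indicator_leI) (unfold atLeastAtMost_iff, linarith)
    qed auto
    show "(\<lambda>r. ennreal (?f t * indicator {0..(real r)\<^sup>2/2} t)) \<longlonglongrightarrow> ennreal (indicator {0..} t * t powr (a - 1) / exp t)" for t
    proof (rule tendsto_eventually)
      \<comment> \<open>For \<open>r \<ge> 1\<close> one has \<open>r \<le> r * r\<close>, so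
        \<open>2 * \<bar>t\<bar> \<le> r\<close> already puts \<open>t\<close> below
        \<open>r\<^sup>2/2\<close>.\<close>
      obtain N where N: "2 * \<bar>t\<bar> \<le> real N" "1 \<le> N" using real_arch_simple[of "max 1 (2 * \<bar>t\<bar>)"] by auto
      show "\<forall>\<^sub>F r in sequentially. ennreal (?f t * indicator {0..(real r)\<^sup>2/2} t) = ennreal (indicator {0..} t * t powr (a - 1) / exp t)"
      proof (rule eventually_sequentiallyI[of N])
        fix r assume "N \<le> r"
        then have "2 * \<bar>t\<bar> \<le> real r * 1" and "1 \<le> real r" using N by linarith+
        moreover have "real r * 1 \<le> real r * real r" using \<open>1 \<le> real r\<close> by (intro mult_left_mono) auto
        ultimately have "2 * \<bar>t\<bar> \<le> real r * real r" by linarith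
        then show "ennreal (?f t * indicator {0..(real r)\<^sup>2/2} t) = ennreal (indicator {0..} t * t powr (a - 1) / exp t)"
          by (auto simp: indicator_def power2_eq_square)
      qed
    qed
  qed auto
  have L2: "(\<lambda>r. \<integral>\<^sup>+s. ennreal (?h s) * indicator {0..real r} s \<partial>lborel) \<longlonglongrightarrow> (\<integral>\<^sup>+s. ennreal (?h s) * indicator {0..} s \<partial>lborel)"
  proof (rule nn_integral_LIMSEQ)
    show "incseq (\<lambda>r s. ennreal (?h s) * indicator {0..real r} s)"
      by (auto simp: incseq_def le_fun_def indicator_def)
    show "(\<lambda>r. ennreal (?h t) * indicator {0..real r} t) \<longlonglongrightarrow> ennreal (?h t) * indicator {0..} t" for t
    proof (rule tendsto_eventually)
      obtain N where N: "\<bar>t\<bar> \<le> real N" using real_arch_simple by auto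
      show "\<forall>\<^sub>F r in sequentially. ennreal (?h t) * indicator {0..real r} t = ennreal (?h t) * indicator {0..} t"
        by (rule eventually_sequentiallyI[of N]) (use N in \<open>auto simp: indicator_def\<close>)
    qed
  qed auto
  have "ennreal (Gamma a) = ennreal (2 powr (1 - a)) * (\<integral>\<^sup>+s. ennreal (?h s) * indicator {0..} s \<partial>lborel)"
    unfolding Gamma_conv_nn_integral_real[OF a]
    by (rule LIMSEQ_unique[OF L1]) (unfold eq, intro ennreal_tendsto_cmult L2, simp)
  then have "ennreal (2 powr a) * ennreal (Gamma a) = (ennreal (2 powr a) * ennreal (2 powr (1 - a))) * (\<integral>\<^sup>+s. ennreal (?h s) * indicator {0..} s \<partial>lborel)"
    by (simp add: mult.assoc)
  also have "ennreal (2 powr a) * ennreal (2 powr (1 - a)) = 2"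
    by (simp add: ennreal_mult'[symmetric] powr_add[symmetric])
  also have "2 * (\<integral>\<^sup>+s. ennreal (?h s) * indicator {0..} s \<partial>lborel) = (\<integral>\<^sup>+s. ennreal (\<bar>s\<bar> powr u * exp (- s\<^sup>2/2)) \<partial>lborel)"
    by (subst nn_integral_even[of "\<lambda>s. ennreal (\<bar>s\<bar> powr u * exp (- s\<^sup>2/2))"])
      (auto intro!: arg_cong[where f="(*) 2"] nn_integral_cong simp: indicator_def)
  finally show ?thesis using a by (simp add: a_def ennreal_mult'[symmetric])
qed

lemma nn_integral_abs_powr_gaussian:
  fixes u W :: real
  assumes "u > -1" "W > 0"
  shows "(\<integral>\<^sup>+s. ennreal (\<bar>s\<bar> powr u * exp (- W * s\<^sup>2/2)) \<partial>lborel)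
    = ennreal (W powr (-(u+1)/2) * (2 powr ((u+1)/2) * Gamma ((u+1)/2)))"
proof -
  let ?c = "1 / sqrt W"
  have c: "?c > 0" using assms by simp
  have "(\<integral>\<^sup>+s. ennreal (\<bar>s\<bar> powr u * exp (- W * s\<^sup>2/2)) \<partial>lborel)
      = ennreal ?c * (\<integral>\<^sup>+s. ennreal (\<bar>?c * s\<bar> powr u * exp (- W * (?c * s)\<^sup>2/2)) \<partial>lborel)"
    using c by (subst nn_integral_real_affine[where c="?c" and t=0]) auto
  also have "(\<integral>\<^sup>+s. ennreal (\<bar>?c * s\<bar> powr u * exp (- W * (?c * s)\<^sup>2/2)) \<partial>lborel) =
     (\<integral>\<^sup>+s. ennreal (?c powr u) * ennreal (\<bar>s\<bar> powr u * exp (- s\<^sup>2/2)) \<partial>lborel)"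
    using assms c by (intro nn_integral_cong)
      (auto simp: ennreal_mult'[symmetric] abs_mult powr_divide power_mult_distrib power_divide)
  also have "\<dots> = ennreal (?c powr u) * ennreal (2 powr ((u+1)/2) * Gamma ((u+1)/2))"
    using assms by (subst nn_integral_cmult) (auto simp: nn_integral_abs_powr_gaussian_std[simplified])
  also have "ennreal ?c * (ennreal (?c powr u) * ennreal (2 powr ((u+1)/2) * Gamma ((u+1)/2))) =
     ennreal ((?c * ?c powr u) * (2 powr ((u+1)/2) * Gamma ((u+1)/2)))"
    using c by (simp add: ennreal_mult'[symmetric] mult.assoc)
  also have "?c * ?c powr u = W powr (-(u+1)/2)"
  proof -
    have "?c = W powr (-1/2)" using assms by (simp add: powr_minus_divide powr_half_sqrt)
    then have "?c * ?c powr u = W powr (-1/2) * (W powr (-1/2)) powr u" by metis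
    also have "\<dots> = W powr (-1/2 + -1/2 * u)" unfolding powr_powr powr_add ..
    also have "-1/2 + -1/2 * u = -(u+1)/2" by (simp add: field_simps)
    finally show ?thesis .
  qed
  finally show ?thesis .
qed

text \<open>Monotone convergence along growing windows. The half-width \<open>Suc m\<close> is
  \<open>L/2\<close> for the truncation level \<open>L = 2 * Suc m\<close> of the main
  proof.\<close>

lemma truncated_moment_tendsto:
  fixes u W :: real
  shows "(\<lambda>m. \<integral>\<^sup>+s. ennreal (\<bar>s\<bar> powr u * exp (- W * s\<^sup>2/2)) * indicator {- real (Suc m)..real (Suc m)} s \<partial>lborel)
    \<longlonglongrightarrow> (\<integral>\<^sup>+s. ennreal (\<bar>s\<bar> powr u * exp (- W * s\<^sup>2/2)) \<partial>lborel)"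
proof (rule nn_integral_LIMSEQ)
  show "incseq (\<lambda>m s. ennreal (\<bar>s\<bar> powr u * exp (- W * s\<^sup>2/2)) * indicator {- real (Suc m)..real (Suc m)} s)"
    by (auto simp: incseq_def le_fun_def indicator_def)
  show "(\<lambda>m. ennreal (\<bar>s\<bar> powr u * exp (- W * s\<^sup>2/2)) * indicator {- real (Suc m)..real (Suc m)} s) \<longlonglongrightarrow>
     ennreal (\<bar>s\<bar> powr u * exp (- W * s\<^sup>2/2))" for s
  proof (rule tendsto_eventually)
    obtain N where N: "\<bar>s\<bar> \<le> real N" using real_arch_simple by auto
    show "\<forall>\<^sub>F m in sequentially. ennreal (\<bar>s\<bar> powr u * exp (- W * s\<^sup>2/2)) * indicator {- real (Suc m)..real (Suc m)} s =
       ennreal (\<bar>s\<bar> powr u * exp (- W * s\<^sup>2/2))"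
      by (rule eventually_sequentiallyI[of N]) (use N in \<open>auto simp: indicator_def\<close>)
  qed
qed auto

text \<open>Without the cut-off this is the expectation of \<open>exp (V * z\<^sup>2/(2*W))\<close>,
  a Gaussian integral of precision \<open>1 - V/W = \<tau>/W\<close>, finite because
  \<open>\<tau>\<close> is positive. The cut-off factor increases to 1 with \<open>m\<close>, so the
  convergence is monotone.\<close>

lemma gaussian_exp_quadratic_tendsto:
  fixes V \<tau> :: real
  assumes "V \<ge> 0" "\<tau> > 0"
  defines "W \<equiv> V + \<tau>"
  shows "(\<lambda>m. \<integral>\<^sup>+z. ennreal (exp ((sqrt V * z)\<^sup>2/(2*W)) * max 0 (1 - \<bar>sqrt V * z\<bar>/(W * real (Suc m)))) \<partial>std_normal_distribution)
    \<longlonglongrightarrow> ennreal (sqrt (W / \<tau>))"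
proof -
  have W: "W > 0" using assms by simp
  have "(\<lambda>m. \<integral>\<^sup>+z. ennreal (exp ((sqrt V * z)\<^sup>2/(2*W)) * max 0 (1 - \<bar>sqrt V * z\<bar>/(W * real (Suc m)))) \<partial>std_normal_distribution)
    \<longlonglongrightarrow> (\<integral>\<^sup>+z. ennreal (exp ((sqrt V * z)\<^sup>2/(2*W))) \<partial>std_normal_distribution)"
  proof (rule nn_integral_LIMSEQ)
    show "incseq (\<lambda>m z. ennreal (exp ((sqrt V * z)\<^sup>2/(2*W)) * max 0 (1 - \<bar>sqrt V * z\<bar>/(W * real (Suc m)))))"
      unfolding incseq_def le_fun_def
    proof (intro allI impI ennreal_leI mult_left_mono max.mono diff_left_mono)
      fix m n :: nat and z assume "m \<le> n"
      then have "W * real (Suc m) \<le> W * real (Suc n)" using W by auto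
      then show "\<bar>sqrt V * z\<bar>/(W * real (Suc n)) \<le> \<bar>sqrt V * z\<bar>/(W * real (Suc m))"
        using W by (intro divide_left_mono) auto
    qed auto
    show "(\<lambda>m. ennreal (exp ((sqrt V * z)\<^sup>2/(2*W)) * max 0 (1 - \<bar>sqrt V * z\<bar>/(W * real (Suc m))))) \<longlonglongrightarrow> ennreal (exp ((sqrt V * z)\<^sup>2/(2*W)))" for z
    proof -
      have "(\<lambda>m. \<bar>sqrt V * z\<bar>/W * (1 / real (Suc m))) \<longlonglongrightarrow> \<bar>sqrt V * z\<bar>/W * 0"
        by (intro tendsto_mult tendsto_const LIMSEQ_Suc[OF lim_1_over_n])
      then have "(\<lambda>m. \<bar>sqrt V * z\<bar>/(W * real (Suc m))) \<longlonglongrightarrow> 0" by simp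
      then have "(\<lambda>m. exp ((sqrt V * z)\<^sup>2/(2*W)) * max 0 (1 - \<bar>sqrt V * z\<bar>/(W * real (Suc m)))) \<longlonglongrightarrow>
         exp ((sqrt V * z)\<^sup>2/(2*W)) * max 0 (1 - 0)"
        by (intro tendsto_intros)
      then show ?thesis by (intro tendsto_ennrealI) simp
    qed
  qed auto
  also have "(\<integral>\<^sup>+z. ennreal (exp ((sqrt V * z)\<^sup>2/(2*W))) \<partial>std_normal_distribution) =
     (\<integral>\<^sup>+z. ennreal (1 / sqrt (2 * pi)) * ennreal (\<bar>z\<bar> powr 0 * exp (- (\<tau>/W) * z\<^sup>2/2)) \<partial>lborel)"
  proof -
    \<comment> \<open>The point 0 is excluded because \<open>0 powr 0\<close> is 0, whereas the
      integrand there calls for 1.\<close>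
    have "AE z in lborel. ennreal (std_normal_density z) * ennreal (exp ((sqrt V * z)\<^sup>2/(2*W))) =
       ennreal (1 / sqrt (2 * pi)) * ennreal (\<bar>z\<bar> powr 0 * exp (- (\<tau>/W) * z\<^sup>2/2))"
      using AE_lborel_singleton[of "0::real"]
    proof eventually_elim
      fix z :: real assume z: "z \<noteq> 0"
      have "- z\<^sup>2/2 + V * z\<^sup>2/(2*W) = - (\<tau>/W) * z\<^sup>2/2" using W by (simp add: field_simps W_def)
      then have "exp (- z\<^sup>2/2) * exp (V * z\<^sup>2/(2*W)) = exp (- (\<tau>/W) * z\<^sup>2/2)" by (simp only: mult_exp_exp)
      then show "ennreal (std_normal_density z) * ennreal (exp ((sqrt V * z)\<^sup>2/(2*W))) =
       ennreal (1 / sqrt (2 * pi)) * ennreal (\<bar>z\<bar> powr 0 * exp (- (\<tau>/W) * z\<^sup>2/2))"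
        using z assms by (simp add: normal_density_def ennreal_mult'[symmetric] power_mult_distrib)
    qed
    then show ?thesis by (subst nn_integral_density) (auto intro!: nn_integral_cong_AE)
  qed
  also have "\<dots> = ennreal (1 / sqrt (2 * pi)) * (\<integral>\<^sup>+z. ennreal (\<bar>z\<bar> powr 0 * exp (- (\<tau>/W) * z\<^sup>2/2)) \<partial>lborel)"
    by (rule nn_integral_cmult) measurable
  also have "(\<integral>\<^sup>+z. ennreal (\<bar>z\<bar> powr 0 * exp (- (\<tau>/W) * z\<^sup>2/2)) \<partial>lborel) = ennreal ((\<tau>/W) powr (-(0+1)/2) * (2 powr ((0+1)/2) * Gamma ((0+1)/2)))"
    by (rule nn_integral_abs_powr_gaussian) (use assms(2) W in auto)
  also have "ennreal (1 / sqrt (2 * pi)) * \<dots> = ennreal (1 / sqrt (2 * pi) * ((\<tau>/W) powr (-(1/2)) * (sqrt 2 * sqrt pi)))"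
    by (simp add: ennreal_mult'[symmetric] Gamma_one_half_real powr_half_sqrt)
  also have "1 / sqrt (2 * pi) * ((\<tau>/W) powr (-(1/2)) * (sqrt 2 * sqrt pi)) = sqrt (W/\<tau>)"
  proof -
    have "(\<tau>/W) powr (-(1/2)) = sqrt (W/\<tau>)"
      using assms(2) W by (simp add: powr_minus powr_half_sqrt real_sqrt_divide)
    then show ?thesis by (simp add: real_sqrt_mult)
  qed
  finally show ?thesis .
qed

section \<open>Triangular arrays\<close>

lemma (in prob_space) iid_char_sum:
  fixes X :: "'a \<Rightarrow> real"
  assumes [measurable]: "X \<in> borel_measurable M"
  shows "char (distr (PiM {..<n::nat} (\<lambda>_. M)) borel (\<lambda>y. \<Sum>j<n. X (y j))) t = char (distr M borel X) t ^ n"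
proof -
  interpret product_sigma_finite "\<lambda>_::nat. M" ..
  have "char (distr (PiM {..<n} (\<lambda>_. M)) borel (\<lambda>y. \<Sum>j<n. X (y j))) t
     = (\<integral>y. (\<Prod>j<n. iexp (t * X (y j))) \<partial>PiM {..<n} (\<lambda>_. M))"
    unfolding char_def by (subst integral_distr) (auto simp: exp_sum sum_distrib_left)
  also have "\<dots> = (\<Prod>j<n. \<integral>x. iexp (t * X x) \<partial>M)"
    by (rule product_integral_prod) (auto intro!: integrable_const_bound[where B=1])
  also have "\<dots> = char (distr M borel X) t ^ n"
    unfolding char_def by (subst integral_distr) auto
  finally show ?thesis .
qed

lemma (in prob_space) integrable_bounded:
  fixes X :: "'a \<Rightarrow> real"
  assumes "X \<in> borel_measurable M" "\<And>x. x \<in> space M \<Longrightarrow> \<bar>X x\<bar> \<le> B"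
  shows "integrable M X"
  using assms by (intro integrable_const_bound[where B=B]) auto

text \<open>Boundedness turns the Taylor remainder into a third-order error that depends on the law
  only through \<open>B\<close>, hence is uniform along a triangular array.\<close>

lemma (in prob_space) char_approx_bounded:
  fixes X :: "'a \<Rightarrow> real"
  assumes [measurable]: "X \<in> borel_measurable M" and B: "\<And>x. x \<in> space M \<Longrightarrow> \<bar>X x\<bar> \<le> B"
    and mean: "expectation X = 0"
  shows "norm (char (distr M borel X) t - of_real (1 - t\<^sup>2 * expectation (\<lambda>x. (X x)\<^sup>2) / 2)) \<le> \<bar>t\<bar>^3 * B^3 / 6"
proof -
  have B0: "0 \<le> B" using B not_empty by fastforce
  have B2: "\<bar>(X x)\<^sup>2\<bar> \<le> B\<^sup>2" if "x \<in> space M" for x using power_mono[OF B[OF that], of 2] by simp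
  have int: "integrable M X" "integrable M (\<lambda>x. (X x)\<^sup>2)"
    by (rule integrable_bounded; use B B2 in auto)+
  have "norm (char (distr M borel X) t - of_real (1 - t\<^sup>2 * expectation (\<lambda>x. (X x)\<^sup>2) / 2)) \<le>
    (t\<^sup>2 / 6) * expectation (\<lambda>x. min (6 * (X x)\<^sup>2) (\<bar>t\<bar> * \<bar>X x\<bar>^3))"
    by (rule char_approx3') (auto simp: int mean)
  also have "expectation (\<lambda>x. min (6 * (X x)\<^sup>2) (\<bar>t\<bar> * \<bar>X x\<bar>^3)) \<le> expectation (\<lambda>_. \<bar>t\<bar> * B^3)"
  proof (rule integral_mono)
    show "integrable M (\<lambda>x. min (6 * (X x)\<^sup>2) (\<bar>t\<bar> * \<bar>X x\<bar>^3))"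
    proof (rule integrable_bounded)
      fix x assume "x \<in> space M"
      then have "min (6 * (X x)\<^sup>2) (\<bar>t\<bar> * \<bar>X x\<bar>^3) \<le> 6 * B\<^sup>2" using B2[of x] by simp
      moreover have "0 \<le> min (6 * (X x)\<^sup>2) (\<bar>t\<bar> * \<bar>X x\<bar>^3)" by simp
      ultimately show "\<bar>min (6 * (X x)\<^sup>2) (\<bar>t\<bar> * \<bar>X x\<bar>^3)\<bar> \<le> 6 * B\<^sup>2" by linarith
    qed auto
    fix x assume "x \<in> space M"
    then have "\<bar>t\<bar> * \<bar>X x\<bar>^3 \<le> \<bar>t\<bar> * B^3" by (intro mult_left_mono power_mono B) auto
    then show "min (6 * (X x)\<^sup>2) (\<bar>t\<bar> * \<bar>X x\<bar>^3) \<le> \<bar>t\<bar> * B^3" by simp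
  qed simp
  also have "t\<^sup>2 / 6 * expectation (\<lambda>_. \<bar>t\<bar> * B^3) = \<bar>t\<bar>^3 * B^3 / 6"
    by (simp add: prob_space power3_eq_cube power2_abs[of t, symmetric] power2_eq_square[of "\<bar>t\<bar>"] del: power2_abs)
  finally show ?thesis by (simp add: mult_left_mono)
qed

text \<open>The limit variance may vanish, hence the limit law is written as an image of the standard normal law.\<close>

lemma triangular_array_clt:
  fixes \<nu> :: "nat \<Rightarrow> 'a measure" and s :: "nat \<Rightarrow> 'a \<Rightarrow> real"
  assumes prob: "\<And>n. prob_space (\<nu> n)"
    and meas: "\<And>n. s n \<in> borel_measurable (\<nu> n)"
    and B: "\<And>n y. y \<in> space (\<nu> n) \<Longrightarrow> \<bar>s n y\<bar> \<le> B"
    and mean: "\<And>n. (\<integral>y. s n y \<partial>\<nu> n) = 0"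
    and var: "(\<lambda>n. \<integral>y. (s n y)\<^sup>2 \<partial>\<nu> n) \<longlonglongrightarrow> V" and V: "0 \<le> V"
  shows "weak_conv_m (\<lambda>n. distr (PiM {..<n} (\<lambda>_. \<nu> n)) borel (\<lambda>y. \<Sum>j<n. s n (y j) / sqrt n))
    (distr std_normal_distribution borel (\<lambda>x. sqrt V * x))"
proof (rule levy_continuity)
  have prod: "prob_space (PiM {..<n} (\<lambda>_. \<nu> n))" for n by (intro prob_space_PiM prob)
  show "real_distribution (distr (PiM {..<n} (\<lambda>_. \<nu> n)) borel (\<lambda>y. \<Sum>j<n. s n (y j) / sqrt n))" for n
    using meas[of n] by (intro prob_space.real_distribution_distr prod) auto
  interpret N: real_distribution std_normal_distribution by (rule real_dist_normal_dist)
  show "real_distribution (distr std_normal_distribution borel (\<lambda>x. sqrt V * x))"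
    by (intro N.real_distribution_distr) auto
  fix t :: real
  have limit: "char (distr std_normal_distribution borel (\<lambda>x. sqrt V * x)) t = of_real (exp (- (t\<^sup>2 * V) / 2))"
  proof -
    have "char (distr std_normal_distribution borel (\<lambda>x. sqrt V * x)) t = char std_normal_distribution (t * sqrt V)"
      unfolding char_def by (subst integral_distr) (auto simp: mult.assoc)
    then show ?thesis using V by (simp add: char_std_normal_distribution power_mult_distrib)
  qed
  define \<sigma> where "\<sigma> n = (\<integral>y. (s n y)\<^sup>2 \<partial>\<nu> n)" for n
  define \<psi> where "\<psi> n = char (distr (\<nu> n) borel (\<lambda>x. s n x / sqrt n)) t" for n
  \<comment> \<open>\<open>b n ^ n\<close> converges to the Gaussian characteristic function. It
    uses the limit variance \<open>V\<close> instead of the row variance \<open>\<sigma> n\<close>;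
    the term with \<open>\<bar>\<sigma> n - V\<bar>\<close> below is the cost.\<close>
  define b where "b n = 1 + (- (t\<^sup>2 * V) / 2) / real n" for n
  have char_eq: "char (distr (PiM {..<n} (\<lambda>_. \<nu> n)) borel (\<lambda>y. \<Sum>j<n. s n (y j) / sqrt n)) t = \<psi> n ^ n" for n
    unfolding \<psi>_def using meas[of n] by (intro prob_space.iid_char_sum[OF prob]) auto
  have main: "\<forall>\<^sub>F n in sequentially. norm (\<psi> n ^ n - of_real (b n ^ n)) \<le> \<bar>t\<bar>^3 * B^3 / 6 * (1 / sqrt n) + t\<^sup>2 / 2 * \<bar>\<sigma> n - V\<bar>"
  proof (rule eventually_sequentiallyI)
    \<comment> \<open>The bound \<open>t\<^sup>2 * V \<le> n\<close> puts \<open>b n\<close> into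
      the unit interval; as \<open>\<psi> n\<close> has norm at most 1, the n-th powers then differ
      by at most \<open>n\<close> times the difference of the bases.\<close>
    fix n assume "max 1 (nat \<lceil>t\<^sup>2 * V\<rceil>) \<le> n"
    then have n: "1 \<le> n" "t\<^sup>2 * V \<le> real n" by (auto simp: nat_ceiling_le_eq)
    interpret \<nu>: prob_space "\<nu> n" by (rule prob)
    note [measurable] = meas[of n]
    have sq: "(\<integral>x. (s n x / sqrt n)\<^sup>2 \<partial>\<nu> n) = \<sigma> n / n"
      using n by (simp add: \<sigma>_def power_divide)
    have "norm (\<psi> n - of_real (1 - t\<^sup>2 * (\<integral>x. (s n x / sqrt n)\<^sup>2 \<partial>\<nu> n) / 2)) \<le> \<bar>t\<bar>^3 * (B / sqrt n)^3 / 6"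
      unfolding \<psi>_def using B[of _ n] n mean[of n]
      by (intro \<nu>.char_approx_bounded) (auto simp: divide_right_mono abs_divide)
    then have 1: "norm (\<psi> n - of_real (1 - t\<^sup>2 * (\<sigma> n / n) / 2)) \<le> \<bar>t\<bar>^3 * (B / sqrt n)^3 / 6" unfolding sq .
    have "\<psi> n - of_real (b n) = (\<psi> n - of_real (1 - t\<^sup>2 * (\<sigma> n / n) / 2)) + of_real (t\<^sup>2 / 2 * (V - \<sigma> n) / n)"
      using n by (simp add: b_def field_simps)
    then have "norm (\<psi> n - of_real (b n)) \<le> norm (\<psi> n - of_real (1 - t\<^sup>2 * (\<sigma> n / n) / 2)) + norm (of_real (t\<^sup>2 / 2 * (V - \<sigma> n) / n) :: complex)"
      using norm_triangle_ineq by metis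
    also have "\<dots> \<le> \<bar>t\<bar>^3 * (B / sqrt n)^3 / 6 + t\<^sup>2 / 2 * \<bar>\<sigma> n - V\<bar> / n"
      using 1 by (auto simp: norm_mult norm_divide abs_mult abs_minus_commute simp del: of_real_mult of_real_divide of_real_diff)
    finally have 2: "norm (\<psi> n - of_real (b n)) \<le> \<bar>t\<bar>^3 * (B / sqrt n)^3 / 6 + t\<^sup>2 / 2 * \<bar>\<sigma> n - V\<bar> / n" .
    interpret D: real_distribution "distr (\<nu> n) borel (\<lambda>x. s n x / sqrt n)"
      by (intro \<nu>.real_distribution_distr) auto
    have "0 \<le> b n" "b n \<le> 1" using n V by (auto simp: b_def field_simps)
    then have "norm (\<psi> n ^ n - of_real (b n) ^ n) \<le> n * norm (\<psi> n - of_real (b n))"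
      by (intro norm_power_diff) (auto simp: \<psi>_def D.cmod_char_le_1)
    also have "\<dots> \<le> n * (\<bar>t\<bar>^3 * (B / sqrt n)^3 / 6 + t\<^sup>2 / 2 * \<bar>\<sigma> n - V\<bar> / n)"
      using 2 by (intro mult_left_mono) auto
    also have "\<dots> = \<bar>t\<bar>^3 * B^3 / 6 * (1 / sqrt n) + t\<^sup>2 / 2 * \<bar>\<sigma> n - V\<bar>"
    proof -
      have "(sqrt n * sqrt n) * (B / sqrt n)^3 = B^3 * (1 / sqrt n)" using n
        by (simp add: power_divide power3_eq_cube del: real_sqrt_mult_self)
      then have "real n * (B / sqrt n)^3 = B^3 * (1 / sqrt n)" by simp
      moreover have "real n * (\<bar>t\<bar>^3 * (B / sqrt n)^3 / 6 + t\<^sup>2 / 2 * \<bar>\<sigma> n - V\<bar> / n) = \<bar>t\<bar>^3 / 6 * (real n * (B / sqrt n)^3) + t\<^sup>2 / 2 * \<bar>\<sigma> n - V\<bar>"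
        using n by (simp add: distrib_left)
      ultimately show ?thesis by simp
    qed
    finally show "norm (\<psi> n ^ n - of_real (b n ^ n)) \<le> \<bar>t\<bar>^3 * B^3 / 6 * (1 / sqrt n) + t\<^sup>2 / 2 * \<bar>\<sigma> n - V\<bar>" by simp
  qed
  have "(\<lambda>n. \<bar>t\<bar>^3 * B^3 / 6 * (1 / sqrt (real n)) + t\<^sup>2 / 2 * \<bar>\<sigma> n - V\<bar>) \<longlonglongrightarrow> \<bar>t\<bar>^3 * B^3 / 6 * 0 + t\<^sup>2 / 2 * \<bar>V - V\<bar>"
    using var unfolding \<sigma>_def[symmetric]
    by (intro tendsto_intros tendsto_divide_0[OF tendsto_const] filterlim_at_top_imp_at_infinity
        filterlim_compose[OF sqrt_at_top filterlim_real_sequentially])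
  then have err: "(\<lambda>n. \<bar>t\<bar>^3 * B^3 / 6 * (1 / sqrt (real n)) + t\<^sup>2 / 2 * \<bar>\<sigma> n - V\<bar>) \<longlonglongrightarrow> 0" by simp
  have "(\<lambda>n. b n ^ n) \<longlonglongrightarrow> exp (- (t\<^sup>2 * V) / 2)"
    unfolding b_def by (rule tendsto_exp_limit_sequentially)
  then have "(\<lambda>n. complex_of_real (b n ^ n)) \<longlonglongrightarrow> of_real (exp (- (t\<^sup>2 * V) / 2))" by (rule tendsto_of_real)
  then show "(\<lambda>n. char (distr (PiM {..<n} (\<lambda>_. \<nu> n)) borel (\<lambda>y. \<Sum>j<n. s n (y j) / sqrt n)) t)
      \<longlonglongrightarrow> char (distr std_normal_distribution borel (\<lambda>x. sqrt V * x)) t"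
    unfolding char_eq limit by (rule Lim_transform) (rule Lim_null_comparison[OF main err])
qed

text \<open>Independence factors the mixed products, and centring kills those with distinct indices.
  It serves a Chebyshev estimate for the sum of squared scores.\<close>

lemma (in prob_space) iid_sum_second_moment:
  fixes X :: "'a \<Rightarrow> real"
  assumes [measurable]: "X \<in> borel_measurable M" and B: "\<And>x. x \<in> space M \<Longrightarrow> \<bar>X x\<bar> \<le> B"
    and mean: "expectation X = 0"
  shows "(\<integral>y. (\<Sum>j<n. X (y j))\<^sup>2 \<partial>PiM {..<n::nat} (\<lambda>_. M)) = real n * expectation (\<lambda>x. (X x)\<^sup>2)"
proof -
  interpret P: product_sigma_finite "\<lambda>_::nat. M" ..
  interpret PP: prob_space "PiM {..<n} (\<lambda>_. M)" by (intro prob_space_PiM) unfold_locales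
  have B2: "\<bar>(X x)\<^sup>2\<bar> \<le> B\<^sup>2" if "x \<in> space M" for x using power_mono[OF B[OF that], of 2] by simp
  have int: "integrable M X" "integrable M (\<lambda>x. (X x)\<^sup>2)"
    by (rule integrable_bounded; use B B2 in auto)+
  have pair: "(\<integral>y. X (y i) * X (y j) \<partial>PiM {..<n} (\<lambda>_. M)) = (if i = j then expectation (\<lambda>x. (X x)\<^sup>2) else 0)"
    if ij: "i < n" "j < n" for i j
  proof -
    \<comment> \<open>The two conditional factors write \<open>X (y i) * X (y j)\<close> as a
      product over all coordinates both for \<open>i = j\<close> and for
      \<open>i \<noteq> j\<close>.\<close>
    define f where "f l x = (if l = i then X x else 1) * (if l = j then X x else 1)" for l x
    have "(\<Prod>l<n. f l (y l)) = X (y i) * X (y j)" for y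
      unfolding f_def prod.distrib using ij by (simp add: prod.delta)
    then have "(\<integral>y. X (y i) * X (y j) \<partial>PiM {..<n} (\<lambda>_. M)) = (\<integral>y. (\<Prod>l<n. f l (y l)) \<partial>PiM {..<n} (\<lambda>_. M))" by simp
    also have "\<dots> = (\<Prod>l<n. expectation (f l))"
    proof (rule P.product_integral_prod)
      show "integrable M (f l)" for l
        by (cases "l = i"; cases "l = j") (use int in \<open>auto simp: f_def[abs_def] power2_eq_square\<close>)
    qed auto
    also have "\<dots> = (if i = j then expectation (\<lambda>x. (X x)\<^sup>2) else 0)"
    proof (cases "i = j")
      case True
      then have "expectation (f l) = (if l = i then expectation (\<lambda>x. (X x)\<^sup>2) else 1)" for l
        by (simp add: f_def[abs_def] power2_eq_square prob_space)
      then show ?thesis using True ij by (simp add: prod.delta)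
    next
      case False
      then have "expectation (f i) = 0" using mean by (simp add: f_def[abs_def])
      then show ?thesis using False ij by auto
    qed
    finally show ?thesis .
  qed
  have int2: "integrable (PiM {..<n} (\<lambda>_. M)) (\<lambda>y. X (y i) * X (y j))" if ij: "i < n" "j < n" for i j
  proof (rule PP.integrable_bounded)
    show "(\<lambda>y. X (y i) * X (y j)) \<in> borel_measurable (PiM {..<n} (\<lambda>_. M))" 
    proof (intro borel_measurable_times)
      show "(\<lambda>y. X (y i)) \<in> borel_measurable (PiM {..<n} (\<lambda>_. M))"
        by (rule measurable_compose[OF measurable_component_singleton]) (use ij in auto)
      show "(\<lambda>y. X (y j)) \<in> borel_measurable (PiM {..<n} (\<lambda>_. M))"
        by (rule measurable_compose[OF measurable_component_singleton]) (use ij in auto)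
    qed
    fix y assume "y \<in> space (PiM {..<n} (\<lambda>_. M))"
    then have "y i \<in> space M" "y j \<in> space M" using ij by (auto simp: space_PiM)
    then show "\<bar>X (y i) * X (y j)\<bar> \<le> B * B" using B[of "y i"] B[of "y j"] unfolding abs_mult by (intro mult_mono) auto
  qed
  have "(\<integral>y. (\<Sum>j<n. X (y j))\<^sup>2 \<partial>PiM {..<n} (\<lambda>_. M)) = (\<integral>y. (\<Sum>i<n. \<Sum>j<n. X (y i) * X (y j)) \<partial>PiM {..<n} (\<lambda>_. M))"
    by (simp add: power2_eq_square sum_product)
  also have "\<dots> = (\<Sum>i<n. \<Sum>j<n. if i = j then expectation (\<lambda>x. (X x)\<^sup>2) else 0)"
  proof -
    have "(\<integral>y. (\<Sum>i<n. \<Sum>j<n. X (y i) * X (y j)) \<partial>PiM {..<n} (\<lambda>_. M))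
       = (\<Sum>i<n. \<Sum>j<n. \<integral>y. X (y i) * X (y j) \<partial>PiM {..<n} (\<lambda>_. M))"
      using int2 by (subst Bochner_Integration.integral_sum)
        (auto intro!: sum.cong Bochner_Integration.integral_sum Bochner_Integration.integrable_sum)
    also have "\<dots> = (\<Sum>i<n. \<Sum>j<n. if i = j then expectation (\<lambda>x. (X x)\<^sup>2) else 0)"
      by (intro sum.cong refl pair) auto
    finally show ?thesis .
  qed
  also have "\<dots> = real n * expectation (\<lambda>x. (X x)\<^sup>2)" by simp
  finally show ?thesis .
qed

section \<open>One-dimensional local lower bound\<close>

lemma measurable_PiM_coordinate:
  assumes "f \<in> measurable M N" "j \<in> I"
  shows "(\<lambda>y. f (y j)) \<in> measurable (PiM I (\<lambda>_. M)) N"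
  using measurable_component_singleton[OF assms(2)] assms(1) by (rule measurable_compose)

text \<open>The cubic lower bound is applied factor by factor; \<open>small\<close> keeps every
  increment within 1/2. The term with \<open>L\<^sup>2/2\<close> pays for replacing the empirical
  second moment by \<open>V\<close>, and \<open>(L*B)^3/sqrt n\<close> is \<open>n\<close> times the
  largest cubic remainder. The total error does not depend on \<open>\<theta>\<close>, so it can
  later leave the integral over the prior.\<close>

lemma likelihood_lower:
  fixes s :: "'a \<Rightarrow> real" and y :: "nat \<Rightarrow> 'a"
  assumes n: "1 \<le> n" and "0 \<le> B" "0 \<le> L" and small: "L * B \<le> sqrt n / 2"
    and B: "\<And>j. j < n \<Longrightarrow> \<bar>s (y j)\<bar> \<le> B" and \<theta>: "\<bar>\<theta>\<bar> \<le> L"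
    and d: "\<bar>(\<Sum>j<n. (s (y j))\<^sup>2) - real n * \<sigma>\<bar> \<le> d"
  shows "exp (\<theta> * (\<Sum>j<n. s (y j) / sqrt n) - V * \<theta>\<^sup>2/2 - (L\<^sup>2/2 * (\<bar>\<sigma> - V\<bar> + d/n) + (L*B)^3/sqrt n))
    \<le> (\<Prod>j<n. 1 + \<theta> * s (y j) / sqrt n)"
proof -
  define x where "x j = \<theta> * s (y j) / sqrt n" for j
  have sq: "sqrt n > 0" using n by simp
  have x: "\<bar>x j\<bar> \<le> L * B / sqrt n" if "j < n" for j
    using B[OF that] \<theta> assms(2,3) unfolding x_def abs_divide abs_mult
    by (intro frac_le mult_mono) (use n in auto)
  have half: "L * B / sqrt n \<le> 1/2" using small sq by (simp add: field_simps)
  have "\<theta>\<^sup>2 \<le> L\<^sup>2" using \<theta> power_mono[of "\<bar>\<theta>\<bar>" L 2] by simp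
  have cube: "(\<Sum>j<n. \<bar>x j\<bar>^3) \<le> (L*B)^3/sqrt n"
  proof -
    have "(\<Sum>j<n. \<bar>x j\<bar>^3) \<le> (\<Sum>j<n. (L * B / sqrt n)^3)"
      using x by (intro sum_mono power_mono) auto
    also have "\<dots> = (sqrt n * sqrt n) * (L * B / sqrt n)^3" by simp
    also have "\<dots> = (L*B)^3/sqrt n" using sq by (simp add: power_divide power3_eq_cube del: real_sqrt_mult_self)
    finally show ?thesis .
  qed
  have square: "(\<Sum>j<n. (x j)\<^sup>2) \<le> V * \<theta>\<^sup>2 + L\<^sup>2 * (\<bar>\<sigma> - V\<bar> + d/n)"
  proof -
    have "(\<Sum>j<n. (x j)\<^sup>2) = \<theta>\<^sup>2 * ((\<Sum>j<n. (s (y j))\<^sup>2) / n)"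
      by (simp add: x_def power_mult_distrib power_divide sum_distrib_left sum_divide_distrib)
    also have "(\<Sum>j<n. (s (y j))\<^sup>2) / n \<le> V + (\<bar>\<sigma> - V\<bar> + d/n)"
    proof -
      have "(\<Sum>j<n. (s (y j))\<^sup>2) \<le> real n * \<sigma> + d" using d by linarith
      then have "(\<Sum>j<n. (s (y j))\<^sup>2) / n \<le> (real n * \<sigma> + d) / n" by (rule divide_right_mono) simp
      also have "\<dots> = \<sigma> + d/n" using n by (simp add: add_divide_distrib)
      finally show ?thesis by linarith
    qed
    then have "\<theta>\<^sup>2 * ((\<Sum>j<n. (s (y j))\<^sup>2) / n) \<le> \<theta>\<^sup>2 * (V + (\<bar>\<sigma> - V\<bar> + d/n))"
      by (rule mult_left_mono) simp
    also have "\<dots> = \<theta>\<^sup>2 * V + \<theta>\<^sup>2 * (\<bar>\<sigma> - V\<bar> + d/n)" by (rule distrib_left)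
    also have "\<theta>\<^sup>2 * (\<bar>\<sigma> - V\<bar> + d/n) \<le> L\<^sup>2 * (\<bar>\<sigma> - V\<bar> + d/n)"
      using \<open>\<theta>\<^sup>2 \<le> L\<^sup>2\<close> d by (intro mult_right_mono) auto
    finally show ?thesis by (simp add: mult.commute)
  qed
  have "\<theta> * (\<Sum>j<n. s (y j) / sqrt n) - V * \<theta>\<^sup>2/2 - (L\<^sup>2/2 * (\<bar>\<sigma> - V\<bar> + d/n) + (L*B)^3/sqrt n)
      \<le> (\<Sum>j<n. x j) - (\<Sum>j<n. (x j)\<^sup>2)/2 - (\<Sum>j<n. \<bar>x j\<bar>^3)"
  proof -
    have "\<theta> * (\<Sum>j<n. s (y j) / sqrt n) = (\<Sum>j<n. x j)" by (simp add: x_def sum_distrib_left)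
    moreover have "L\<^sup>2/2 * (\<bar>\<sigma> - V\<bar> + d/n) = (L\<^sup>2 * (\<bar>\<sigma> - V\<bar> + d/n))/2" by simp
    ultimately show ?thesis using square cube by linarith
  qed
  also have "\<dots> = (\<Sum>j<n. x j - (x j)\<^sup>2/2 - \<bar>x j\<bar>^3)" by (simp add: sum_subtractf sum_divide_distrib)
  finally have "exp (\<theta> * (\<Sum>j<n. s (y j) / sqrt n) - V * \<theta>\<^sup>2/2 - (L\<^sup>2/2 * (\<bar>\<sigma> - V\<bar> + d/n) + (L*B)^3/sqrt n))
      \<le> (\<Prod>j<n. exp (x j - (x j)\<^sup>2/2 - \<bar>x j\<bar>^3))" by (simp flip: exp_sum)
  also have "\<dots> \<le> (\<Prod>j<n. 1 + x j)"
  proof (rule prod_mono)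
    fix j assume "j \<in> {..<n}"
    then have "\<bar>x j\<bar> \<le> 1/2" using order_trans[OF x half] by simp
    then show "0 \<le> exp (x j - (x j)\<^sup>2/2 - \<bar>x j\<bar>^3) \<and> exp (x j - (x j)\<^sup>2/2 - \<bar>x j\<bar>^3) \<le> 1 + x j"
      by (simp add: one_plus_ge_exp_cubic)
  qed
  finally show ?thesis by (simp add: x_def)
qed

text \<open>The Gaussian prior of precision \<open>\<tau>\<close> is truncated to \<open>{-L..L}\<close>. Its precision keeps
  \<open>W = V + \<tau>\<close> positive even when the information \<open>V\<close> vanishes.\<close>

lemma local_bayes_risk_lower:
  fixes \<nu> :: "nat \<Rightarrow> 'a measure" and s :: "nat \<Rightarrow> 'a \<Rightarrow> real" and c :: ennreal
  assumes prob: "\<And>n. prob_space (\<nu> n)"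
    and meas: "\<And>n. s n \<in> borel_measurable (\<nu> n)"
    and B: "\<And>n y. y \<in> space (\<nu> n) \<Longrightarrow> \<bar>s n y\<bar> \<le> B"
    and mean: "\<And>n. (\<integral>y. s n y \<partial>\<nu> n) = 0"
    and var: "(\<lambda>n. \<integral>y. (s n y)\<^sup>2 \<partial>\<nu> n) \<longlonglongrightarrow> V" and V: "0 \<le> V"
    and \<tau>: "0 < \<tau>" and u: "1 \<le> u" and L: "0 < L"
  defines "W \<equiv> V + \<tau>"
  assumes c: "c < (\<integral>\<^sup>+z. ennreal (exp ((sqrt V * z)\<^sup>2/(2*W)) * max 0 (1 - 2*\<bar>sqrt V * z\<bar>/(W*L))) \<partial>std_normal_distribution) *
     (\<integral>\<^sup>+\<theta>. ennreal (\<bar>\<theta>\<bar> powr u * exp (- W * \<theta>\<^sup>2/2)) * indicator {-L/2..L/2} \<theta> \<partial>lborel)"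
  shows "\<forall>\<^sub>F n in sequentially. \<forall>T\<in>borel_measurable (PiM {..<n} (\<lambda>_. \<nu> n)).
    c \<le> (\<integral>\<^sup>+\<theta>. (\<integral>\<^sup>+y. ennreal (\<bar>T y - \<theta>\<bar> powr u * (\<Prod>j<n. 1 + \<theta> * s n (y j) / sqrt n)) \<partial>PiM {..<n} (\<lambda>_. \<nu> n))
       * (ennreal (exp (- \<tau> * \<theta>\<^sup>2/2)) * indicator {-L..L} \<theta>) \<partial>lborel)"
proof -
  have W: "0 < W" using V \<tau> by (simp add: W_def)
  define F where "F x = exp (x\<^sup>2/(2*W)) * max 0 (1 - 2*\<bar>x\<bar>/(W*L))" for x :: real
  define G where "G = (\<integral>\<^sup>+\<theta>. ennreal (\<bar>\<theta>\<bar> powr u * exp (- W * \<theta>\<^sup>2/2)) * indicator {-L/2..L/2} \<theta> \<partial>lborel)"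
  \<comment> \<open>\<open>F\<close> vanishes from \<open>\<bar>x\<bar> = W*L/2\<close> on;
    \<open>K\<close> is its exponential factor at that edge.\<close>
  define K where "K = exp ((W*L/2)\<^sup>2/(2*W))"
  have F_nonneg: "0 \<le> F x" for x by (simp add: F_def)
  have F_le: "F x \<le> K" for x
  proof (cases "\<bar>x\<bar> \<le> W*L/2")
    case True
    then have "x\<^sup>2 \<le> (W*L/2)\<^sup>2" using power_mono[of "\<bar>x\<bar>" "W*L/2" 2] by simp
    then have "exp (x\<^sup>2/(2*W)) \<le> K" unfolding K_def using W by (simp add: divide_right_mono)
    moreover have "max 0 (1 - 2*\<bar>x\<bar>/(W*L)) \<le> 1" using W L by simp
    ultimately show ?thesis unfolding F_def using mult_mono[of _ K _ 1] by (simp add: K_def)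
  next
    case False
    then have "1 - 2*\<bar>x\<bar>/(W*L) \<le> 0" using W L by (simp add: field_simps)
    then show ?thesis by (simp add: F_def K_def)
  qed
  have F_cont: "isCont F x" for x unfolding F_def using W L by (intro continuous_intros) auto
  then have F_meas[measurable]: "F \<in> borel_measurable borel"
    by (intro borel_measurable_continuous_onI) (auto simp: continuous_at_imp_continuous_on)
  have G_fin: "G < \<top>"
  proof -
    have "G \<le> (\<integral>\<^sup>+\<theta>. ennreal (\<bar>\<theta>\<bar> powr u * exp (- W * \<theta>\<^sup>2/2)) \<partial>lborel)"
      unfolding G_def by (intro nn_integral_mono) (auto simp: indicator_def)
    also have "\<dots> < \<top>" using u W by (subst nn_integral_abs_powr_gaussian) auto
    finally show ?thesis .
  qed
  define P where "P n = PiM {..<n} (\<lambda>_. \<nu> n)" for n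
  have P: "prob_space (P n)" for n unfolding P_def by (intro prob_space_PiM prob)
  define \<Delta> where "\<Delta> n y = (\<Sum>j<n. s n (y j) / sqrt n)" for n and y :: "nat \<Rightarrow> 'a"
  have comp_meas: "(\<lambda>y. s n (y j)) \<in> borel_measurable (P n)" if "j < n" for n j
    unfolding P_def using that by (intro measurable_PiM_coordinate meas) auto
  have \<Delta>_meas[measurable]: "\<Delta> n \<in> borel_measurable (P n)" for n
    unfolding \<Delta>_def using comp_meas by (intro borel_measurable_sum borel_measurable_divide) auto
  define \<sigma> where "\<sigma> n = (\<integral>y. (s n y)\<^sup>2 \<partial>\<nu> n)" for n
  \<comment> \<open>A rate strictly between \<open>sqrt n\<close> and \<open>n\<close>: both
    \<open>d n / n\<close> and the Chebyshev bound
    \<open>n * B^4 / (d n)\<^sup>2 = B^4 / sqrt n\<close> have to vanish.\<close>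
  define d where "d n = real n powr (3/4)" for n :: nat
  define \<kappa> where "\<kappa> n = L\<^sup>2/2 * (\<bar>\<sigma> n - V\<bar> + d n/n) + (L*B)^3/sqrt n" for n
  have B0: "0 \<le> B"
  proof -
    interpret prob_space "\<nu> 0" by (rule prob)
    show ?thesis using B not_empty by fastforce
  qed
  interpret N: real_distribution std_normal_distribution by (rule real_dist_normal_dist)
  define EF where "EF = (\<integral>z. F (sqrt V * z) \<partial>std_normal_distribution)"
  have EF: "(\<lambda>n. \<integral>y. F (\<Delta> n y) \<partial>P n) \<longlonglongrightarrow> EF"
  proof -
    have "(\<lambda>n. \<integral>x. F x \<partial>distr (P n) borel (\<Delta> n)) \<longlonglongrightarrow> (\<integral>x. F x \<partial>distr std_normal_distribution borel (\<lambda>x. sqrt V * x))"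
      unfolding P_def \<Delta>_def[abs_def]
    proof (rule weak_conv_imp_integral_bdd_continuous_conv[OF _ _ triangular_array_clt[OF prob meas B mean var V]])
      show "real_distribution (distr (PiM {..<n} (\<lambda>_. \<nu> n)) borel (\<lambda>y. \<Sum>j<n. s n (y j) / sqrt n))" for n
        using P[of n] \<Delta>_meas[of n] unfolding P_def \<Delta>_def[abs_def]
        by (rule prob_space.real_distribution_distr)
      show "real_distribution (distr std_normal_distribution borel (\<lambda>x. sqrt V * x))"
        by (intro N.real_distribution_distr) auto
      show "norm (F x) \<le> K" for x using F_nonneg F_le by simp
    qed (auto simp: F_cont)
    then show ?thesis unfolding EF_def by (simp add: integral_distr)
  qed
  have c': "c < ennreal EF * G"
  proof -
    have "ennreal EF = (\<integral>\<^sup>+z. ennreal (F (sqrt V * z)) \<partial>std_normal_distribution)"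
      unfolding EF_def using F_nonneg F_le
      by (intro nn_integral_eq_integral[symmetric] N.integrable_const_bound[where B=K]) auto
    then show ?thesis using c unfolding F_def G_def by simp
  qed
  have EF0: "0 \<le> EF" unfolding EF_def using F_nonneg by (intro integral_nonneg_AE) auto
  \<comment> \<open>The subtracted term is the price of discarding the samples whose sum of squared
    scores lies farther than \<open>d n\<close> from its mean.\<close>
  define a where "a n = (\<integral>y. F (\<Delta> n y) \<partial>P n) - K * (B^4 / sqrt n)" for n
  have inv_sqrt: "(\<lambda>n. C / sqrt (real n)) \<longlonglongrightarrow> 0" for C
    by (intro tendsto_divide_0[OF tendsto_const] filterlim_at_top_imp_at_infinity
        filterlim_compose[OF sqrt_at_top filterlim_real_sequentially])
  have \<kappa>_lim: "\<kappa> \<longlonglongrightarrow> 0"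
  proof -
    have "(\<lambda>n. d n / n) \<longlonglongrightarrow> 0" unfolding d_def by real_asymp
    then have "(\<lambda>n. L\<^sup>2/2 * (\<bar>\<sigma> n - V\<bar> + d n/n) + (L*B)^3/sqrt n) \<longlonglongrightarrow> L\<^sup>2/2 * (\<bar>V - V\<bar> + 0) + 0"
      using var unfolding \<sigma>_def[symmetric] by (intro tendsto_intros inv_sqrt)
    then show ?thesis unfolding \<kappa>_def by simp
  qed
  have a_lim: "a \<longlonglongrightarrow> EF"
    unfolding a_def using tendsto_diff[OF EF tendsto_mult[OF tendsto_const[of K] inv_sqrt[of "B^4"]]] by simp
  have "(\<lambda>n. exp (- \<kappa> n) * a n) \<longlonglongrightarrow> exp (- 0) * EF"
    by (intro tendsto_intros \<kappa>_lim a_lim)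
  then have "(\<lambda>n. G * ennreal (exp (- \<kappa> n) * a n)) \<longlonglongrightarrow> G * ennreal EF"
    using G_fin by (intro ennreal_tendsto_cmult tendsto_ennrealI) auto
  \<comment> \<open>Neither this condition on \<open>n\<close> nor the next one mentions the
    estimator, so the threshold is uniform in \<open>T\<close>.\<close>
  then have ev1: "\<forall>\<^sub>F n in sequentially. c < G * ennreal (exp (- \<kappa> n) * a n)"
    using c' by (intro order_tendstoD(1)) (auto simp: mult.commute)
  have ev2: "\<forall>\<^sub>F n in sequentially. L * B \<le> sqrt (real n) / 2"
  proof -
    have "filterlim (\<lambda>n. sqrt (real n) / 2) at_top sequentially" by real_asymp
    then show ?thesis by (simp add: filterlim_at_top)
  qed
  show ?thesis
    using ev1 ev2 eventually_ge_at_top[of 1]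
  proof eventually_elim
    case (elim n)
    then have small: "L * B \<le> sqrt n / 2" and n: "1 \<le> n" by auto
    interpret \<nu>: prob_space "\<nu> n" by (rule prob)
    interpret P: prob_space "P n" by (rule P)
    note [measurable] = meas[of n]
    define X where "X y = (s n y)\<^sup>2 - \<sigma> n" for y
    have s2: "(s n y)\<^sup>2 \<le> B\<^sup>2" if "y \<in> space (\<nu> n)" for y
      using power_mono[OF B[OF that], of 2] by simp
    have s2_int: "integrable (\<nu> n) (\<lambda>y. (s n y)\<^sup>2)"
      using s2 by (intro \<nu>.integrable_bounded[where B="B\<^sup>2"]) auto
    have \<sigma>n: "0 \<le> \<sigma> n" "\<sigma> n \<le> B\<^sup>2"
    proof -
      show "0 \<le> \<sigma> n" unfolding \<sigma>_def by simp
      show "\<sigma> n \<le> B\<^sup>2" unfolding \<sigma>_def using s2 by (intro \<nu>.integral_le_const s2_int) auto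
    qed
    have X_B: "\<bar>X y\<bar> \<le> B\<^sup>2" if "y \<in> space (\<nu> n)" for y
      using s2[OF that] \<sigma>n zero_le_power2[of "s n y"] unfolding X_def by linarith
    have X_meas[measurable]: "X \<in> borel_measurable (\<nu> n)" unfolding X_def by measurable
    have X_mean: "(\<integral>y. X y \<partial>\<nu> n) = 0"
      unfolding X_def using s2_int
      by (subst Bochner_Integration.integral_diff) (simp_all add: \<sigma>_def \<nu>.prob_space)
    have X2: "(\<integral>y. (X y)\<^sup>2 \<partial>\<nu> n) \<le> B^4"
    proof (rule \<nu>.integral_le_const)
      have le: "(X y)\<^sup>2 \<le> B^4" if "y \<in> space (\<nu> n)" for y
        using power_mono[OF X_B[OF that], of 2] by simp
      then show "integrable (\<nu> n) (\<lambda>y. (X y)\<^sup>2)" by (intro \<nu>.integrable_bounded) auto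
      show "AE y in \<nu> n. (X y)\<^sup>2 \<le> B^4" using le by auto
    qed
    define S where "S y = (\<Sum>j<n. X (y j))" for y :: "nat \<Rightarrow> 'a"
    have X_comp: "(\<lambda>y. X (y j)) \<in> borel_measurable (P n)" if "j < n" for j
      unfolding P_def using that by (intro measurable_PiM_coordinate X_meas) auto
    have S_meas[measurable]: "S \<in> borel_measurable (P n)"
      unfolding S_def using X_comp by (intro borel_measurable_sum) auto
    have S_eq: "S y = (\<Sum>j<n. (s n (y j))\<^sup>2) - real n * \<sigma> n" for y
      by (simp add: S_def X_def sum_subtractf)
    have S_bound: "\<bar>S y\<bar> \<le> n * B\<^sup>2" if "y \<in> space (P n)" for y
    proof -
      have "\<bar>S y\<bar> \<le> (\<Sum>j<n. \<bar>X (y j)\<bar>)" unfolding S_def by (rule sum_abs)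
      also have "\<dots> \<le> (\<Sum>j<n. B\<^sup>2)"
        using that by (intro sum_mono X_B) (auto simp: P_def space_PiM)
      finally show ?thesis by simp
    qed
    have S2_int: "integrable (P n) (\<lambda>y. (S y)\<^sup>2)"
    proof (rule P.integrable_bounded)
      fix y assume "y \<in> space (P n)"
      from power_mono[OF S_bound[OF this], of 2] show "\<bar>(S y)\<^sup>2\<bar> \<le> (n * B\<^sup>2)\<^sup>2" by simp
    qed measurable
    have S2: "(\<integral>y. (S y)\<^sup>2 \<partial>P n) \<le> n * B^4"
      unfolding S_def P_def using X2 by (subst \<nu>.iid_sum_second_moment[OF X_meas X_B X_mean]) (auto intro!: mult_left_mono)
    have dn: "0 < d n" "(d n)\<^sup>2 = n * sqrt n"
    proof -
      show "0 < d n" using n by (simp add: d_def)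
      have "(d n)\<^sup>2 = real n powr (1 + 1/2)" by (simp add: d_def power2_eq_square flip: powr_add)
      also have "\<dots> = n * sqrt n" using n by (simp only: powr_add) (simp add: powr_half_sqrt)
      finally show "(d n)\<^sup>2 = n * sqrt n" .
    qed
    define A where "A = {y \<in> space (P n). \<bar>S y\<bar> \<le> d n}"
    have A[measurable]: "A \<in> sets (P n)" unfolding A_def by measurable
    have Fint: "integrable (P n) (\<lambda>y. F (\<Delta> n y))" "integrable (P n) (\<lambda>y. F (\<Delta> n y) * indicator A y)"
      using F_nonneg F_le by (intro P.integrable_bounded[where B=K]; auto simp: indicator_def K_def)+
    \<comment> \<open>Chebyshev's inequality in integrated form: outside \<open>A\<close> the ratio
      \<open>(S y)\<^sup>2 / (d n)\<^sup>2\<close> is at least 1 and pays for the lost value of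
      \<open>F\<close>.\<close>
    have a_le: "a n \<le> (\<integral>y. F (\<Delta> n y) * indicator A y \<partial>P n)"
    proof -
      have "(\<integral>y. F (\<Delta> n y) \<partial>P n) - K * ((\<integral>y. (S y)\<^sup>2 \<partial>P n) / (d n)\<^sup>2) = (\<integral>y. F (\<Delta> n y) - K * ((S y)\<^sup>2 / (d n)\<^sup>2) \<partial>P n)"
        using Fint S2_int by simp
      also have "\<dots> \<le> (\<integral>y. F (\<Delta> n y) * indicator A y \<partial>P n)"
      proof (rule integral_mono)
        show "integrable (P n) (\<lambda>y. F (\<Delta> n y) - K * ((S y)\<^sup>2 / (d n)\<^sup>2))" using Fint S2_int by simp
        fix y assume y: "y \<in> space (P n)"
        show "F (\<Delta> n y) - K * ((S y)\<^sup>2 / (d n)\<^sup>2) \<le> F (\<Delta> n y) * indicator A y"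
        proof (cases "y \<in> A")
          case True
          then show ?thesis by (simp add: K_def)
        next
          case False
          then have "d n \<le> \<bar>S y\<bar>" using y by (auto simp: A_def)
          then have "(d n)\<^sup>2 \<le> (S y)\<^sup>2" using dn(1) power_mono[of "d n" "\<bar>S y\<bar>" 2] by simp
          then have "1 \<le> (S y)\<^sup>2 / (d n)\<^sup>2" using dn(1) by (simp add: le_divide_eq)
          then have "K * 1 \<le> K * ((S y)\<^sup>2 / (d n)\<^sup>2)" by (intro mult_left_mono) (auto simp: K_def)
          then show ?thesis using F_le[of "\<Delta> n y"] False by simp
        qed
      qed (use Fint in auto)
      finally have "(\<integral>y. F (\<Delta> n y) \<partial>P n) - K * ((\<integral>y. (S y)\<^sup>2 \<partial>P n) / (d n)\<^sup>2) \<le> (\<integral>y. F (\<Delta> n y) * indicator A y \<partial>P n)" .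
      moreover have "K * ((\<integral>y. (S y)\<^sup>2 \<partial>P n) / (d n)\<^sup>2) \<le> K * (B^4 / sqrt n)"
      proof (rule mult_left_mono)
        have "(\<integral>y. (S y)\<^sup>2 \<partial>P n) / (d n)\<^sup>2 \<le> n * B^4 / (d n)\<^sup>2" by (rule divide_right_mono[OF S2]) simp
        also have "\<dots> = B^4 / sqrt n" using n by (simp add: dn(2))
        finally show "(\<integral>y. (S y)\<^sup>2 \<partial>P n) / (d n)\<^sup>2 \<le> B^4 / sqrt n" .
      qed (simp add: K_def)
      ultimately show ?thesis unfolding a_def by linarith
    qed
    show ?case
    proof (intro ballI)
      fix T :: "(nat \<Rightarrow> 'a) \<Rightarrow> real" assume "T \<in> borel_measurable (PiM {..<n} (\<lambda>_. \<nu> n))"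
      then have T[measurable]: "T \<in> borel_measurable (P n)" by (simp add: P_def)
      let ?\<Lambda> = "\<lambda>\<theta> y. \<Prod>j<n. 1 + \<theta> * s n (y j) / sqrt n"
      let ?w = "\<lambda>\<theta>. ennreal (exp (- \<tau> * \<theta>\<^sup>2/2)) * indicator {-L..L} \<theta>"
      let ?f = "\<lambda>\<theta> y. ennreal (\<bar>T y - \<theta>\<bar> powr u * ?\<Lambda> \<theta> y) * ?w \<theta>"
      interpret PS: pair_sigma_finite "lborel :: real measure" "P n" by unfold_locales
      have \<Lambda>_meas[measurable]: "(\<lambda>(\<theta>, y). ?\<Lambda> \<theta> y) \<in> borel_measurable (lborel \<Otimes>\<^sub>M P n)"
        unfolding split_beta'
        by (intro borel_measurable_prod borel_measurable_add borel_measurable_divide borel_measurable_times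
             measurable_compose[OF measurable_snd comp_meas]) auto
      have \<Lambda>_meas2: "?\<Lambda> \<theta> \<in> borel_measurable (P n)" for \<theta>
        by (intro borel_measurable_prod borel_measurable_add borel_measurable_divide borel_measurable_times comp_meas) auto
      have "(\<integral>\<^sup>+\<theta>. (\<integral>\<^sup>+y. ennreal (\<bar>T y - \<theta>\<bar> powr u * ?\<Lambda> \<theta> y) \<partial>P n) * ?w \<theta> \<partial>lborel)
        = (\<integral>\<^sup>+\<theta>. (\<integral>\<^sup>+y. ?f \<theta> y \<partial>P n) \<partial>lborel)"
        using \<Lambda>_meas2 by (intro nn_integral_cong nn_integral_multc[symmetric]) auto
      \<comment> \<open>After the exchange the inner integral is, for each sample \<open>y\<close>,
        the unnormalised posterior risk of the single number \<open>T y\<close>.\<close>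
      also have "\<dots> = (\<integral>\<^sup>+y. (\<integral>\<^sup>+\<theta>. ?f \<theta> y \<partial>lborel) \<partial>P n)"
        using PS.Fubini'[of ?f] by simp
      also have "\<dots> \<ge> (\<integral>\<^sup>+y. ennreal (exp (- \<kappa> n)) * (ennreal (F (\<Delta> n y) * indicator A y) * G) \<partial>P n)"
      proof (rule nn_integral_mono)
        fix y assume y: "y \<in> space (P n)"
        show "ennreal (exp (- \<kappa> n)) * (ennreal (F (\<Delta> n y) * indicator A y) * G) \<le> (\<integral>\<^sup>+\<theta>. ?f \<theta> y \<partial>lborel)"
        proof (cases "y \<in> A")
          case True
          have "ennreal (exp (- \<kappa> n)) * (ennreal (F (\<Delta> n y)) * G) \<le>
             ennreal (exp (- \<kappa> n)) * (\<integral>\<^sup>+\<theta>. ennreal (\<bar>T y - \<theta>\<bar> powr u * exp (\<theta> * \<Delta> n y - W * \<theta>\<^sup>2/2)) * indicator {-L..L} \<theta> \<partial>lborel)"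
            unfolding F_def G_def using gaussian_tilt_risk_lower[OF u L W] by (intro mult_left_mono) auto
          also have "\<dots> = (\<integral>\<^sup>+\<theta>. ennreal (exp (- \<kappa> n)) * (ennreal (\<bar>T y - \<theta>\<bar> powr u * exp (\<theta> * \<Delta> n y - W * \<theta>\<^sup>2/2)) * indicator {-L..L} \<theta>) \<partial>lborel)"
            by (intro nn_integral_cmult[symmetric]) auto
          also have "\<dots> \<le> (\<integral>\<^sup>+\<theta>. ?f \<theta> y \<partial>lborel)"
          proof (rule nn_integral_mono)
            fix \<theta> :: real
            show "ennreal (exp (- \<kappa> n)) * (ennreal (\<bar>T y - \<theta>\<bar> powr u * exp (\<theta> * \<Delta> n y - W * \<theta>\<^sup>2/2)) * indicator {-L..L} \<theta>) \<le> ?f \<theta> y"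
            proof (cases "\<theta> \<in> {-L..L}")
              case True
              have "exp (\<theta> * \<Delta> n y - V * \<theta>\<^sup>2/2 - \<kappa> n) \<le> ?\<Lambda> \<theta> y"
                unfolding \<Delta>_def \<kappa>_def
              proof (rule likelihood_lower[OF n B0 _ small])
                show "\<bar>s n (y j)\<bar> \<le> B" if "j < n" for j
                  using y that by (intro B) (auto simp: P_def space_PiM)
                show "\<bar>(\<Sum>j<n. (s n (y j))\<^sup>2) - real n * \<sigma> n\<bar> \<le> d n"
                  using \<open>y \<in> A\<close> by (simp add: A_def S_eq)
              qed (use L True in auto)
              then have "\<bar>T y - \<theta>\<bar> powr u * exp (\<theta> * \<Delta> n y - V * \<theta>\<^sup>2/2 - \<kappa> n) * exp (- \<tau> * \<theta>\<^sup>2/2) \<le>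
                 \<bar>T y - \<theta>\<bar> powr u * ?\<Lambda> \<theta> y * exp (- \<tau> * \<theta>\<^sup>2/2)"
                by (intro mult_right_mono mult_left_mono) auto
              \<comment> \<open>The information \<open>V\<close> from the likelihood and the
                precision \<open>\<tau>\<close> of the prior add up to \<open>W\<close>.\<close>
              moreover have "exp (\<theta> * \<Delta> n y - V * \<theta>\<^sup>2/2 - \<kappa> n) * exp (- \<tau> * \<theta>\<^sup>2/2) = exp (- \<kappa> n) * exp (\<theta> * \<Delta> n y - W * \<theta>\<^sup>2/2)"
                unfolding mult_exp_exp by (simp add: W_def field_simps)
              ultimately have "exp (- \<kappa> n) * (\<bar>T y - \<theta>\<bar> powr u * exp (\<theta> * \<Delta> n y - W * \<theta>\<^sup>2/2)) \<le>
                 \<bar>T y - \<theta>\<bar> powr u * ?\<Lambda> \<theta> y * exp (- \<tau> * \<theta>\<^sup>2/2)"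
                by (simp only: mult.assoc mult.left_commute)
              then have "ennreal (exp (- \<kappa> n) * (\<bar>T y - \<theta>\<bar> powr u * exp (\<theta> * \<Delta> n y - W * \<theta>\<^sup>2/2))) \<le>
                 ennreal (\<bar>T y - \<theta>\<bar> powr u * ?\<Lambda> \<theta> y * exp (- \<tau> * \<theta>\<^sup>2/2))" by (rule ennreal_leI)
              then show ?thesis using True by (simp add: ennreal_mult' ennreal_mult'' del: minus_mult_left)
            qed simp
          qed
          finally show ?thesis using True by simp
        qed simp
      qed
      finally have "(\<integral>\<^sup>+y. ennreal (exp (- \<kappa> n)) * (ennreal (F (\<Delta> n y) * indicator A y) * G) \<partial>P n)
          \<le> (\<integral>\<^sup>+\<theta>. (\<integral>\<^sup>+y. ennreal (\<bar>T y - \<theta>\<bar> powr u * ?\<Lambda> \<theta> y) \<partial>P n) * ?w \<theta> \<partial>lborel)" .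
      moreover have "c \<le> (\<integral>\<^sup>+y. ennreal (exp (- \<kappa> n)) * (ennreal (F (\<Delta> n y) * indicator A y) * G) \<partial>P n)"
      proof -
        have "c \<le> G * ennreal (exp (- \<kappa> n) * a n)" using elim by simp
        also have "\<dots> \<le> G * ennreal (exp (- \<kappa> n) * (\<integral>y. F (\<Delta> n y) * indicator A y \<partial>P n))"
          using a_le by (intro mult_left_mono ennreal_leI) auto
        also have "\<dots> = ennreal (exp (- \<kappa> n)) * (ennreal (\<integral>y. F (\<Delta> n y) * indicator A y \<partial>P n) * G)"
          by (simp add: ennreal_mult' mult_ac)
        also have "ennreal (\<integral>y. F (\<Delta> n y) * indicator A y \<partial>P n) = (\<integral>\<^sup>+y. ennreal (F (\<Delta> n y) * indicator A y) \<partial>P n)"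
          using F_nonneg by (intro nn_integral_eq_integral[symmetric] Fint) auto
        also have "ennreal (exp (- \<kappa> n)) * ((\<integral>\<^sup>+y. ennreal (F (\<Delta> n y) * indicator A y) \<partial>P n) * G) =
           (\<integral>\<^sup>+y. ennreal (exp (- \<kappa> n)) * (ennreal (F (\<Delta> n y) * indicator A y) * G) \<partial>P n)"
          by (simp add: nn_integral_cmult nn_integral_multc)
        finally show ?thesis .
      qed
      ultimately show "c \<le> (\<integral>\<^sup>+\<theta>. (\<integral>\<^sup>+y. ennreal (\<bar>T y - \<theta>\<bar> powr u * ?\<Lambda> \<theta> y) \<partial>PiM {..<n} (\<lambda>_. \<nu> n)) * ?w \<theta> \<partial>lborel)"
        unfolding P_def by order
    qed
  qed
qed

section \<open>Densities of private mechanisms\<close>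

text \<open>\<open>mix\<close> is given by \<open>measure_of\<close>, which reproduces its set
  function only when that is a measure; agreement on \<open>sets Y\<close> with the
  \<open>emeasure\<close> of a density supplies this.\<close>

lemma mix_eq_density:
  assumes sets: "sets \<mu> = sets Y"
    and q: "\<And>i. i \<in> {1..k} \<Longrightarrow> q i \<in> borel_measurable \<mu>" "\<And>i y. i \<in> {1..k} \<Longrightarrow> y \<in> space \<mu> \<Longrightarrow> 0 \<le> q i y"
    and Q: "\<And>i. i \<in> {1..k} \<Longrightarrow> Q i = density \<mu> (\<lambda>y. ennreal (q i y))"
    and p: "\<And>i. i \<in> {1..k} \<Longrightarrow> 0 \<le> p i"
  shows "mix k Y Q p = density \<mu> (\<lambda>y. ennreal (\<Sum>i=1..k. p i * q i y))"
proof -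
  let ?d = "density \<mu> (\<lambda>y. ennreal (\<Sum>i=1..k. p i * q i y))"
  have space: "space \<mu> = space Y" using sets by (rule sets_eq_imp_space_eq)
  have "(\<Sum>i=1..k. ennreal (p i) * emeasure (Q i) S) = emeasure ?d S" if S: "S \<in> sets Y" for S
  proof -
    have "emeasure ?d S = (\<integral>\<^sup>+y. (\<Sum>i=1..k. ennreal (p i) * (ennreal (q i y) * indicator S y)) \<partial>\<mu>)"
    proof (subst emeasure_density)
      show "(\<lambda>y. ennreal (\<Sum>i=1..k. p i * q i y)) \<in> borel_measurable \<mu>" using q by auto
      have "ennreal (\<Sum>i=1..k. p i * q i y) = (\<Sum>i=1..k. ennreal (p i) * ennreal (q i y))" if "y \<in> space \<mu>" for y
        using p q(2) that by (subst sum_ennreal[symmetric]) (auto intro!: sum.cong ennreal_mult')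
      then show "(\<integral>\<^sup>+y. ennreal (\<Sum>i=1..k. p i * q i y) * indicator S y \<partial>\<mu>) =
          (\<integral>\<^sup>+y. (\<Sum>i=1..k. ennreal (p i) * (ennreal (q i y) * indicator S y)) \<partial>\<mu>)"
        by (intro nn_integral_cong) (simp add: sum_distrib_right mult.assoc)
    qed (use S sets in auto)
    also have "\<dots> = (\<Sum>i=1..k. ennreal (p i) * (\<integral>\<^sup>+y. ennreal (q i y) * indicator S y \<partial>\<mu>))"
      using q S sets by (subst nn_integral_sum) (auto intro!: sum.cong nn_integral_cmult)
    also have "\<dots> = (\<Sum>i=1..k. ennreal (p i) * emeasure (Q i) S)"
      using q S sets by (intro sum.cong) (auto simp: Q emeasure_density)
    finally show ?thesis by simp
  qed
  then have "mix k Y Q p = measure_of (space Y) (sets Y) (emeasure ?d)"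
    unfolding mix_def by (intro measure_of_eq) (auto simp: sets.space_closed sets.sigma_sets_eq)
  also have "\<dots> = ?d"
    using measure_of_of_measure[of ?d] by (simp add: sets space)
  finally show ?thesis .
qed

lemma PiM_density:
  fixes f :: "'a \<Rightarrow> ennreal" and I :: "'i set"
  assumes "finite I" "prob_space M" "prob_space (density M f)" and [measurable]: "f \<in> borel_measurable M"
  shows "PiM I (\<lambda>_. density M f) = density (PiM I (\<lambda>_. M)) (\<lambda>y. \<Prod>i\<in>I. f (y i))"
proof -
  interpret M: prob_space M by fact
  interpret D: prob_space "density M f" by fact
  interpret P: product_sigma_finite "\<lambda>_::'i. M" ..
  interpret PD: product_sigma_finite "\<lambda>_::'i. density M f" ..
  have [measurable]: "(\<lambda>y. \<Prod>i\<in>I. f (y i)) \<in> borel_measurable (PiM I (\<lambda>_. M))"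
    by (intro borel_measurable_prod_ennreal measurable_compose[OF measurable_component_singleton]) auto
  have "density (PiM I (\<lambda>_. M)) (\<lambda>y. \<Prod>i\<in>I. f (y i)) = PiM I (\<lambda>_. density M f)"
  proof (rule PD.PiM_eqI)
    show "sets (density (PiM I (\<lambda>_. M)) (\<lambda>y. \<Prod>i\<in>I. f (y i))) = sets (PiM I (\<lambda>_. density M f))"
      by (auto intro!: sets_PiM_cong)
    fix A assume A: "\<And>i. i \<in> I \<Longrightarrow> A i \<in> sets (density M f)"
    have "emeasure (density (PiM I (\<lambda>_. M)) (\<lambda>y. \<Prod>i\<in>I. f (y i))) (Pi\<^sub>E I A) =
       (\<integral>\<^sup>+y. (\<Prod>i\<in>I. f (y i)) * indicator (Pi\<^sub>E I A) y \<partial>PiM I (\<lambda>_. M))"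
      using A assms(1) by (intro emeasure_density sets_PiM_I_finite) auto
    also have "\<dots> = (\<integral>\<^sup>+y. (\<Prod>i\<in>I. f (y i) * indicator (A i) (y i)) \<partial>PiM I (\<lambda>_. M))"
    proof (intro nn_integral_cong)
      fix y assume y: "y \<in> space (PiM I (\<lambda>_. M))"
      have "indicator (Pi\<^sub>E I A) y = (\<Prod>i\<in>I. indicator (A i) (y i) :: ennreal)"
        using y assms(1) by (auto simp: indicator_def space_PiM PiE_iff prod_zero_iff)
      then show "(\<Prod>i\<in>I. f (y i)) * indicator (Pi\<^sub>E I A) y = (\<Prod>i\<in>I. f (y i) * indicator (A i) (y i))"
        by (simp add: prod.distrib)
    qed
    also have "\<dots> = (\<Prod>i\<in>I. \<integral>\<^sup>+x. f x * indicator (A i) x \<partial>M)"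
      using A assms(1) by (intro P.product_nn_integral_prod) auto
    also have "\<dots> = (\<Prod>i\<in>I. emeasure (density M f) (A i))"
      using A by (intro prod.cong) (auto simp: emeasure_density)
    finally show "emeasure (density (PiM I (\<lambda>_. M)) (\<lambda>y. \<Prod>i\<in>I. f (y i))) (Pi\<^sub>E I A) = (\<Prod>i\<in>I. emeasure (density M f) (A i))" .
  qed (use assms in auto)
  then show ?thesis ..
qed

text \<open>Privacy makes every \<open>Q i\<close> absolutely continuous with respect to
  \<open>Q 1\<close>, which yields densities whose ratios are bounded almost everywhere. A change on
  a null set makes the bounds hold everywhere, so that the finite-dimensional inequality for the
  vector of densities is available at each output, and division by the average passes to the output
  law at the uniform input.\<close>

lemma ldp_densities:
  assumes k: "1 \<le> k" and "ldp \<epsilon> k Y Q"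
  obtains \<mu> q where "prob_space \<mu>" "sets \<mu> = sets Y"
    "\<And>i. i \<in> {1..k} \<Longrightarrow> q i \<in> borel_measurable \<mu>"
    "\<And>i y. i \<in> {1..k} \<Longrightarrow> 0 < q i y"
    "\<And>i j y. i \<in> {1..k} \<Longrightarrow> j \<in> {1..k} \<Longrightarrow> q i y \<le> exp \<epsilon> * q j y"
    "\<And>y. (\<Sum>i=1..k. q i y) = real k"
    "\<And>i. i \<in> {1..k} \<Longrightarrow> Q i = density \<mu> (\<lambda>y. ennreal (q i y))"
proof -
  let ?I = "{1..k}"
  define M where "M = Q 1"
  have one: "1 \<in> ?I" using k by auto
  have Q: "prob_space (Q i)" "sets (Q i) = sets Y" if "i \<in> ?I" for i
    using assms that by (auto simp: ldp_def is_mechanism_def)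
  have le: "measure (Q i) S \<le> exp \<epsilon> * measure (Q j) S" if "i \<in> ?I" "j \<in> ?I" "S \<in> sets Y" for i j S
    using assms that by (auto simp: ldp_def)
  interpret M: prob_space M unfolding M_def using Q one by blast
  have sets_M: "sets M = sets Y" unfolding M_def using Q one by blast
  have ele: "emeasure (Q i) S \<le> ennreal (exp \<epsilon>) * emeasure (Q j) S" if "i \<in> ?I" "j \<in> ?I" "S \<in> sets Y" for i j S
  proof -
    interpret i: prob_space "Q i" using Q that by blast
    interpret j: prob_space "Q j" using Q that by blast
    show ?thesis using le[OF that]
      by (simp add: i.emeasure_eq_measure j.emeasure_eq_measure ennreal_mult'[symmetric])
  qed
  have "\<exists>D. D \<in> borel_measurable M \<and> (\<forall>x. 0 \<le> D x) \<and> (AE x in Q i. 0 < D x) \<and> Q i = density M (\<lambda>x. ennreal (D x))"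
    if i: "i \<in> ?I" for i
  proof -
    interpret i: prob_space "Q i" using Q i by blast
    have ac: "absolutely_continuous M (Q i)"
    proof -
      have "emeasure (Q i) S = 0" if "S \<in> sets Y" "emeasure (Q 1) S = 0" for S
        using ele[OF i one that(1)] that(2) by simp
      then show ?thesis using Q(2)[OF i] sets_M by (auto simp: absolutely_continuous_def null_sets_def M_def)
    qed
    have s: "sets (Q i) = sets M" using Q(2)[OF i] sets_M by simp
    obtain D where D: "D \<in> borel_measurable M" "AE x in M. RN_deriv M (Q i) x = ennreal (D x)"
        "AE x in Q i. 0 < D x" "\<And>x. 0 \<le> D x"
      by (rule M.real_RN_deriv[OF i.finite_measure_axioms ac s]) blast
    have "Q i = density M (RN_deriv M (Q i))" using M.density_RN_deriv[OF ac s] by simp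
    also have "\<dots> = density M (\<lambda>x. ennreal (D x))" using D by (intro density_cong) auto
    finally show ?thesis using D by blast
  qed
  then obtain D where D: "\<And>i. i \<in> ?I \<Longrightarrow> D i \<in> borel_measurable M" "\<And>i x. i \<in> ?I \<Longrightarrow> 0 \<le> D i x"
      "\<And>i. i \<in> ?I \<Longrightarrow> AE x in Q i. 0 < D i x" "\<And>i. i \<in> ?I \<Longrightarrow> Q i = density M (\<lambda>x. ennreal (D i x))"
    by metis
  have AE_le: "AE x in M. D i x \<le> exp \<epsilon> * D j x" if ij: "i \<in> ?I" "j \<in> ?I" for i j
  proof -
    \<comment> \<open>The set of violations. On it the densities satisfy the reverse inequality
      pointwise, so positive measure would order the integrals strictly, against the privacy bound
      for \<open>S\<close>.\<close>
    define S where "S = {x \<in> space M. exp \<epsilon> * D j x < D i x}"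
    note [measurable] = D(1)[OF ij(1)] D(1)[OF ij(2)]
    have S[measurable]: "S \<in> sets M" unfolding S_def by measurable
    let ?f = "\<lambda>x. ennreal (exp \<epsilon>) * (ennreal (D j x) * indicator S x)"
    let ?g = "\<lambda>x. ennreal (D i x) * indicator S x"
    have f: "integral\<^sup>N M ?f = ennreal (exp \<epsilon>) * emeasure (Q j) S"
      by (subst nn_integral_cmult) (auto simp: D(4)[OF ij(2)] emeasure_density)
    have g: "integral\<^sup>N M ?g = emeasure (Q i) S"
      by (auto simp: D(4)[OF ij(1)] emeasure_density)
    have fg: "?f x \<le> ?g x" if "x \<in> space M" for x
      using that D(2)[OF ij(1)] by (auto simp: S_def indicator_def ennreal_mult'[symmetric] intro!: ennreal_leI)
    interpret j: prob_space "Q j" using Q ij by blast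
    have "AE x in M. ?g x \<le> ?f x"
    proof (rule ccontr)
      assume "\<not> (AE x in M. ?g x \<le> ?f x)"
      then have "integral\<^sup>N M ?f < integral\<^sup>N M ?g"
        using fg by (intro nn_integral_less) (auto simp: f ennreal_mult_eq_top_iff j.emeasure_eq_measure)
      moreover have "emeasure (Q i) S \<le> ennreal (exp \<epsilon>) * emeasure (Q j) S"
        using ele[OF ij] S sets_M by blast
      ultimately show False unfolding f g by simp
    qed
    then show ?thesis using AE_space
    proof eventually_elim
      case (elim x)
      show ?case
      proof (rule ccontr)
        assume "\<not> ?thesis"
        then have "x \<in> S" using elim by (auto simp: S_def)
        then show False using elim D(2)[OF ij(1), of x] D(2)[OF ij(2), of x]
          by (auto simp: S_def indicator_def ennreal_mult'[symmetric])
      qed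
    qed
  qed
  define good where "good x \<longleftrightarrow> 0 < D 1 x \<and> (\<forall>i\<in>?I. \<forall>j\<in>?I. D i x \<le> exp \<epsilon> * D j x)" for x
  have "AE x in M. 0 < D 1 x" using D(3)[OF one] unfolding M_def .
  moreover have "AE x in M. \<forall>i\<in>?I. \<forall>j\<in>?I. D i x \<le> exp \<epsilon> * D j x"
    using AE_le by (auto simp: AE_ball_countable)
  ultimately have AE_good: "AE x in M. good x" unfolding good_def by eventually_elim auto
  have good_meas[measurable]: "Measurable.pred M good"
    unfolding good_def using D(1) one by (auto intro!: pred_intros_logic pred_intros_finite)
  \<comment> \<open>On the exceptional null set all densities become 1, where the ratio bound reads
    \<open>1 \<le> exp \<epsilon>\<close>.\<close>
  define r where "r i x = (if good x then D i x else 1)" for i x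
  have r_meas: "r i \<in> borel_measurable M" if "i \<in> ?I" for i
    unfolding r_def using D(1)[OF that] by measurable
  \<comment> \<open>Privacy for two equal inputs, evaluated on the whole output space.\<close>
  have exp1: "1 \<le> exp \<epsilon>"
    using le[OF one one, of "space Y"] M.prob_space sets_M sets_eq_imp_space_eq[OF sets_M] by (simp add: M_def)
  have r_le: "r i x \<le> exp \<epsilon> * r j x" if "i \<in> ?I" "j \<in> ?I" for i j x
    using that exp1 by (auto simp: r_def good_def)
  have r_pos: "0 < r i x" if "i \<in> ?I" for i x
  proof -
    have "0 < r 1 x" by (auto simp: r_def good_def)
    also have "r 1 x \<le> exp \<epsilon> * r i x" by (rule r_le[OF one that])
    finally show ?thesis by (simp add: zero_less_mult_iff)
  qed
  have Qr: "Q i = density M (\<lambda>x. ennreal (r i x))" if "i \<in> ?I" for i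
    unfolding D(4)[OF that] using AE_good D(1)[OF that] r_meas[OF that]
    by (intro density_cong) (auto simp: r_def elim: eventually_mono)
  \<comment> \<open>Density of the output law at the uniform input; dividing by it makes the new
    densities sum to \<open>k\<close> at every point.\<close>
  define h where "h x = (\<Sum>i=1..k. r i x) / k" for x
  have h_pos: "0 < h x" for x
    unfolding h_def using r_pos k one by (intro divide_pos_pos sum_pos) auto
  have h_meas[measurable]: "h \<in> borel_measurable M" unfolding h_def using r_meas by auto
  define \<mu> where "\<mu> = density M (\<lambda>x. ennreal (h x))"
  define q where "q i x = r i x / h x" for i x
  have q_meas: "q i \<in> borel_measurable M" if "i \<in> ?I" for i
    unfolding q_def using r_meas[OF that] by measurable
  have Qq: "Q i = density \<mu> (\<lambda>x. ennreal (q i x))" if "i \<in> ?I" for i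
  proof -
    have "ennreal (h x) * ennreal (q i x) = ennreal (r i x)" for x
      using h_pos[of x] by (simp add: q_def ennreal_mult'[symmetric])
    then show ?thesis unfolding \<mu>_def Qr[OF that] using q_meas[OF that]
      by (subst density_density_eq) auto
  qed
  have "emeasure \<mu> (space \<mu>) = (\<integral>\<^sup>+x. ennreal (h x) \<partial>M)"
    by (simp add: \<mu>_def emeasure_density cong: nn_integral_cong)
  also have "\<dots> = (\<integral>\<^sup>+x. (\<Sum>i=1..k. ennreal (1/k) * ennreal (r i x)) \<partial>M)"
  proof (intro nn_integral_cong)
    fix x
    have "h x = (\<Sum>i=1..k. 1/k * r i x)" by (simp add: h_def sum_divide_distrib)
    also have "ennreal \<dots> = (\<Sum>i=1..k. ennreal (1/k * r i x))"
      using r_pos by (intro sum_ennreal[symmetric]) (auto simp: less_imp_le)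
    also have "\<dots> = (\<Sum>i=1..k. ennreal (1/k) * ennreal (r i x))"
      by (intro sum.cong refl ennreal_mult') auto
    finally show "ennreal (h x) = (\<Sum>i=1..k. ennreal (1/k) * ennreal (r i x))" .
  qed
  also have "\<dots> = (\<Sum>i=1..k. ennreal (1/k) * (\<integral>\<^sup>+x. ennreal (r i x) \<partial>M))"
    using r_meas by (subst nn_integral_sum) (auto intro!: sum.cong nn_integral_cmult)
  also have "\<dots> = (\<Sum>i=1..k. ennreal (1/k) * 1)"
  proof (intro sum.cong refl arg_cong2[where f="(*)"])
    fix i assume i: "i \<in> ?I"
    interpret i: prob_space "Q i" using Q i by blast
    show "(\<integral>\<^sup>+x. ennreal (r i x) \<partial>M) = 1"
      using i.emeasure_space_1 r_meas[OF i] unfolding Qr[OF i]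
      by (simp add: emeasure_density cong: nn_integral_cong)
  qed
  also have "\<dots> = 1" using k by (simp add: ennreal_of_nat_eq_real_of_nat ennreal_mult'[symmetric])
  finally have prob: "prob_space \<mu>" by (rule prob_spaceI)
  show ?thesis
  proof (rule that[of \<mu> q])
    show "(\<Sum>i=1..k. q i y) = real k" for y
    proof -
      have "(\<Sum>i=1..k. q i y) = (\<Sum>i=1..k. r i y) / h y" by (simp add: q_def sum_divide_distrib)
      also have "\<dots> = real k"
      proof -
        have "(\<Sum>i=1..k. r i y) = real k * h y" using k by (simp add: h_def)
        then show ?thesis using h_pos[of y] by simp
      qed
      finally show ?thesis .
    qed
    show "q i y \<le> exp \<epsilon> * q j y" if "i \<in> ?I" "j \<in> ?I" for i j y
      using r_le[OF that, of y] h_pos[of y] by (simp add: q_def divide_right_mono)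
  qed (use prob sets_M q_meas r_pos h_pos Qq in \<open>auto simp: q_def \<mu>_def\<close>)
qed

section \<open>Local submodels around the uniform distribution\<close>

locale channel_densities = prob_space \<mu> for \<mu> :: "'b measure" +
  fixes k :: nat and q :: "nat \<Rightarrow> 'b \<Rightarrow> real"
  assumes k: "2 \<le> k"
    and q_meas: "\<And>i. i \<in> {1..k} \<Longrightarrow> q i \<in> borel_measurable \<mu>"
    and q_pos: "\<And>i y. i \<in> {1..k} \<Longrightarrow> 0 < q i y"
    and q_sum: "\<And>y. (\<Sum>i=1..k. q i y) = real k"
    and q_int: "\<And>i. i \<in> {1..k} \<Longrightarrow> (\<integral>y. q i y \<partial>\<mu>) = 1"
begin

text \<open>Fisher information per observation at the uniform input along the i-th unit vector minus
  the constant vector 1/k; the score is \<open>q i y - 1\<close> because the densities sum to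
  \<open>k\<close>.\<close>

definition info :: "nat \<Rightarrow> real" where
  "info i = (\<integral>y. (q i y - 1)\<^sup>2 \<partial>\<mu>)"

definition dens :: "nat \<Rightarrow> (nat \<Rightarrow> real) \<Rightarrow> 'b \<Rightarrow> real" where
  "dens n \<theta> y = 1 + (\<Sum>j=1..k. \<theta> j * (q j y - 1)) / sqrt n"

definition model :: "nat \<Rightarrow> (nat \<Rightarrow> real) \<Rightarrow> 'b measure" where
  "model n \<theta> = density \<mu> (\<lambda>y. ennreal (dens n \<theta> y))"

definition parameter_box :: "real \<Rightarrow> (nat \<Rightarrow> real) set" where
  "parameter_box L = {\<theta>. \<forall>j\<in>{1..k}. \<bar>\<theta> j\<bar> \<le> L}"

lemma q_le: "i \<in> {1..k} \<Longrightarrow> q i y \<le> k"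
  using member_le_sum[of i "{1..k}" "\<lambda>i. q i y"] q_pos[of _ y] unfolding q_sum by (auto simp: less_imp_le)

lemma score_bound: "i \<in> {1..k} \<Longrightarrow> \<bar>q i y - 1\<bar> \<le> k"
  using q_le[of i y] q_pos[of i y] k by linarith

lemma q_integrable: "i \<in> {1..k} \<Longrightarrow> integrable \<mu> (q i)"
  using q_le[of i] q_pos[of i] by (intro integrable_bounded[where B=k] q_meas) (auto simp: abs_of_pos)

lemma dens_meas: "dens n \<theta> \<in> borel_measurable \<mu>"
  unfolding dens_def using q_meas by (intro borel_measurable_add borel_measurable_divide borel_measurable_sum borel_measurable_times) auto

lemma dens_zero: "dens n (\<lambda>_. 0) y = 1"
  by (simp add: dens_def)

text \<open>Bounding \<open>\<bar>q j y - 1\<bar>\<close> by \<open>q j y + 1\<close> before summing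
  exploits that the densities sum to \<open>k\<close>, so the constant is linear in
  \<open>k\<close>.\<close>

lemma dens_bound:
  assumes "\<theta> \<in> parameter_box L"
  shows "\<bar>dens n \<theta> y - 1\<bar> \<le> 2 * real k * L / sqrt n"
proof -
  have "\<bar>\<Sum>j=1..k. \<theta> j * (q j y - 1)\<bar> \<le> (\<Sum>j=1..k. L * (q j y + 1))"
  proof (rule order_trans[OF sum_abs], rule sum_mono)
    fix j assume j: "j \<in> {1..k}"
    have "\<bar>\<theta> j\<bar> \<le> L" using assms j by (auto simp: parameter_box_def)
    moreover have "\<bar>q j y - 1\<bar> \<le> q j y + 1" using q_pos[OF j, of y] by linarith
    ultimately show "\<bar>\<theta> j * (q j y - 1)\<bar> \<le> L * (q j y + 1)"
      unfolding abs_mult by (intro mult_mono) auto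
  qed
  also have "\<dots> = 2 * real k * L" unfolding sum_distrib_left[symmetric] sum.distrib q_sum by simp
  finally show ?thesis by (simp add: dens_def abs_divide divide_right_mono)
qed

text \<open>Source of the threshold \<open>4 * real k * L \<le> sqrt n\<close>: the perturbation
  stays within 1/2, which keeps the models genuine densities and the scores bounded by
  \<open>2 * k\<close>.\<close>

lemma dens_half:
  assumes "\<theta> \<in> parameter_box L" "4 * real k * L \<le> sqrt n" "1 \<le> n"
  shows "1/2 \<le> dens n \<theta> y"
proof -
  have "2 * real k * L / sqrt n \<le> 1/2" using assms by (simp add: field_simps)
  then show ?thesis using dens_bound[OF assms(1), of n y] by linarith
qed

lemma integral_dens: "(\<integral>y. dens n \<theta> y \<partial>\<mu>) = 1" and dens_integrable: "integrable \<mu> (dens n \<theta>)"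
proof -
  have int: "integrable \<mu> (\<lambda>y. \<theta> j * (q j y - 1))" if "j \<in> {1..k}" for j
    using q_integrable[OF that] by (intro integrable_mult_right Bochner_Integration.integrable_diff) auto
  have zero: "(\<integral>y. \<theta> j * (q j y - 1) \<partial>\<mu>) = 0" if "j \<in> {1..k}" for j
    using q_integrable[OF that] q_int[OF that] by (simp add: prob_space)
  have sum_int: "integrable \<mu> (\<lambda>y. \<Sum>j=1..k. \<theta> j * (q j y - 1))"
    using int by (rule Bochner_Integration.integrable_sum)
  then show "integrable \<mu> (dens n \<theta>)" unfolding dens_def by simp
  have "(\<integral>y. (\<Sum>j=1..k. \<theta> j * (q j y - 1)) \<partial>\<mu>) = 0"
    using int by (subst Bochner_Integration.integral_sum) (blast intro: sum.neutral zero)+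
  then show "(\<integral>y. dens n \<theta> y \<partial>\<mu>) = 1"
    unfolding dens_def using sum_int by (simp add: prob_space)
qed

lemma model_prob:
  assumes "\<And>y. 0 \<le> dens n \<theta> y"
  shows "prob_space (model n \<theta>)"
proof
  have "emeasure (model n \<theta>) (space (model n \<theta>)) = (\<integral>\<^sup>+y. ennreal (dens n \<theta> y) \<partial>\<mu>)"
    using dens_meas by (simp add: model_def emeasure_density cong: nn_integral_cong)
  also have "\<dots> = 1" using assms by (subst nn_integral_eq_integral) (auto simp: dens_integrable integral_dens)
  finally show "emeasure (model n \<theta>) (space (model n \<theta>)) = 1" .
qed

lemma sets_model [simp, measurable_cong]: "sets (model n \<theta>) = sets \<mu>"
  by (simp add: model_def)

lemma dens_upd:
  assumes "i \<in> {1..k}" "\<theta> i = 0"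
  shows "dens n (\<theta>(i := t)) y = dens n \<theta> y + t * (q i y - 1) / sqrt n"
  using assms unfolding dens_def
  by (subst (1 2) sum.remove[of _ i]) (auto simp: add_divide_distrib intro!: sum.cong)

lemma conditional_bayes_risk_lower:
  fixes L \<tau> u :: real and c :: ennreal
  assumes i: "i \<in> {1..k}" and \<tau>: "0 < \<tau>" and u: "1 \<le> u" and L: "0 < L"
  defines "W \<equiv> info i + \<tau>"
  assumes c: "c < (\<integral>\<^sup>+z. ennreal (exp ((sqrt (info i) * z)\<^sup>2/(2*W)) * max 0 (1 - 2*\<bar>sqrt (info i) * z\<bar>/(W*L))) \<partial>std_normal_distribution) *
     (\<integral>\<^sup>+\<theta>. ennreal (\<bar>\<theta>\<bar> powr u * exp (- W * \<theta>\<^sup>2/2)) * indicator {-L/2..L/2} \<theta> \<partial>lborel)"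
  shows "\<forall>\<^sub>F n in sequentially. \<forall>\<theta>\<in>parameter_box L. \<theta> i = 0 \<longrightarrow> (\<forall>T\<in>borel_measurable (PiM {..<n} (\<lambda>_. \<mu>)).
    c \<le> (\<integral>\<^sup>+t. (\<integral>\<^sup>+y. ennreal (\<bar>T y - t\<bar> powr u) \<partial>PiM {..<n} (\<lambda>_. model n (\<theta>(i := t))))
       * (ennreal (exp (- \<tau> * t\<^sup>2/2)) * indicator {-L..L} t) \<partial>lborel))"
    (is "\<forall>\<^sub>F n in sequentially. \<forall>\<theta>\<in>parameter_box L. \<theta> i = 0 \<longrightarrow> ?good n \<theta>")
proof -
  have "\<forall>\<^sub>F n in sequentially. 4 * real k * L \<le> sqrt (real n) \<and> 1 \<le> n"
  proof -
    have "filterlim (\<lambda>n. sqrt (real n)) at_top sequentially" by real_asymp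
    then show ?thesis by (simp add: filterlim_at_top eventually_conj_iff eventually_ge_at_top)
  qed
  then obtain N where N: "\<And>n. N \<le> n \<Longrightarrow> 4 * real k * L \<le> sqrt (real n)" "\<And>n. N \<le> n \<Longrightarrow> 1 \<le> n"
    by (auto simp: eventually_sequentially)
  \<comment> \<open>Uniformity in the base point: follow a sequence of worst base points.\<close>
  define bad where "bad n \<theta> \<longleftrightarrow> N \<le> n \<and> \<theta> \<in> parameter_box L \<and> \<theta> i = 0 \<and> \<not> ?good n \<theta>" for n \<theta>
  \<comment> \<open>The zero vector, with density 1, is the default. As \<open>bad\<close> demands
    \<open>N \<le> n\<close>, the default also covers small \<open>n\<close>, so the density is at
    least 1/2 in every row of the array.\<close>
  define \<theta> where "\<theta> n = (if \<exists>\<eta>. bad n \<eta> then SOME \<eta>. bad n \<eta> else (\<lambda>_. 0))" for n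
  have \<theta>_bad: "bad n (\<theta> n)" if "bad n \<eta>" for n \<eta>
    using that someI_ex[of "bad n"] by (auto simp: \<theta>_def)
  have \<theta>_cases: "\<theta> n = (\<lambda>_. 0) \<or> bad n (\<theta> n)" for n
    using someI_ex[of "bad n"] by (auto simp: \<theta>_def)
  have \<theta>_box: "\<theta> n \<in> parameter_box L" and \<theta>_i: "\<theta> n i = 0" for n
    using \<theta>_cases[of n] L by (auto simp: bad_def parameter_box_def)
  have half: "1/2 \<le> dens n (\<theta> n) y" for n y
    using \<theta>_cases[of n]
  proof
    assume "bad n (\<theta> n)"
    then show ?thesis using N by (intro dens_half[where L=L]) (auto simp: bad_def)
  qed (simp add: dens_zero)
  define \<nu> where "\<nu> n = model n (\<theta> n)" for n
  \<comment> \<open>Score at the moving base point, chosen so that setting coordinate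
    \<open>i\<close> to \<open>t\<close> multiplies the density by exactly
    \<open>1 + t * s n y / sqrt n\<close>.\<close>
  define s where "s n y = (q i y - 1) / dens n (\<theta> n) y" for n y
  have dens_pos: "0 < dens n (\<theta> n) y" for n y using half[of n y] by linarith
  have \<nu>_prob: "prob_space (\<nu> n)" for n unfolding \<nu>_def using dens_pos by (intro model_prob) (simp add: less_imp_le)
  have s_meas: "s n \<in> borel_measurable \<mu>" for n
    unfolding s_def using q_meas[OF i] dens_meas by measurable
  have s_meas': "s n \<in> borel_measurable (\<nu> n)" for n
    using s_meas by (simp add: \<nu>_def cong: measurable_cong_sets)
  have s_bound: "\<bar>s n y\<bar> \<le> 2 * k" for n y
  proof -
    have "\<bar>s n y\<bar> = \<bar>q i y - 1\<bar> / dens n (\<theta> n) y" using dens_pos[of n y] by (simp add: s_def abs_divide)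
    also have "\<dots> \<le> k / (1/2)" using score_bound[OF i] half by (intro frac_le) auto
    finally show ?thesis by simp
  qed
  have int_\<nu>: "(\<integral>y. f y \<partial>\<nu> n) = (\<integral>y. dens n (\<theta> n) y * f y \<partial>\<mu>)" if "f \<in> borel_measurable \<mu>" for f :: "'b \<Rightarrow> real" and n
    unfolding \<nu>_def model_def using that dens_meas dens_pos by (subst integral_density) (auto simp: less_imp_le)
  have s_mean: "(\<integral>y. s n y \<partial>\<nu> n) = 0" for n
  proof -
    have "(\<integral>y. s n y \<partial>\<nu> n) = (\<integral>y. q i y - 1 \<partial>\<mu>)"
      unfolding int_\<nu>[OF s_meas] using dens_pos[of n] by (intro Bochner_Integration.integral_cong) (auto simp: s_def less_imp_neq[symmetric])
    then show ?thesis using q_integrable[OF i] q_int[OF i] by (simp add: prob_space)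
  qed
  have sq_int: "integrable \<mu> (\<lambda>y. (q i y - 1)\<^sup>2)"
  proof (rule integrable_bounded)
    show "\<bar>(q i y - 1)\<^sup>2\<bar> \<le> (real k)\<^sup>2" for y using power_mono[OF score_bound[OF i, of y], of 2] by simp
  qed (use q_meas[OF i] in measurable)
  have s_var: "(\<lambda>n. \<integral>y. (s n y)\<^sup>2 \<partial>\<nu> n) \<longlonglongrightarrow> info i"
  proof -
    have bound: "\<bar>(\<integral>y. (s n y)\<^sup>2 \<partial>\<nu> n) - info i\<bar> \<le> (2 * (real k)\<^sup>2 * (2 * real k * L)) / sqrt n" for n
    proof -
      let ?g = "\<lambda>y. (q i y - 1)\<^sup>2 / dens n (\<theta> n) y"
      have g_eq: "(\<integral>y. (s n y)\<^sup>2 \<partial>\<nu> n) = (\<integral>y. ?g y \<partial>\<mu>)"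
      proof (subst int_\<nu>)
        show "(\<lambda>y. (s n y)\<^sup>2) \<in> borel_measurable \<mu>" using s_meas[of n] by measurable
        have "dens n (\<theta> n) y * (s n y)\<^sup>2 = ?g y" for y
          using dens_pos[of n y] by (simp add: s_def power2_eq_square)
        then show "(\<integral>y. dens n (\<theta> n) y * (s n y)\<^sup>2 \<partial>\<mu>) = (\<integral>y. ?g y \<partial>\<mu>)" by simp
      qed
      have diff: "\<bar>?g y - (q i y - 1)\<^sup>2\<bar> \<le> (2 * (real k)\<^sup>2 * (2 * real k * L)) / sqrt n" for y
      proof -
        have "?g y - (q i y - 1)\<^sup>2 = (q i y - 1)\<^sup>2 * (1 - dens n (\<theta> n) y) / dens n (\<theta> n) y"
          using dens_pos[of n y] by (simp add: field_simps)
        then have "\<bar>?g y - (q i y - 1)\<^sup>2\<bar> = (q i y - 1)\<^sup>2 * \<bar>dens n (\<theta> n) y - 1\<bar> / dens n (\<theta> n) y"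
          using dens_pos[of n y] by (simp add: abs_mult abs_divide abs_minus_commute)
        also have "\<dots> \<le> ((real k)\<^sup>2 * (2 * real k * L / sqrt n)) / (1/2)"
        proof (intro frac_le mult_mono)
          show "(q i y - 1)\<^sup>2 \<le> (real k)\<^sup>2" using power_mono[OF score_bound[OF i, of y], of 2] by simp
          show "\<bar>dens n (\<theta> n) y - 1\<bar> \<le> 2 * real k * L / sqrt n" by (rule dens_bound[OF \<theta>_box])
        qed (use half L in auto)
        finally show ?thesis by simp
      qed
      have meas: "?g \<in> borel_measurable \<mu>" using q_meas[OF i] dens_meas by measurable
      have bnd: "\<bar>?g y - (q i y - 1)\<^sup>2\<bar> \<le> (2 * (real k)\<^sup>2 * (2 * real k * L)) / sqrt n" for y by (rule diff)
      have diff_int: "integrable \<mu> (\<lambda>y. ?g y - (q i y - 1)\<^sup>2)"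
        using meas q_meas[OF i] bnd by (intro integrable_bounded) auto
      have g_int: "integrable \<mu> ?g" using Bochner_Integration.integrable_add[OF diff_int sq_int] by simp
      have "(\<integral>y. (s n y)\<^sup>2 \<partial>\<nu> n) - info i = (\<integral>y. ?g y - (q i y - 1)\<^sup>2 \<partial>\<mu>)"
        unfolding g_eq info_def using g_int sq_int by simp
      also have "\<bar>\<dots>\<bar> \<le> (\<integral>y. \<bar>?g y - (q i y - 1)\<^sup>2\<bar> \<partial>\<mu>)" by (rule integral_abs_bound)
      also have "\<dots> \<le> (2 * (real k)\<^sup>2 * (2 * real k * L)) / sqrt n"
        using diff_int bnd by (intro integral_le_const) auto
      finally show ?thesis .
    qed
    have lim: "(\<lambda>n. (2 * (real k)\<^sup>2 * (2 * real k * L)) / sqrt (real n)) \<longlonglongrightarrow> 0" by real_asymp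
    have "(\<lambda>n. (\<integral>y. (s n y)\<^sup>2 \<partial>\<nu> n) - info i) \<longlonglongrightarrow> 0"
    proof (rule Lim_null_comparison[OF _ lim], rule always_eventually, rule allI)
      fix n
      show "norm ((\<integral>y. (s n y)\<^sup>2 \<partial>\<nu> n) - info i) \<le> (2 * (real k)\<^sup>2 * (2 * real k * L)) / sqrt (real n)"
        unfolding real_norm_def by (rule bound)
    qed
    then show ?thesis by (simp add: LIM_zero_iff)
  qed
  have "0 \<le> info i" by (simp add: info_def)
  from local_bayes_risk_lower[OF \<nu>_prob s_meas' s_bound s_mean s_var this \<tau> u L c[unfolded W_def]]
  have "\<forall>\<^sub>F n in sequentially. \<forall>T\<in>borel_measurable (PiM {..<n} (\<lambda>_. \<nu> n)).
    c \<le> (\<integral>\<^sup>+t. (\<integral>\<^sup>+y. ennreal (\<bar>T y - t\<bar> powr u * (\<Prod>j<n. 1 + t * s n (y j) / sqrt n)) \<partial>PiM {..<n} (\<lambda>_. \<nu> n))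
       * (ennreal (exp (- \<tau> * t\<^sup>2/2)) * indicator {-L..L} t) \<partial>lborel)" .
  then show ?thesis using eventually_ge_at_top[of N]
  proof eventually_elim
    case (elim n)
    note n = N[OF elim(2)]
    have good: "?good n (\<theta> n)"
    proof
      fix T :: "(nat \<Rightarrow> 'b) \<Rightarrow> real" assume T: "T \<in> borel_measurable (PiM {..<n} (\<lambda>_. \<mu>))"
      have sets_eq: "sets (PiM {..<n} (\<lambda>_. \<nu> n)) = sets (PiM {..<n} (\<lambda>_. \<mu>))"
        by (intro sets_PiM_cong) (auto simp: \<nu>_def)
      have T': "T \<in> borel_measurable (PiM {..<n} (\<lambda>_. \<nu> n))"
        using T by (simp cong: measurable_cong_sets add: sets_eq)
      have eq: "(\<integral>\<^sup>+y. ennreal (\<bar>T y - t\<bar> powr u) \<partial>PiM {..<n} (\<lambda>_. model n ((\<theta> n)(i := t)))) =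
        (\<integral>\<^sup>+y. ennreal (\<bar>T y - t\<bar> powr u * (\<Prod>j<n. 1 + t * s n (y j) / sqrt n)) \<partial>PiM {..<n} (\<lambda>_. \<nu> n))"
        if t: "t \<in> {-L..L}" for t
      proof -
        have parameter_box: "(\<theta> n)(i := t) \<in> parameter_box L" using \<theta>_box[of n] t by (auto simp: parameter_box_def)
        have dens_eq: "dens n ((\<theta> n)(i := t)) y = dens n (\<theta> n) y * (1 + t * s n y / sqrt n)" for y
          using dens_pos[of n y] by (simp add: dens_upd[where i=i and \<theta>="\<theta> n", OF i \<theta>_i] s_def distrib_left)
        have pos: "0 \<le> 1 + t * s n y / sqrt n" for y
        proof -
          have "0 \<le> dens n (\<theta> n) y * (1 + t * s n y / sqrt n)"
            using dens_half[OF parameter_box n(1) n(2), of y] unfolding dens_eq by linarith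
          then show ?thesis using dens_pos[of n y] by (simp add: zero_le_mult_iff)
        qed
        have f_meas: "(\<lambda>y. ennreal (1 + t * s n y / sqrt n)) \<in> borel_measurable (\<nu> n)"
          using s_meas'[of n] by measurable
        have model_eq: "model n ((\<theta> n)(i := t)) = density (\<nu> n) (\<lambda>y. ennreal (1 + t * s n y / sqrt n))"
          unfolding model_def \<nu>_def dens_eq using dens_meas s_meas[of n] dens_pos pos
          by (subst density_density_eq) (auto simp: ennreal_mult less_imp_le)
        have "prob_space (model n ((\<theta> n)(i := t)))"
          using dens_half[OF parameter_box n(1) n(2)] by (intro model_prob) (smt (verit) half_gt_zero)
        then have "PiM {..<n} (\<lambda>_. model n ((\<theta> n)(i := t))) =
           density (PiM {..<n} (\<lambda>_. \<nu> n)) (\<lambda>y. \<Prod>j<n. ennreal (1 + t * s n (y j) / sqrt n))"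
          unfolding model_eq using f_meas \<nu>_prob by (intro PiM_density) auto
        moreover have "(\<lambda>y. \<Prod>j<n. ennreal (1 + t * s n (y j) / sqrt n)) \<in> borel_measurable (PiM {..<n} (\<lambda>_. \<nu> n))"
          by (intro borel_measurable_prod_ennreal measurable_PiM_coordinate[OF f_meas])
        ultimately show ?thesis
          using T' pos by (simp add: nn_integral_density prod_ennreal ennreal_mult'' prod_nonneg mult.commute)
      qed
      have "c \<le> (\<integral>\<^sup>+t. (\<integral>\<^sup>+y. ennreal (\<bar>T y - t\<bar> powr u * (\<Prod>j<n. 1 + t * s n (y j) / sqrt n)) \<partial>PiM {..<n} (\<lambda>_. \<nu> n))
       * (ennreal (exp (- \<tau> * t\<^sup>2/2)) * indicator {-L..L} t) \<partial>lborel)"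
        using elim(1) T' by blast
      also have "\<dots> = (\<integral>\<^sup>+t. (\<integral>\<^sup>+y. ennreal (\<bar>T y - t\<bar> powr u) \<partial>PiM {..<n} (\<lambda>_. model n ((\<theta> n)(i := t))))
       * (ennreal (exp (- \<tau> * t\<^sup>2/2)) * indicator {-L..L} t) \<partial>lborel)"
        using eq by (intro nn_integral_cong) (auto simp: indicator_def)
      finally show "c \<le> (\<integral>\<^sup>+t. (\<integral>\<^sup>+y. ennreal (\<bar>T y - t\<bar> powr u) \<partial>PiM {..<n} (\<lambda>_. model n ((\<theta> n)(i := t))))
       * (ennreal (exp (- \<tau> * t\<^sup>2/2)) * indicator {-L..L} t) \<partial>lborel)" .
    qed
    \<comment> \<open>A failure anywhere at stage \<open>n\<close> would have been picked up by the
      selection of \<open>\<theta> n\<close>, where the bound has just been verified.\<close>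
    have "?good n \<eta>" if "\<eta> \<in> parameter_box L" "\<eta> i = 0" for \<eta>
    proof (rule ccontr)
      assume "\<not> ?good n \<eta>"
      with that have "bad n \<eta>" using elim(2) by (auto simp: bad_def)
      then have "\<not> ?good n (\<theta> n)" using \<theta>_bad by (auto simp: bad_def)
      then show False using good by contradiction
    qed
    then show ?case by blast
  qed
qed

end

section \<open>The privacy bound on the information\<close>

text \<open>The sum is maximal at a vertex of the box of admissible densities; a vertex with \<open>d\<close> large
  coordinates yields the \<open>d\<close>-th constraint on \<open>v\<close>.\<close>

lemma sum_squared_deviation_le:
  fixes q :: "nat \<Rightarrow> real" and E v :: real
  assumes k: "1 \<le> k" and E: "1 \<le> E" and v: "0 \<le> v"
    and pos: "\<And>i. i \<in> {1..k} \<Longrightarrow> 0 < q i"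
    and ratio: "\<And>i j. i \<in> {1..k} \<Longrightarrow> j \<in> {1..k} \<Longrightarrow> q i \<le> E * q j"
    and sum: "(\<Sum>i=1..k. q i) = real k"
    and d: "\<And>d. d \<in> {1..k-1} \<Longrightarrow> real d * (real k - real d) * (E - 1)\<^sup>2 \<le> v * (real d * E + real k - real d)\<^sup>2"
  shows "(\<Sum>i=1..k. (q i - 1)\<^sup>2) \<le> real k * v"
proof -
  let ?I = "{1..k}"
  define m where "m = Min (q ` ?I)"
  have "m \<in> q ` ?I" unfolding m_def using k by (intro Min_in) auto
  then obtain i0 where i0: "i0 \<in> ?I" "m = q i0" by auto
  have m: "0 < m" using pos i0 by simp
  have box: "m \<le> q i \<and> q i \<le> E * m" if "i \<in> ?I" for i
    using ratio[OF that i0(1)] that unfolding i0(2)[symmetric] by (auto simp: m_def)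
  \<comment> \<open>The homogeneous form of the claim: with sum \<open>k\<close> the squared
    deviations add up to the sum of squares minus \<open>k\<close>, whence the constant
    \<open>1 + v\<close>. The box spans from the smallest coordinate \<open>m\<close> to
    \<open>E * m\<close>.\<close>
  have "real (card ?I) * (\<Sum>i\<in>?I. (q i)\<^sup>2) \<le> (1 + v) * (\<Sum>i\<in>?I. q i)\<^sup>2"
  proof (rule sum_squares_le_of_box_vertices[where m=m and M="E * m"])
    show "m \<le> E * m" using m E by simp
    fix x assume x: "\<And>i. i \<in> ?I \<Longrightarrow> x i = m \<or> x i = E * m"
    define H where "H = {i \<in> ?I. x i = E * m}"
    define D where "D = card H"
    have H: "H \<subseteq> ?I" "finite H" by (auto simp: H_def)
    have D: "D \<le> k" unfolding D_def using card_mono[OF _ H(1)] by simp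
    have card_diff: "real (card (?I - H)) = real k - real D"
      using H D by (simp add: card_Diff_subset D_def of_nat_diff)
    have split: "(\<Sum>i\<in>?I. f (x i)) = D * f (E * m) + (real k - real D) * f m" for f :: "real \<Rightarrow> real"
    proof -
      have "(\<Sum>i\<in>?I. f (x i)) = (\<Sum>i\<in>?I - H. f (x i)) + (\<Sum>i\<in>H. f (x i))"
        by (rule sum.subset_diff[OF H(1)]) simp
      also have "(\<Sum>i\<in>?I - H. f (x i)) = (\<Sum>i\<in>?I - H. f m)"
        by (intro sum.cong refl arg_cong[where f=f]) (use x in \<open>auto simp: H_def\<close>)
      also have "(\<Sum>i\<in>H. f (x i)) = (\<Sum>i\<in>H. f (E * m))"
        by (intro sum.cong) (auto simp: H_def)
      finally show ?thesis unfolding sum_constant card_diff D_def by simp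
    qed
    \<comment> \<open>At \<open>D = 0\<close> and \<open>D = k\<close> the vertex is constant and
      the left side vanishes.\<close>
    have key: "real D * (real k - real D) * (E - 1)\<^sup>2 \<le> v * (real D * E + real k - real D)\<^sup>2"
    proof (cases "D = 0 \<or> D = k")
      case True
      then show ?thesis using v by auto
    next
      case False
      then show ?thesis using D by (intro d) auto
    qed
    \<comment> \<open>The last term is \<open>k\<^sup>2\<close> times the variance of a vector with
      \<open>D\<close> entries \<open>E\<close> and the remaining entries 1.\<close>
    have "real k * (D * E\<^sup>2 + (real k - real D)) = (real D * E + real k - real D)\<^sup>2 + real D * (real k - real D) * (E - 1)\<^sup>2"
      by (simp add: power2_eq_square algebra_simps)
    also have "\<dots> \<le> (1 + v) * (real D * E + real k - real D)\<^sup>2" using key by (simp add: distrib_right)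
    finally have "m\<^sup>2 * (real k * (D * E\<^sup>2 + (real k - real D))) \<le> m\<^sup>2 * ((1 + v) * (real D * E + real k - real D)\<^sup>2)"
      by (rule mult_left_mono) simp
    moreover have "(\<Sum>i\<in>?I. (x i)\<^sup>2) = m\<^sup>2 * (D * E\<^sup>2 + (real k - real D))"
      unfolding split[of "\<lambda>x. x\<^sup>2"] by (simp add: power_mult_distrib algebra_simps)
    moreover have "(\<Sum>i\<in>?I. x i) = m * (real D * E + real k - real D)"
      unfolding split[of "\<lambda>x. x"] by (simp add: algebra_simps)
    ultimately show "real (card ?I) * (\<Sum>i\<in>?I. (x i)\<^sup>2) \<le> (1 + v) * (\<Sum>i\<in>?I. x i)\<^sup>2"
      by (simp add: power_mult_distrib mult_ac)
  qed (use m box in auto)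
  then have "real k * (\<Sum>i\<in>?I. (q i)\<^sup>2) \<le> real k * ((1 + v) * real k)"
    unfolding sum by (simp add: power2_eq_square mult_ac)
  then have "(\<Sum>i\<in>?I. (q i)\<^sup>2) \<le> (1 + v) * real k" using k by simp
  moreover have "(\<Sum>i\<in>?I. (q i - 1)\<^sup>2) = (\<Sum>i\<in>?I. (q i)\<^sup>2) - real k"
  proof -
    have "(\<Sum>i\<in>?I. (q i - 1)\<^sup>2) = (\<Sum>i\<in>?I. (q i)\<^sup>2 - 2 * q i + 1)"
      by (intro sum.cong) (auto simp: power2_eq_square algebra_simps)
    also have "\<dots> = (\<Sum>i\<in>?I. (q i)\<^sup>2) - 2 * (\<Sum>i\<in>?I. q i) + real k"
      by (simp add: sum.distrib sum_subtractf sum_distrib_left)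
    finally show ?thesis unfolding sum by simp
  qed
  ultimately show ?thesis by (simp add: algebra_simps)
qed

text \<open>The tangent is taken at \<open>b\<close> instead of at the mean of the
  \<open>x i\<close>: its slope is nonpositive, so an upper bound on the sum is enough. The tangent
  inequality itself combines \<open>ln r \<le> r - 1\<close> with
  \<open>1 + y \<le> exp y\<close>.\<close>

lemma sum_powr_minus_ge:
  fixes x :: "'i \<Rightarrow> real" and a b :: real
  assumes "finite I" "0 \<le> a" "0 < b" "\<And>i. i \<in> I \<Longrightarrow> 0 < x i" "(\<Sum>i\<in>I. x i) \<le> card I * b"
  shows "card I * b powr (- a) \<le> (\<Sum>i\<in>I. x i powr (- a))"
proof -
  have tangent: "b powr (- a) * (1 - a * (x i / b - 1)) \<le> x i powr (- a)" if "i \<in> I" for i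
  proof -
    have r: "0 < x i / b" using assms that by simp
    have "1 - a * (x i / b - 1) \<le> 1 + - a * ln (x i / b)"
      using ln_le_minus_one[OF r] assms(2) by (simp add: mult_left_mono)
    also have "\<dots> \<le> (x i / b) powr (- a)"
      using exp_ge_add_one_self[of "- a * ln (x i / b)"] r assms(3) assms(4)[OF that] by (simp add: powr_def)
    finally have "b powr (- a) * (1 - a * (x i / b - 1)) \<le> b powr (- a) * (x i / b) powr (- a)"
      by (rule mult_left_mono) simp
    also have "\<dots> = x i powr (- a)" using assms that[THEN assms(4)] by (simp add: powr_divide)
    finally show ?thesis .
  qed
  have "(\<Sum>i\<in>I. x i) / b \<le> card I" using assms by (simp add: divide_le_eq)
  then have "a * ((\<Sum>i\<in>I. x i) / b - card I) \<le> 0" using assms(2) by (intro mult_nonneg_nonpos) auto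
  then have "card I * b powr (- a) \<le> b powr (- a) * (card I - a * ((\<Sum>i\<in>I. x i) / b - card I))"
    using mult_left_mono[of "real (card I)" "card I - a * ((\<Sum>i\<in>I. x i) / b - card I)" "b powr (- a)"]
    by (simp add: mult.commute)
  also have "\<dots> = (\<Sum>i\<in>I. b powr (- a) * (1 - a * (x i / b - 1)))"
    by (simp add: sum_distrib_left[symmetric] sum_subtractf sum_divide_distrib[symmetric])
  also have "\<dots> \<le> (\<Sum>i\<in>I. x i powr (- a))" by (intro sum_mono tangent)
  finally show ?thesis .
qed

text \<open>With \<open>D\<close> the minimum inside \<open>M_ke\<close>, take
  \<open>v = (exp \<epsilon> - 1)\<^sup>2 / D\<close>. This is the largest average squared deviation
  from 1 over all nonconstant vertices with ratio \<open>exp \<epsilon>\<close>, rescaled to mean 1,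
  and \<open>M_ke k \<epsilon>\<close> equals \<open>(1 - 1/k)\<^sup>2 / v\<close>.\<close>

lemma M_ke_powr:
  assumes k: "2 \<le> k" and "\<epsilon> > 0"
  obtains v where "0 < v"
    "\<And>d. d \<in> {1..k-1} \<Longrightarrow> real d * (real k - real d) * (exp \<epsilon> - 1)\<^sup>2 \<le> v * (real d * exp \<epsilon> + real k - real d)\<^sup>2"
    "M_ke k \<epsilon> powr (u/2) = (1 - 1/real k) powr u * v powr (-(u/2))"
proof -
  let ?f = "\<lambda>d::nat. (real d * exp \<epsilon> + real k - real d)\<^sup>2 / (real d * (real k - real d))"
  define D where "D = Min (?f ` {1..k-1})"
  have E: "1 < exp \<epsilon>" using assms by simp
  have fpos: "0 < ?f d" and dpos: "0 < real d * (real k - real d)" if "d \<in> {1..k-1}" for d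
  proof -
    have "0 < real d" "0 < real k - real d" using that by auto
    moreover from this have "0 < real d * exp \<epsilon> + (real k - real d)" by (intro add_pos_pos mult_pos_pos) auto
    ultimately show "0 < ?f d" "0 < real d * (real k - real d)" by (auto simp: add_diff_eq)
  qed
  have ne: "finite (?f ` {1..k-1})" "?f ` {1..k-1} \<noteq> {}" using k by auto
  have D: "0 < D" using Min_in[OF ne] fpos unfolding D_def by (auto simp only: image_iff)
  define v where "v = (exp \<epsilon> - 1)\<^sup>2 / D"
  have v: "0 < v" using D E by (simp add: v_def)
  show ?thesis
  proof (rule that[OF v])
    fix d assume d: "d \<in> {1..k-1}"
    have "D \<le> ?f d" unfolding D_def using d ne by (intro Min_le) auto
    then have "D * (real d * (real k - real d)) \<le> (real d * exp \<epsilon> + real k - real d)\<^sup>2"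
      using dpos[OF d] by (simp only: pos_le_divide_eq)
    then have "v * (D * (real d * (real k - real d))) \<le> v * (real d * exp \<epsilon> + real k - real d)\<^sup>2"
      using v by (intro mult_left_mono) auto
    moreover have "v * D = (exp \<epsilon> - 1)\<^sup>2" using D by (simp add: v_def)
    ultimately show "real d * (real k - real d) * (exp \<epsilon> - 1)\<^sup>2 \<le> v * (real d * exp \<epsilon> + real k - real d)\<^sup>2"
      by (metis mult.assoc mult.commute)
  next
    have "M_ke k \<epsilon> = (1 - 1/real k)\<^sup>2 / v"
      using k E D unfolding M_ke_def D_def[symmetric] v_def
      by (simp add: of_nat_diff field_simps power_divide)
    then have "M_ke k \<epsilon> powr (u/2) = ((1 - 1/real k) powr 2) powr (u/2) / v powr (u/2)"
      using k v by (simp add: powr_divide)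
    then show "M_ke k \<epsilon> powr (u/2) = (1 - 1/real k) powr u * v powr (-(u/2))"
      unfolding powr_powr powr_minus_divide by simp
  qed
qed

text \<open>The factors on the left are the normaliser of the Gaussian prior, the limiting mean of
  the tilt factor, and the u-th absolute moment of the weight with precision \<open>W\<close>. Apart
  from its share in \<open>W\<close>, \<open>\<tau>\<close> cancels.\<close>

lemma gaussian_constants:
  assumes "0 < W" "0 < \<tau>"
  shows "sqrt (\<tau> / (2 * pi)) * (sqrt (W / \<tau>) * (W powr (-(u+1)/2) * (2 powr ((u+1)/2) * Gamma ((u+1)/2)))) = C_u u * W powr (-(u/2))"
proof -
  have "sqrt (\<tau> / (2 * pi)) * sqrt (W / \<tau>) = sqrt W / (sqrt 2 * sqrt pi)"
    using assms by (simp add: real_sqrt_divide real_sqrt_mult)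
  moreover have "W powr (-(u+1)/2) = W powr (-(u/2)) / sqrt W"
  proof -
    have "-(u+1)/2 = -(u/2) - 1/2" by (simp add: field_simps)
    then show ?thesis using assms by (simp only: powr_diff) (simp add: powr_half_sqrt)
  qed
  moreover have "2 powr ((u+1)/2) = 2 powr (u/2) * sqrt 2"
  proof -
    have "(u+1)/2 = u/2 + 1/2" by (simp add: field_simps)
    then show ?thesis by (simp only: powr_add) (simp add: powr_half_sqrt)
  qed
  ultimately show ?thesis using assms unfolding C_u_def by (simp add: mult.assoc[symmetric])
qed

section \<open>From Bayes risk to minimax risk\<close>

lemma gaussian_mass:
  fixes \<tau> :: real
  assumes "0 < \<tau>"
  shows "(\<integral>\<^sup>+t. ennreal (exp (- \<tau> * t\<^sup>2/2)) \<partial>lborel) = ennreal (sqrt (2 * pi / \<tau>))"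
proof -
  have "(\<integral>\<^sup>+t. ennreal (exp (- \<tau> * t\<^sup>2/2)) \<partial>lborel) = (\<integral>\<^sup>+t. ennreal (\<bar>t\<bar> powr 0 * exp (- \<tau> * t\<^sup>2/2)) \<partial>lborel)"
    by (rule nn_integral_cong_AE) (use AE_lborel_singleton[of "0::real"] in eventually_elim, simp)
  also have "\<dots> = ennreal (\<tau> powr (-(0+1)/2) * (2 powr ((0+1)/2) * Gamma ((0+1)/2)))"
    using assms by (intro nn_integral_abs_powr_gaussian) auto
  also have "\<tau> powr (-(0+1)/2) * (2 powr ((0+1)/2) * Gamma ((0+1)/2)) = sqrt (2 * pi / \<tau>)"
    using assms by (simp add: Gamma_one_half_real powr_half_sqrt powr_minus_divide real_sqrt_divide real_sqrt_mult)
  finally show ?thesis .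
qed

text \<open>Normalisation of the truncated prior. The upper bound gives
  \<open>1/z \<ge> sqrt (\<tau> / (2 * pi))\<close>, so passing to the full Gaussian normaliser only
  weakens the risk bound.\<close>

lemma truncated_gaussian_mass:
  fixes \<tau> L :: real
  assumes "0 < \<tau>" "0 < L"
  obtains z where "0 < z" "z \<le> sqrt (2 * pi / \<tau>)"
    "(\<integral>\<^sup>+t. ennreal (exp (- \<tau> * t\<^sup>2/2)) * indicator {-L..L} t \<partial>lborel) = ennreal z"
proof -
  let ?Z = "\<integral>\<^sup>+t. ennreal (exp (- \<tau> * t\<^sup>2/2)) * indicator {-L..L} t \<partial>lborel"
  have "?Z \<le> (\<integral>\<^sup>+t. ennreal (exp (- \<tau> * t\<^sup>2/2)) \<partial>lborel)"
    by (intro nn_integral_mono) (auto simp: indicator_def)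
  then have le: "?Z \<le> ennreal (sqrt (2 * pi / \<tau>))" using gaussian_mass[OF assms(1)] by simp
  have "0 < ennreal (exp (- \<tau> * L\<^sup>2/2) * (2 * L))" using assms by simp
  also have "ennreal (exp (- \<tau> * L\<^sup>2/2) * (2 * L)) = (\<integral>\<^sup>+t. ennreal (exp (- \<tau> * L\<^sup>2/2)) * indicator {-L..L} t \<partial>lborel)"
    using assms by (subst nn_integral_cmult_indicator) (auto simp: ennreal_mult)
  also have "\<dots> \<le> ?Z"
  proof (intro nn_integral_mono)
    fix t :: real
    show "ennreal (exp (- \<tau> * L\<^sup>2/2)) * indicator {-L..L} t \<le> ennreal (exp (- \<tau> * t\<^sup>2/2)) * indicator {-L..L} t"
    proof (cases "t \<in> {-L..L}")
      case True
      then have "t\<^sup>2 \<le> L\<^sup>2" using power_mono[of "\<bar>t\<bar>" L 2] by auto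
      then have "exp (- \<tau> * L\<^sup>2/2) \<le> exp (- \<tau> * t\<^sup>2/2)" using assms by simp
      then show ?thesis by (intro mult_right_mono ennreal_leI) auto
    qed simp
  qed
  finally have "0 < ?Z" .
  moreover obtain z where z: "0 \<le> z" "?Z = ennreal z"
    using le by (cases ?Z) (auto simp: top_unique)
  ultimately have "0 < z" by simp
  moreover have "z \<le> sqrt (2 * pi / \<tau>)" using le z assms by simp
  ultimately show ?thesis using z that by blast
qed

context channel_densities
begin

definition point :: "nat \<Rightarrow> (nat \<Rightarrow> real) \<Rightarrow> nat \<Rightarrow> real" where
  "point n \<theta> i = 1/k + (\<theta> i - (\<Sum>l=1..k. \<theta> l)/k) / sqrt n"

lemma point_simplex:
  assumes "\<theta> \<in> parameter_box L" "4 * real k * L \<le> sqrt n" "1 \<le> n"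
  shows "point n \<theta> \<in> prob_simplex k"
proof -
  have sq: "0 < sqrt n" using assms by simp
  have "0 \<le> point n \<theta> i" if i: "i \<in> {1..k}" for i
  proof -
    have L: "\<bar>\<theta> l\<bar> \<le> L" if "l \<in> {1..k}" for l using assms(1) that by (auto simp: parameter_box_def)
    have "0 \<le> L" using L[OF i] by linarith
    have "(\<Sum>l=1..k. \<theta> l) \<le> (\<Sum>l=1..k. L)" by (intro sum_mono) (use L in \<open>auto simp: abs_le_iff\<close>)
    then have "(\<Sum>l=1..k. \<theta> l)/k \<le> L" using k by (simp add: divide_le_eq mult.commute)
    then have "- 2 * L \<le> \<theta> i - (\<Sum>l=1..k. \<theta> l)/k" using L[OF i] by linarith
    then have "- 2 * L / sqrt n \<le> (\<theta> i - (\<Sum>l=1..k. \<theta> l)/k) / sqrt n" by (rule divide_right_mono) simp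
    moreover have "2 * L / sqrt n \<le> 1/k"
    proof -
      have "2 * real k * L \<le> sqrt n" using assms(2) \<open>0 \<le> L\<close> mult_nonneg_nonneg[of "real k" L] by linarith
      then show ?thesis using sq k by (simp add: field_simps)
    qed
    ultimately show ?thesis unfolding point_def by simp
  qed
  moreover have "(\<Sum>i=1..k. point n \<theta> i) = 1"
    using k by (simp add: point_def sum.distrib sum_subtractf sum_divide_distrib[symmetric])
  ultimately show ?thesis by (auto simp: prob_simplex_def)
qed

text \<open>As the densities sum to \<open>k\<close> at every \<open>y\<close>, subtracting the mean
  of \<open>\<theta>\<close> replaces \<open>q j y\<close> by \<open>q j y - 1\<close>.\<close>

lemma point_dens: "(\<Sum>i=1..k. point n \<theta> i * q i y) = dens n \<theta> y"
proof -
  have "(\<Sum>i=1..k. point n \<theta> i * q i y) = (\<Sum>i=1..k. 1/k * q i y + (\<theta> i * q i y) / sqrt n - ((\<Sum>l=1..k. \<theta> l)/k / sqrt n) * q i y)"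
    by (intro sum.cong) (simp_all add: point_def algebra_simps diff_divide_distrib)
  also have "\<dots> = 1/k * (\<Sum>i=1..k. q i y) + (\<Sum>i=1..k. \<theta> i * q i y) / sqrt n - ((\<Sum>l=1..k. \<theta> l)/k / sqrt n) * (\<Sum>i=1..k. q i y)"
    by (simp only: sum_subtractf sum.distrib sum_distrib_left sum_divide_distrib)
  also have "\<dots> = 1 + ((\<Sum>i=1..k. \<theta> i * q i y) - (\<Sum>l=1..k. \<theta> l)) / sqrt n"
    unfolding q_sum using k by (simp add: diff_divide_distrib)
  also have "\<dots> = dens n \<theta> y" by (simp add: dens_def sum_subtractf[symmetric] right_diff_distrib)
  finally show ?thesis .
qed

text \<open>Origin of the factor \<open>1 - 1/k\<close>: raising one coordinate by \<open>t\<close>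
  also raises the subtracted mean by \<open>t/k\<close>.\<close>

lemma point_upd:
  assumes "i \<in> {1..k}" "\<theta> i = 0"
  shows "point n (\<theta>(i := t)) i = point n \<theta> i + t * (1 - 1/k) / sqrt n"
proof -
  have "(\<Sum>l=1..k. (\<theta>(i := t)) l) = (\<Sum>l=1..k. \<theta> l) + t"
    using assms by (subst (1 2) sum.remove[of _ i]) (auto intro!: sum.cong)
  moreover have "t - ((\<Sum>l=1..k. \<theta> l) + t)/k = (0 - (\<Sum>l=1..k. \<theta> l)/k) + t * (1 - 1/k)"
    by (simp add: add_divide_distrib right_diff_distrib)
  ultimately show ?thesis using assms(2) by (simp only: point_def fun_upd_same add_divide_distrib)
qed

text \<open>Moves the dependence on \<open>\<theta>\<close> from the measure into the integrand, so
  that measurability of the risk in \<open>\<theta>\<close> becomes joint measurability over a fixed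
  product space.\<close>

lemma nn_integral_PiM_model:
  assumes "\<And>y. 0 \<le> dens n \<theta> y" "f \<in> borel_measurable (PiM {..<n} (\<lambda>_. \<mu>))"
  shows "(\<integral>\<^sup>+y. f y \<partial>PiM {..<n} (\<lambda>_. model n \<theta>)) = (\<integral>\<^sup>+y. (\<Prod>j<n. ennreal (dens n \<theta> (y j))) * f y \<partial>PiM {..<n} (\<lambda>_. \<mu>))"
proof -
  have meas: "(\<lambda>y. ennreal (dens n \<theta> y)) \<in> borel_measurable \<mu>" using dens_meas by measurable
  have "PiM {..<n} (\<lambda>_. model n \<theta>) = density (PiM {..<n} (\<lambda>_. \<mu>)) (\<lambda>y. \<Prod>j<n. ennreal (dens n \<theta> (y j)))"
    using model_prob[OF assms(1)] prob_space_axioms meas unfolding model_def by (intro PiM_density) auto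
  moreover have "(\<lambda>y. \<Prod>j<n. ennreal (dens n \<theta> (y j))) \<in> borel_measurable (PiM {..<n} (\<lambda>_. \<mu>))"
    by (intro borel_measurable_prod_ennreal measurable_PiM_coordinate[OF meas])
  ultimately show ?thesis using assms(2) by (simp add: nn_integral_density)
qed

text \<open>A bound \<open>S\<close> on the risk over the box also bounds its average under the
  product prior. The average splits into \<open>k\<close> coordinate risks; in the i-th one,
  coordinate \<open>i\<close> is integrated innermost, where the conditional bound applies for every
  choice of the others.\<close>

lemma bayes_risk_le_minimax:
  fixes L \<tau> u :: real and c :: "nat \<Rightarrow> ennreal"
  assumes n: "1 \<le> n" "4 * real k * L \<le> sqrt n" and L: "0 < L" and \<tau>: "0 < \<tau>"
    and cond: "\<And>i. i \<in> {1..k} \<Longrightarrow> \<forall>\<theta>\<in>parameter_box L. \<theta> i = 0 \<longrightarrow> (\<forall>T\<in>borel_measurable (PiM {..<n} (\<lambda>_. \<mu>)).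
      c i \<le> (\<integral>\<^sup>+t. (\<integral>\<^sup>+y. ennreal (\<bar>T y - t\<bar> powr u) \<partial>PiM {..<n} (\<lambda>_. model n (\<theta>(i := t))))
       * (ennreal (exp (- \<tau> * t\<^sup>2/2)) * indicator {-L..L} t) \<partial>lborel))"
    and ph: "\<And>i. i \<in> {1..k} \<Longrightarrow> (\<lambda>y. ph y i) \<in> borel_measurable (PiM {..<n} (\<lambda>_. \<mu>))"
    and S: "\<And>\<theta>. \<theta> \<in> parameter_box L \<Longrightarrow> (\<integral>\<^sup>+y. ennreal (lu_loss u k (\<lambda>i. ph y i - point n \<theta> i)) \<partial>PiM {..<n} (\<lambda>_. model n \<theta>)) \<le> S"
  shows "(\<Sum>i=1..k. ennreal ((1 - 1/k) powr u * sqrt (\<tau> / (2 * pi))) * c i) \<le> S * ennreal (real n powr (u/2))"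
proof -
  let ?I = "{1..k}"
  let ?\<mu>n = "PiM {..<n} (\<lambda>_. \<mu>)"
  let ?w = "\<lambda>t. ennreal (exp (- \<tau> * t\<^sup>2/2)) * indicator {-L..L} t"
  obtain z where z: "0 < z" "z \<le> sqrt (2 * pi / \<tau>)" "(\<integral>\<^sup>+t. ?w t \<partial>lborel) = ennreal z"
    using truncated_gaussian_mass[OF \<tau> L] by blast
  define \<pi> where "\<pi> = density lborel (\<lambda>t. ennreal (1/z) * ?w t)"
  have \<pi>_prob: "prob_space \<pi>"
  proof
    show "emeasure \<pi> (space \<pi>) = 1"
      using z by (simp add: \<pi>_def emeasure_density nn_integral_cmult ennreal_mult'[symmetric])
  qed
  interpret \<pi>: prob_space \<pi> by (rule \<pi>_prob)
  interpret PP: product_sigma_finite "\<lambda>_::nat. \<pi>" ..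
  interpret \<mu>n: prob_space ?\<mu>n by (intro prob_space_PiM prob_space_axioms)
  \<comment> \<open>Clamping makes every point of the product space a legitimate parameter, so
    positivity of the densities and measurability hold everywhere; on \<open>{-L..L}\<close>, which
    carries \<open>\<pi>\<close>, it is the identity.\<close>
  define cl where "cl x = max (- L) (min L x)" for x :: real
  have cl_meas[measurable]: "cl \<in> borel_measurable borel" unfolding cl_def by measurable
  have cl_box: "(\<lambda>l. cl (\<theta> l)) \<in> parameter_box L" for \<theta> using L by (auto simp: parameter_box_def cl_def)
  have sets_\<pi>[simp, measurable_cong]: "sets \<pi> = sets borel" by (simp add: \<pi>_def)
  have dens0: "0 \<le> dens n \<theta> y" if "\<theta> \<in> parameter_box L" for \<theta> y using dens_half[OF that n(2,1), of y] by linarith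
  define R where "R i \<theta> = (\<integral>\<^sup>+y. ennreal (\<bar>ph y i - point n \<theta> i\<bar> powr u) \<partial>PiM {..<n} (\<lambda>_. model n \<theta>))" for i \<theta>
  have R_eq: "R i \<theta> = (\<integral>\<^sup>+y. (\<Prod>j<n. ennreal (dens n \<theta> (y j))) * ennreal (\<bar>ph y i - point n \<theta> i\<bar> powr u) \<partial>?\<mu>n)"
    if "i \<in> ?I" "\<theta> \<in> parameter_box L" for i \<theta>
    unfolding R_def using ph[OF that(1)] dens0[OF that(2)] by (intro nn_integral_PiM_model) auto
  have R_meas: "(\<lambda>\<theta>. R i (\<lambda>l. cl (\<theta> l))) \<in> borel_measurable (PiM ?I (\<lambda>_. \<pi>))" if i: "i \<in> ?I" for i
  proof -
    have th: "(\<lambda>x. cl (fst x l)) \<in> borel_measurable (PiM ?I (\<lambda>_. \<pi>) \<Otimes>\<^sub>M ?\<mu>n)" if "l \<in> ?I" for l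
    proof (rule measurable_compose[OF measurable_fst])
      show "(\<lambda>\<theta>. cl (\<theta> l)) \<in> borel_measurable (PiM ?I (\<lambda>_. \<pi>))"
        by (rule measurable_PiM_coordinate[OF _ that]) measurable
    qed
    have qm: "(\<lambda>x. q l (snd x j)) \<in> borel_measurable (PiM ?I (\<lambda>_. \<pi>) \<Otimes>\<^sub>M ?\<mu>n)" if "l \<in> ?I" "j < n" for l j
      using that by (intro measurable_compose[OF measurable_snd] measurable_PiM_coordinate q_meas) auto
    have phm: "(\<lambda>x. ph (snd x) i) \<in> borel_measurable (PiM ?I (\<lambda>_. \<pi>) \<Otimes>\<^sub>M ?\<mu>n)"
      by (rule measurable_compose[OF measurable_snd ph[OF i]])
    have point_m: "(\<lambda>x. point n (\<lambda>l. cl (fst x l)) i) \<in> borel_measurable (PiM ?I (\<lambda>_. \<pi>) \<Otimes>\<^sub>M ?\<mu>n)"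
      unfolding point_def using i
      by (intro borel_measurable_add borel_measurable_const borel_measurable_divide borel_measurable_diff borel_measurable_sum th) auto
    have dens_m: "(\<lambda>x. dens n (\<lambda>l. cl (fst x l)) (snd x j)) \<in> borel_measurable (PiM ?I (\<lambda>_. \<pi>) \<Otimes>\<^sub>M ?\<mu>n)" if "j < n" for j
      unfolding dens_def using that
      by (intro borel_measurable_add borel_measurable_const borel_measurable_divide borel_measurable_diff borel_measurable_sum
          borel_measurable_times th qm) auto
    have "(\<lambda>x. (\<Prod>j<n. ennreal (dens n (\<lambda>l. cl (fst x l)) (snd x j))) * ennreal (\<bar>ph (snd x) i - point n (\<lambda>l. cl (fst x l)) i\<bar> powr u))
       \<in> borel_measurable (PiM ?I (\<lambda>_. \<pi>) \<Otimes>\<^sub>M ?\<mu>n)"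
      using dens_m point_m phm by (intro borel_measurable_times_ennreal borel_measurable_prod_ennreal) auto
    then show ?thesis unfolding R_eq[OF i cl_box]
      by (intro \<mu>n.borel_measurable_nn_integral) (simp add: split_beta')
  qed
  \<comment> \<open>Rate at which the i-th coordinate of \<open>point\<close> moves with the i-th
    parameter; the loss scales by \<open>C = b powr u\<close>, and \<open>T\<close> below is the
    estimator expressed on the parameter scale.\<close>
  define b where "b = (1 - 1/k) / sqrt n"
  define C where "C = b powr u"
  have base: "0 < b" unfolding b_def using k n by simp
  then have C0: "0 < C" unfolding C_def powr_gt_zero by linarith
  have coord: "ennreal (C / z) * c i \<le> (\<integral>\<^sup>+\<theta>. R i (\<lambda>l. cl (\<theta> l)) \<partial>PiM ?I (\<lambda>_. \<pi>))" if i: "i \<in> ?I" for i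
  proof -
    have inner: "ennreal (C / z) * c i \<le> (\<integral>\<^sup>+t. R i (\<lambda>l. cl ((\<theta>(i := t)) l)) \<partial>\<pi>)"
      if \<theta>: "\<theta> \<in> space (PiM (?I - {i}) (\<lambda>_. \<pi>))" for \<theta>
    proof -
      \<comment> \<open>Frozen base point: the clamped neighbours, with coordinate \<open>i\<close>
        reset to the value 0 that the conditional bound asks for.\<close>
      define \<eta> where "\<eta> = (\<lambda>l. cl (\<theta> l))(i := 0)"
      have \<eta>: "\<eta> \<in> parameter_box L" "\<eta> i = 0" using cl_box[of \<theta>] L by (auto simp: \<eta>_def parameter_box_def)
      have cl_eq: "(\<lambda>l. cl ((\<theta>(i := t)) l)) = \<eta>(i := t)" if "t \<in> {-L..L}" for t
        using that by (auto simp: \<eta>_def cl_def fun_eq_iff)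
      define T where "T y = (ph y i - point n \<eta> i) / b" for y
      have T_meas: "T \<in> borel_measurable ?\<mu>n" unfolding T_def using ph[OF i] by measurable
      let ?J = "\<lambda>t. \<integral>\<^sup>+y. ennreal (\<bar>T y - t\<bar> powr u) \<partial>PiM {..<n} (\<lambda>_. model n (\<eta>(i := t)))"
      have RJ: "R i (\<eta>(i := t)) = ennreal C * ?J t" for t
      proof -
        have "\<bar>ph y i - point n (\<eta>(i := t)) i\<bar> powr u = C * \<bar>T y - t\<bar> powr u" for y
        proof -
          have "point n (\<eta>(i := t)) i = point n \<eta> i + t * b"
            using point_upd[where \<theta>=\<eta> and i=i, OF i \<eta>(2)] by (simp add: b_def)
          then have "ph y i - point n (\<eta>(i := t)) i = b * (T y - t)"
            using base by (subst right_diff_distrib) (simp add: T_def)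
          then have "\<bar>ph y i - point n (\<eta>(i := t)) i\<bar> = b * \<bar>T y - t\<bar>"
            using base by (simp only: abs_mult abs_of_pos)
          then show ?thesis using base by (simp only: C_def powr_mult)
        qed
        then have "R i (\<eta>(i := t)) = (\<integral>\<^sup>+y. ennreal C * ennreal (\<bar>T y - t\<bar> powr u) \<partial>PiM {..<n} (\<lambda>_. model n (\<eta>(i := t))))"
          unfolding R_def using C0 by (simp add: ennreal_mult')
        also have "\<dots> = ennreal C * ?J t"
        proof (rule nn_integral_cmult)
          have "sets (PiM {..<n} (\<lambda>_. model n (\<eta>(i := t)))) = sets ?\<mu>n" by (intro sets_PiM_cong) auto
          then show "(\<lambda>y. ennreal (\<bar>T y - t\<bar> powr u)) \<in> borel_measurable (PiM {..<n} (\<lambda>_. model n (\<eta>(i := t))))"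
            using T_meas by (simp cong: measurable_cong_sets)
        qed
        finally show ?thesis .
      qed
      let ?g = "\<lambda>t. R i (\<lambda>l. cl ((\<theta>(i := t)) l))"
      have g_meas: "?g \<in> borel_measurable borel"
      proof -
        have "(\<lambda>t. \<theta>(i := t)) \<in> \<pi> \<rightarrow>\<^sub>M PiM (insert i (?I - {i})) (\<lambda>_. \<pi>)"
          using \<theta> by (intro measurable_fun_upd[where J="?I - {i}"]) auto
        moreover have "insert i (?I - {i}) = ?I" using i by auto
        ultimately have "(\<lambda>t. \<theta>(i := t)) \<in> \<pi> \<rightarrow>\<^sub>M PiM ?I (\<lambda>_. \<pi>)" by simp
        from measurable_compose[OF this R_meas[OF i]] have "?g \<in> borel_measurable \<pi>" .
        then show ?thesis by (simp cong: measurable_cong_sets)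
      qed
      have "c i \<le> (\<integral>\<^sup>+t. ?J t * ?w t \<partial>lborel)" using cond[OF i] \<eta> T_meas by blast
      also have "\<dots> = (\<integral>\<^sup>+t. ennreal (1/C) * (?g t * ?w t) \<partial>lborel)"
      proof (intro nn_integral_cong)
        fix t :: real
        have "?J t = ennreal (1/C) * R i (\<eta>(i := t))"
          unfolding RJ mult.assoc[symmetric] using C0 by (simp add: ennreal_mult'[symmetric])
        then show "?J t * ?w t = ennreal (1/C) * (?g t * ?w t)"
          using cl_eq[of t] by (cases "t \<in> {-L..L}") (simp_all add: mult.assoc)
      qed
      also have "\<dots> = ennreal (1/C) * (\<integral>\<^sup>+t. ?g t * ?w t \<partial>lborel)"
        using g_meas by (intro nn_integral_cmult) auto
      finally have "ennreal (C / z) * c i \<le> ennreal (C / z) * (ennreal (1/C) * (\<integral>\<^sup>+t. ?g t * ?w t \<partial>lborel))"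
        by (rule mult_left_mono) simp
      also have "\<dots> = ennreal (1/z) * (\<integral>\<^sup>+t. ?g t * ?w t \<partial>lborel)"
        using C0 z by (simp add: mult.assoc[symmetric] ennreal_mult'[symmetric])
      also have "\<dots> = (\<integral>\<^sup>+t. ennreal (1/z) * (?g t * ?w t) \<partial>lborel)"
        using g_meas by (intro nn_integral_cmult[symmetric]) auto
      also have "\<dots> = (\<integral>\<^sup>+t. ?g t \<partial>\<pi>)"
        unfolding \<pi>_def using g_meas by (subst nn_integral_density) (auto simp: mult_ac)
      finally show ?thesis .
    qed
    interpret P': prob_space "PiM (?I - {i}) (\<lambda>_. \<pi>)" by (intro prob_space_PiM \<pi>_prob)
    have ins: "insert i (?I - {i}) = ?I" using i by auto
    have "ennreal (C / z) * c i = (\<integral>\<^sup>+\<theta>. ennreal (C / z) * c i \<partial>PiM (?I - {i}) (\<lambda>_. \<pi>))"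
      unfolding nn_integral_const P'.emeasure_space_1 by simp
    also have "\<dots> \<le> (\<integral>\<^sup>+\<theta>. (\<integral>\<^sup>+t. R i (\<lambda>l. cl ((\<theta>(i := t)) l)) \<partial>\<pi>) \<partial>PiM (?I - {i}) (\<lambda>_. \<pi>))"
      by (intro nn_integral_mono inner)
    also have "\<dots> = (\<integral>\<^sup>+\<theta>. R i (\<lambda>l. cl (\<theta> l)) \<partial>PiM (insert i (?I - {i})) (\<lambda>_. \<pi>))"
      by (intro PP.product_nn_integral_insert[symmetric]) (simp, simp, simp only: ins R_meas[OF i])
    finally show ?thesis unfolding ins .
  qed
  have sum_le: "(\<Sum>i=1..k. R i (\<lambda>l. cl (\<theta> l))) \<le> S" for \<theta>
  proof -
    let ?\<eta> = "\<lambda>l. cl (\<theta> l)"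
    have "sets (PiM {..<n} (\<lambda>_. model n ?\<eta>)) = sets ?\<mu>n" by (intro sets_PiM_cong) auto
    then have "(\<Sum>i=1..k. R i ?\<eta>) = (\<integral>\<^sup>+y. (\<Sum>i=1..k. ennreal (\<bar>ph y i - point n ?\<eta> i\<bar> powr u)) \<partial>PiM {..<n} (\<lambda>_. model n ?\<eta>))"
      unfolding R_def using ph by (intro nn_integral_sum[symmetric]) (simp cong: measurable_cong_sets)
    also have "\<dots> = (\<integral>\<^sup>+y. ennreal (lu_loss u k (\<lambda>i. ph y i - point n ?\<eta> i)) \<partial>PiM {..<n} (\<lambda>_. model n ?\<eta>))"
      by (simp add: lu_loss_def sum_ennreal)
    also have "\<dots> \<le> S" by (rule S[OF cl_box])
    finally show ?thesis .
  qed
  have "(\<Sum>i=1..k. ennreal (C / z) * c i) \<le> (\<Sum>i=1..k. \<integral>\<^sup>+\<theta>. R i (\<lambda>l. cl (\<theta> l)) \<partial>PiM ?I (\<lambda>_. \<pi>))"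
    by (intro sum_mono coord)
  also have "\<dots> = (\<integral>\<^sup>+\<theta>. (\<Sum>i=1..k. R i (\<lambda>l. cl (\<theta> l))) \<partial>PiM ?I (\<lambda>_. \<pi>))"
    by (intro nn_integral_sum[symmetric] R_meas)
  also have "\<dots> \<le> (\<integral>\<^sup>+\<theta>. S \<partial>PiM ?I (\<lambda>_. \<pi>))" by (intro nn_integral_mono sum_le)
  also have "\<dots> = S"
  proof -
    interpret PI: prob_space "PiM ?I (\<lambda>_. \<pi>)" by (intro prob_space_PiM \<pi>_prob)
    show ?thesis unfolding nn_integral_const PI.emeasure_space_1 by simp
  qed
  finally have main: "(\<Sum>i=1..k. ennreal (C / z) * c i) \<le> S" .
  \<comment> \<open>The factor \<open>b powr u\<close> contains \<open>sqrt n\<close> to the power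
    -u, which the rescaling by \<open>real n powr (u/2)\<close> cancels exactly.\<close>
  have scale: "(1 - 1/k) powr u * sqrt (\<tau> / (2 * pi)) \<le> C / z * real n powr (u/2)"
  proof -
    have "sqrt n powr u = real n powr (u/2)" using n by (simp add: powr_half_sqrt[symmetric] powr_powr)
    then have "C * real n powr (u/2) = (1 - 1/k) powr u" unfolding C_def b_def using n k by (simp add: powr_divide)
    moreover have "sqrt (\<tau> / (2 * pi)) \<le> 1 / z"
    proof -
      have "1 / sqrt (2 * pi / \<tau>) \<le> 1 / z" using z \<tau> by (intro divide_left_mono mult_pos_pos) auto
      then show ?thesis using \<tau> by (simp add: real_sqrt_divide)
    qed
    ultimately show ?thesis
      using mult_left_mono[of "sqrt (\<tau> / (2 * pi))" "1/z" "(1 - 1/k) powr u"] by (simp add: field_simps)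
  qed
  have "(\<Sum>i=1..k. ennreal ((1 - 1/k) powr u * sqrt (\<tau> / (2 * pi))) * c i) \<le> (\<Sum>i=1..k. ennreal (C / z * real n powr (u/2)) * c i)"
    by (intro sum_mono mult_right_mono ennreal_leI scale) auto
  also have "\<dots> = (\<Sum>i=1..k. ennreal (C / z) * c i) * ennreal (real n powr (u/2))"
    unfolding sum_distrib_right
  proof (intro sum.cong refl)
    fix i
    have "ennreal (C / z * real n powr (u/2)) = ennreal (C / z) * ennreal (real n powr (u/2))"
      by (rule ennreal_mult'') simp
    then show "ennreal (C / z * real n powr (u/2)) * c i = ennreal (C / z) * c i * ennreal (real n powr (u/2))"
      by (simp only: mult_ac)
  qed
  also have "\<dots> \<le> S * ennreal (real n powr (u/2))" using main by (rule mult_right_mono) simp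
  finally show ?thesis .
qed

end

section \<open>Assembly of the limits in sample size, truncation level and prior precision\<close>

theorem theorem2:
  fixes k :: nat and \<epsilon> u :: real and Y :: "'b measure" and Q :: "nat \<Rightarrow> 'b measure"
  assumes "k \<ge> 2" and "\<epsilon> > 0" and "u \<ge> 1" and "ldp \<epsilon> k Y Q"
  shows "liminf (\<lambda>n. minimax_risk u k n Y Q * ennreal (real n powr (u / 2)))
           \<ge> ennreal (real k * C_u u * M_ke k \<epsilon> powr (u / 2))"
proof -
  let ?I = "{1..k}"
  let ?lim = "liminf (\<lambda>n. minimax_risk u k n Y Q * ennreal (real n powr (u / 2)))"
  have k1: "1 \<le> k" using assms by simp
  obtain \<mu> q where \<mu>: "prob_space \<mu>" "sets \<mu> = sets Y"
    and q: "\<And>i. i \<in> ?I \<Longrightarrow> q i \<in> borel_measurable \<mu>" "\<And>i y. i \<in> ?I \<Longrightarrow> 0 < q i y"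
      "\<And>i j y. i \<in> ?I \<Longrightarrow> j \<in> ?I \<Longrightarrow> q i y \<le> exp \<epsilon> * q j y" "\<And>y. (\<Sum>i=1..k. q i y) = real k"
      "\<And>i. i \<in> ?I \<Longrightarrow> Q i = density \<mu> (\<lambda>y. ennreal (q i y))"
    using ldp_densities[OF k1 assms(4)] by metis
  obtain v where v: "0 < v"
    "\<And>d. d \<in> {1..k-1} \<Longrightarrow> real d * (real k - real d) * (exp \<epsilon> - 1)\<^sup>2 \<le> v * (real d * exp \<epsilon> + real k - real d)\<^sup>2"
    "M_ke k \<epsilon> powr (u/2) = (1 - 1/real k) powr u * v powr (-(u/2))"
    using M_ke_powr[OF assms(1,2), of u] by metis
  have q_int: "(\<integral>y. q i y \<partial>\<mu>) = 1" if i: "i \<in> ?I" for i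
  proof -
    have "prob_space (Q i)" using assms(4) i by (auto simp: ldp_def is_mechanism_def)
    then have "emeasure (Q i) (space (Q i)) = 1" by (rule prob_space.emeasure_space_1)
    then have "(\<integral>\<^sup>+y. ennreal (q i y) \<partial>\<mu>) = 1"
      unfolding q(5)[OF i] using q(1)[OF i] by (simp add: emeasure_density cong: nn_integral_cong)
    then show ?thesis using q(1,2)[OF i] by (subst integral_eq_nn_integral) (auto simp: less_imp_le)
  qed
  interpret channel_densities \<mu> k q
    using \<mu>(1) assms(1) q q_int by (auto simp: channel_densities_def channel_densities_axioms_def)
  have sq_int: "integrable \<mu> (\<lambda>y. (q i y - 1)\<^sup>2)" if i: "i \<in> ?I" for i
  proof (rule integrable_bounded)
    show "\<bar>(q i y - 1)\<^sup>2\<bar> \<le> (real k)\<^sup>2" for y using power_mono[OF score_bound[OF i, of y], of 2] by simp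
  qed (use q(1)[OF i] in measurable)
  have info_nonneg: "0 \<le> info i" for i by (simp add: info_def)
  have info_sum: "(\<Sum>i=1..k. info i) \<le> real k * v"
  proof -
    have "(\<Sum>i=1..k. info i) = (\<integral>y. (\<Sum>i=1..k. (q i y - 1)\<^sup>2) \<partial>\<mu>)"
      unfolding info_def using sq_int by (subst Bochner_Integration.integral_sum) auto
    also have "\<dots> \<le> real k * v"
    proof (rule integral_le_const)
      show "integrable \<mu> (\<lambda>y. \<Sum>i=1..k. (q i y - 1)\<^sup>2)" using sq_int by (rule Bochner_Integration.integrable_sum)
      have "(\<Sum>i=1..k. (q i y - 1)\<^sup>2) \<le> real k * v" for y
        using k1 assms(2) v(1,2) q(2,3,4) by (intro sum_squared_deviation_le[where E="exp \<epsilon>"]) auto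
      then show "AE y in \<mu>. (\<Sum>i=1..k. (q i y - 1)\<^sup>2) \<le> real k * v" by simp
    qed
    finally show ?thesis .
  qed
  \<comment> \<open>The slack \<open>\<delta> < 1\<close> places \<open>c i\<close> strictly below
    the limiting product, so that it is exceeded already at some finite truncation level.\<close>
  have coordinatewise: "ennreal (\<Sum>i=1..k. (1 - 1/k) powr u * (\<delta> * (C_u u * (info i + \<tau>) powr (-(u/2))))) \<le> ?lim"
    if \<tau>: "0 < \<tau>" and l: "0 < \<delta>" "\<delta> < 1" for \<tau> \<delta> :: real
  proof -
    define W where "W i = info i + \<tau>" for i
    have W: "0 < W i" for i using info_nonneg[of i] \<tau> by (simp add: W_def)
    define G where "G i = W i powr (-(u+1)/2) * (2 powr ((u+1)/2) * Gamma ((u+1)/2))" for i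
    have G: "0 < G i" for i using W[of i] assms(3) unfolding G_def by (intro mult_pos_pos Gamma_real_pos) auto
    define c where "c i = ennreal (\<delta> * (sqrt (W i / \<tau>) * G i))" for i
    define L where "L m = 2 * real (Suc m)" for m
    have "\<forall>\<^sub>F m in sequentially. \<forall>i\<in>?I. c i <
       (\<integral>\<^sup>+z. ennreal (exp ((sqrt (info i) * z)\<^sup>2/(2*W i)) * max 0 (1 - 2*\<bar>sqrt (info i) * z\<bar>/(W i*L m))) \<partial>std_normal_distribution) *
       (\<integral>\<^sup>+\<theta>. ennreal (\<bar>\<theta>\<bar> powr u * exp (- W i * \<theta>\<^sup>2/2)) * indicator {-L m/2..L m/2} \<theta> \<partial>lborel)"
    proof (rule eventually_ball_finite, simp, rule ballI)
      fix i assume "i \<in> ?I"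
      have "2*\<bar>sqrt (info i) * z\<bar>/(W i*L m) = \<bar>sqrt (info i) * z\<bar>/(W i * real (Suc m))" for z m
      proof -
        have "W i * L m = 2 * (W i * real (Suc m))" by (simp add: L_def)
        then show ?thesis by (simp only:) (rule mult_divide_mult_cancel_left, simp)
      qed
      then have lim1: "(\<lambda>m. \<integral>\<^sup>+z. ennreal (exp ((sqrt (info i) * z)\<^sup>2/(2*W i)) * max 0 (1 - 2*\<bar>sqrt (info i) * z\<bar>/(W i*L m))) \<partial>std_normal_distribution)
          \<longlonglongrightarrow> ennreal (sqrt (W i / \<tau>))"
        using gaussian_exp_quadratic_tendsto[OF info_nonneg \<tau>, of i] unfolding W_def[symmetric] by simp
      have half: "-L m/2 = - real (Suc m)" "L m/2 = real (Suc m)" for m by (simp_all add: L_def)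
      have "(\<integral>\<^sup>+s. ennreal (\<bar>s\<bar> powr u * exp (- W i * s\<^sup>2/2)) \<partial>lborel) = ennreal (G i)"
        unfolding G_def using assms(3) W by (intro nn_integral_abs_powr_gaussian) auto
      then have lim2: "(\<lambda>m. \<integral>\<^sup>+\<theta>. ennreal (\<bar>\<theta>\<bar> powr u * exp (- W i * \<theta>\<^sup>2/2)) * indicator {-L m/2..L m/2} \<theta> \<partial>lborel) \<longlonglongrightarrow> ennreal (G i)"
        unfolding half using truncated_moment_tendsto[of u "W i"] by (simp only:)
      have pos: "0 < sqrt (W i / \<tau>)" using W[of i] \<tau> by simp
      have "\<delta> * (sqrt (W i / \<tau>) * G i) < 1 * (sqrt (W i / \<tau>) * G i)"
        using pos G[of i] l by (intro mult_strict_right_mono mult_pos_pos) auto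
      then have "c i < ennreal (sqrt (W i / \<tau>)) * ennreal (G i)"
        unfolding c_def using pos G[of i] l by (subst ennreal_mult[symmetric]) (auto intro!: ennreal_lessI mult_pos_pos)
      then show "\<forall>\<^sub>F m in sequentially. c i <
       (\<integral>\<^sup>+z. ennreal (exp ((sqrt (info i) * z)\<^sup>2/(2*W i)) * max 0 (1 - 2*\<bar>sqrt (info i) * z\<bar>/(W i*L m))) \<partial>std_normal_distribution) *
       (\<integral>\<^sup>+\<theta>. ennreal (\<bar>\<theta>\<bar> powr u * exp (- W i * \<theta>\<^sup>2/2)) * indicator {-L m/2..L m/2} \<theta> \<partial>lborel)"
        using pos G[of i] by (intro order_tendstoD(1)[OF tendsto_mult_ennreal[OF lim1 lim2]]) auto
    qed
    \<comment> \<open>A common truncation level for the finitely many coordinates, so that one prior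
      serves them all.\<close>
    then obtain m where m: "\<And>i. i \<in> ?I \<Longrightarrow> c i <
       (\<integral>\<^sup>+z. ennreal (exp ((sqrt (info i) * z)\<^sup>2/(2*W i)) * max 0 (1 - 2*\<bar>sqrt (info i) * z\<bar>/(W i*L m))) \<partial>std_normal_distribution) *
       (\<integral>\<^sup>+\<theta>. ennreal (\<bar>\<theta>\<bar> powr u * exp (- W i * \<theta>\<^sup>2/2)) * indicator {-L m/2..L m/2} \<theta> \<partial>lborel)"
      unfolding eventually_sequentially by blast
    have L: "0 < L m" by (simp add: L_def)
    have cond: "\<forall>\<^sub>F n in sequentially. \<forall>i\<in>?I. \<forall>\<theta>\<in>parameter_box (L m). \<theta> i = 0 \<longrightarrow> (\<forall>T\<in>borel_measurable (PiM {..<n} (\<lambda>_. \<mu>)).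
      c i \<le> (\<integral>\<^sup>+t. (\<integral>\<^sup>+y. ennreal (\<bar>T y - t\<bar> powr u) \<partial>PiM {..<n} (\<lambda>_. model n (\<theta>(i := t))))
       * (ennreal (exp (- \<tau> * t\<^sup>2/2)) * indicator {-L m..L m} t) \<partial>lborel))"
    proof (rule eventually_ball_finite, simp, rule ballI)
      fix i assume i: "i \<in> ?I"
      show "\<forall>\<^sub>F n in sequentially. \<forall>\<theta>\<in>parameter_box (L m). \<theta> i = 0 \<longrightarrow> (\<forall>T\<in>borel_measurable (PiM {..<n} (\<lambda>_. \<mu>)).
      c i \<le> (\<integral>\<^sup>+t. (\<integral>\<^sup>+y. ennreal (\<bar>T y - t\<bar> powr u) \<partial>PiM {..<n} (\<lambda>_. model n (\<theta>(i := t))))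
       * (ennreal (exp (- \<tau> * t\<^sup>2/2)) * indicator {-L m..L m} t) \<partial>lborel))"
        by (rule conditional_bayes_risk_lower[OF i \<tau> assms(3) L m[OF i, unfolded W_def]])
    qed
    have large: "\<forall>\<^sub>F n in sequentially. 4 * real k * L m \<le> sqrt (real n)"
    proof -
      have "filterlim (\<lambda>n. sqrt (real n)) at_top sequentially" by real_asymp
      then show ?thesis by (simp add: filterlim_at_top)
    qed
    let ?B = "\<Sum>i=1..k. ennreal ((1 - 1/k) powr u * sqrt (\<tau> / (2 * pi))) * c i"
    have "\<forall>\<^sub>F n in sequentially. ?B \<le> minimax_risk u k n Y Q * ennreal (real n powr (u/2))"
      using cond large eventually_ge_at_top[of 1]
    proof eventually_elim
      case (elim n)
      have x: "0 < real n powr (u/2)" using elim by simp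
      \<comment> \<open>The scale factor is moved to the left so that the bound can be proved for
        each estimator and passed to the infimum.\<close>
      have "?B * ennreal (1 / real n powr (u/2)) \<le> minimax_risk u k n Y Q"
        unfolding minimax_risk_def
      proof (rule INF_greatest)
        fix ph assume ph: "ph \<in> estimators k n Y"
        let ?S = "SUP p\<in>prob_simplex k. \<integral>\<^sup>+y. ennreal (lu_loss u k (\<lambda>i. ph y i - p i)) \<partial>PiM {..<n} (\<lambda>_. mix k Y Q p)"
        have "sets (PiM {..<n} (\<lambda>_. Y)) = sets (PiM {..<n} (\<lambda>_. \<mu>))" using \<mu>(2) by (intro sets_PiM_cong) auto
        then have ph': "(\<lambda>y. ph y i) \<in> borel_measurable (PiM {..<n} (\<lambda>_. \<mu>))" if "i \<in> ?I" for i
          using ph that by (auto simp: estimators_def cong: measurable_cong_sets)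
        have "?B \<le> ?S * ennreal (real n powr (u/2))"
        proof (rule bayes_risk_le_minimax[OF elim(3,2) L \<tau> _ ph'])
          fix \<theta> assume \<theta>: "\<theta> \<in> parameter_box (L m)"
          have p: "point n \<theta> \<in> prob_simplex k" by (rule point_simplex[OF \<theta> elim(2,3)])
          have "mix k Y Q (point n \<theta>) = model n \<theta>"
            unfolding model_def point_dens[symmetric]
            using q p by (intro mix_eq_density \<mu>(2)) (auto simp: prob_simplex_def less_imp_le)
          then show "(\<integral>\<^sup>+y. ennreal (lu_loss u k (\<lambda>i. ph y i - point n \<theta> i)) \<partial>PiM {..<n} (\<lambda>_. model n \<theta>)) \<le> ?S"
            using SUP_upper[OF p, of "\<lambda>p. \<integral>\<^sup>+y. ennreal (lu_loss u k (\<lambda>i. ph y i - p i)) \<partial>PiM {..<n} (\<lambda>_. mix k Y Q p)"] by simp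
        qed (use elim(1) in blast)
        then have "?B * ennreal (1 / real n powr (u/2)) \<le> ?S * ennreal (real n powr (u/2)) * ennreal (1 / real n powr (u/2))"
          by (rule mult_right_mono) simp
        also have "\<dots> = ?S" using x by (simp add: mult.assoc ennreal_mult'[symmetric])
        finally show "?B * ennreal (1 / real n powr (u/2)) \<le> ?S" .
      qed
      then have "?B * ennreal (1 / real n powr (u/2)) * ennreal (real n powr (u/2)) \<le> minimax_risk u k n Y Q * ennreal (real n powr (u/2))"
        by (rule mult_right_mono) simp
      then show ?case using x by (simp add: mult.assoc ennreal_mult'[symmetric])
    qed
    then have "?B \<le> ?lim" by (rule Liminf_bounded)
    moreover have "?B = ennreal (\<Sum>i=1..k. (1 - 1/k) powr u * (\<delta> * (C_u u * (info i + \<tau>) powr (-(u/2)))))"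
    proof -
      have summand: "(1 - 1/k) powr u * sqrt (\<tau> / (2 * pi)) * (\<delta> * (sqrt (W i / \<tau>) * G i)) =
          (1 - 1/k) powr u * (\<delta> * (C_u u * (info i + \<tau>) powr (-(u/2))))" for i
        using gaussian_constants[OF W \<tau>, of i u] unfolding G_def[symmetric] by (simp add: W_def mult_ac)
      have nonneg: "0 \<le> (1 - 1/k) powr u * sqrt (\<tau> / (2 * pi))" "0 \<le> \<delta> * (sqrt (W i / \<tau>) * G i)" for i
        using \<tau> l W[of i] G[of i] by (auto intro!: mult_nonneg_nonneg simp: less_imp_le)
      have "?B = (\<Sum>i=1..k. ennreal ((1 - 1/k) powr u * sqrt (\<tau> / (2 * pi)) * (\<delta> * (sqrt (W i / \<tau>) * G i))))"
        unfolding c_def using nonneg by (intro sum.cong refl ennreal_mult[symmetric]) auto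
      also have "\<dots> = ennreal (\<Sum>i=1..k. (1 - 1/k) powr u * sqrt (\<tau> / (2 * pi)) * (\<delta> * (sqrt (W i / \<tau>) * G i)))"
        by (rule sum_ennreal) (rule mult_nonneg_nonneg[OF nonneg])
      finally show ?thesis unfolding summand .
    qed
    ultimately show ?thesis by simp
  qed
  have C: "0 \<le> C_u u" unfolding C_u_def using assms(3) by (intro divide_nonneg_nonneg mult_nonneg_nonneg less_imp_le[OF Gamma_real_pos]) auto
  \<comment> \<open>Here \<open>\<tau> = 1/(j+1)\<close> and \<open>\<delta> = 1 - 1/(j+2)\<close>;
    the shift by 2 keeps \<open>\<delta>\<close> positive at \<open>j = 0\<close>.\<close>
  define b where "b j = (1 - 1/k) powr u * ((1 - 1 / real (Suc (Suc j))) * (C_u u * (real k * (v + 1 / real (Suc j)) powr (-(u/2)))))" for j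
  have "ennreal (b j) \<le> ?lim" for j
  proof -
    let ?\<tau> = "1 / real (Suc j)" and ?l = "1 - 1 / real (Suc (Suc j))"
    have l: "0 < ?l" "?l < 1" by auto
    \<comment> \<open>Convexity is used while \<open>\<tau>\<close> is still positive, because
      \<open>info i\<close> may vanish; \<open>v\<close> is positive, so the limit in
      \<open>\<tau>\<close> is harmless afterwards.\<close>
    have "real (card ?I) * (v + ?\<tau>) powr (-(u/2)) \<le> (\<Sum>i\<in>?I. (info i + ?\<tau>) powr (-(u/2)))"
    proof (rule sum_powr_minus_ge)
      show "0 < info i + ?\<tau>" for i using info_nonneg[of i] by (simp add: add_nonneg_pos)
      show "(\<Sum>i\<in>?I. info i + ?\<tau>) \<le> real (card ?I) * (v + ?\<tau>)"
        using info_sum by (simp add: sum.distrib distrib_left)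
    qed (use assms(3) v(1) in \<open>auto simp: add_pos_pos\<close>)
    then have "b j \<le> (1 - 1/k) powr u * (?l * (C_u u * (\<Sum>i=1..k. (info i + ?\<tau>) powr (-(u/2)))))"
      unfolding b_def using l(1) C by (intro mult_left_mono) auto
    also have "\<dots> = (\<Sum>i=1..k. (1 - 1/k) powr u * (?l * (C_u u * (info i + ?\<tau>) powr (-(u/2)))))"
      by (simp only: sum_distrib_left)
    finally have "ennreal (b j) \<le> ennreal (\<Sum>i=1..k. (1 - 1/k) powr u * (?l * (C_u u * (info i + ?\<tau>) powr (-(u/2)))))"
      by (rule ennreal_leI)
    also have "\<dots> \<le> ?lim" using coordinatewise[of ?\<tau> ?l] l by simp
    finally show ?thesis .
  qed
  moreover have "(\<lambda>j. ennreal (b j)) \<longlonglongrightarrow> ennreal ((1 - 1/k) powr u * ((1 - 0) * (C_u u * (real k * (v + 0) powr (-(u/2))))))"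
    unfolding b_def using v(1)
    by (intro tendsto_ennrealI tendsto_mult tendsto_const tendsto_diff tendsto_powr tendsto_add LIMSEQ_Suc[OF lim_1_over_n]
        LIMSEQ_Suc[OF LIMSEQ_Suc[OF lim_1_over_n]]) auto
  ultimately have "ennreal ((1 - 1/k) powr u * ((1 - 0) * (C_u u * (real k * (v + 0) powr (-(u/2)))))) \<le> ?lim"
    by (intro LIMSEQ_le_const2[where X="\<lambda>j. ennreal (b j)"]) auto
  then show ?thesis unfolding v(3) by (simp add: mult_ac)
qed

end
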